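(* Let $m,d\in\mathbb N$ with $1\le m\le d$, let $\mathcal M$ be an $m$-dimensional $C^1$ manifold embedded in $\mathbb R^d$ with Riemannian volume measure $\nu$, and let $X,X_1,X_2,\ldots$ be independent random elements of $\mathcal M$ with common probability density $f:\mathcal M\to[0,\infty)$ with respect to $\nu$. Suppose that $f$ is bounded and has compact support. Put $\mathcal X_N=\{X_1,\ldots,X_N\}$, let $H(X)=-\int_{\mathcal M} f(x)\log f(x)\,\nu(dx)$ be the Shannon entropy of $X$, and let $\widehat H_{N,k}(\mathcal X_N)$ be the $k$-nearest neighbour entropy estimator. Then for every fixed integer $k\ge 1$, $$\mathbf E\left[\left(\widehat H_{N,k}(\mathcal X_N)-H(X)\right)^2\right]\to 0\quad\text{as } N\to\infty .$$
   Context: An $m$-dimensional $C^1$ manifold $\mathcal M$ embedded in $\mathbb R^d$: a nonempty subset $\mathcal M\subset\mathbb R^d$ (with the subspace topology) such that for each $y\in\mathcal M$ there are an open $U\subset\mathbb R^m$ and a continuously differentiable injection $g:U\to\mathbb R^d$ with $y\in g(U)\subset\mathcal M$, $g$ an open map from $U$ to $\mathcal M$, and $g'(u)$ of full rank for all $u\in U$. The measure $\nu$ is defined, for an atlas $((U_i,g_i))_{i\in I_0}$ and a subordinate partition of unity $(\psi_i)_{i\in I_0}$, by $\int_{\mathcal M}h\,d\nu=\sum_{i\in I_0}\int_{U_i}h(g_i(x))\psi_i(g_i(x))\sqrt{\det\left(J_{g_i}(x)^{T}J_{g_i}(x)\right)}\,dx$, where $J_{g_i}$ is the Jacobian matrix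 of $g_i$ (equivalently, $\nu$ is $m$-dimensional Hausdorff measure on $\mathcal M$). For a finite set $F\subset\mathbb R^d$ and a point $x$, $\rho_k(x,F)$ denotes the Euclidean distance between $x$ and its $k$th nearest neighbour in $F\setminus\{x\}$. For $N\ge k+1$ the $k$-nearest neighbour estimator of entropy is $$\widehat H_{N,k}(\mathcal X_N)=\frac1N\sum_{i=1}^N\log\left(\rho_k(X_i,\mathcal X_N)^m\,V_m\,(N-1)\,e^{-\psi(k)}\right),$$ with $V_m=\pi^{m/2}/\Gamma(1+m/2)$, $\psi(k)=\sum_{j=1}^{k-1}\frac1j-\gamma$, and $\gamma$ the Euler–Mascheroni constant. Convention: $0\log 0=0$. *)

theory Defs
  imports "HOL-Probability.Probability"
begin

(* The dimensions m and d are CARD('m) and CARD('d). *)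

definition C1_chart ::
    "(real ^ 'd) set \<Rightarrow> (real ^ 'm) set \<Rightarrow> (real ^ 'm \<Rightarrow> real ^ 'd) \<Rightarrow> bool" where
  "C1_chart M U g \<longleftrightarrow>
     open U \<and> inj_on g U \<and> g ` U \<subseteq> M \<and>
     g differentiable_on U \<and> continuous_on U (\<lambda>u. jacobian g (at u)) \<and>
     (\<forall>V. open V \<and> V \<subseteq> U \<longrightarrow> openin (top_of_set M) (g ` V)) \<and>
     (\<forall>u\<in>U. rank (jacobian g (at u)) = CARD('m))"

(* The type argument supplies the dimension m, which M alone does not determine. *)
definition C1_manifold :: "'m::finite itself \<Rightarrow> (real ^ 'd) set \<Rightarrow> bool" where
  "C1_manifold (_ :: 'm::finite itself) M \<longleftrightarrow>
     M \<noteq> {} \<and> (\<forall>y\<in>M. \<exists>(U :: (real ^ 'm) set) g. C1_chart M U g \<and> y \<in> g ` U)"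

definition C1_atlas ::
    "(real ^ 'd) set \<Rightarrow> 'i set \<Rightarrow> ('i \<Rightarrow> (real ^ 'm) set) \<Rightarrow> ('i \<Rightarrow> real ^ 'm \<Rightarrow> real ^ 'd) \<Rightarrow> bool" where
  "C1_atlas M I U g \<longleftrightarrow> (\<forall>i\<in>I. C1_chart M (U i) (g i)) \<and> (\<Union>i\<in>I. g i ` U i) = M"

(* As in the library's subordinate_partition_of_unity, subordinate means that p i vanishes
   off the range of the i-th chart.  This includes the partitions for which the closed
   support of p i lies in that range. *)
definition partition_of_unity ::
    "(real ^ 'd) set \<Rightarrow> 'i set \<Rightarrow> ('i \<Rightarrow> (real ^ 'm) set) \<Rightarrow> ('i \<Rightarrow> real ^ 'm \<Rightarrow> real ^ 'd) \<Rightarrow>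
     ('i \<Rightarrow> real ^ 'd \<Rightarrow> real) \<Rightarrow> bool" where
  "partition_of_unity M I U g p \<longleftrightarrow>
     (\<forall>i\<in>I. continuous_on M (p i) \<and> (\<forall>y\<in>M. 0 \<le> p i y) \<and> (\<forall>y \<in> M - g i ` U i. p i y = 0)) \<and>
     (\<forall>y\<in>M. \<exists>W. openin (top_of_set M) W \<and> y \<in> W \<and> finite {i\<in>I. \<exists>z\<in>W. p i z \<noteq> 0}) \<and>
     (\<forall>y\<in>M. (\<Sum>i | i \<in> I \<and> p i y \<noteq> 0. p i y) = 1)"

(* The Borel measure nu on M with
     int h dnu = sum_i int_(U_i) h(g_i(x)) p_i(g_i(x)) sqrt(det(J_(g_i)(x)^T J_(g_i)(x))) dx
   for every nonnegative Borel h (the indicators alone determine nu).  The sum over I is the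
   integral with respect to counting measure, so I need not be finite. *)
definition volume_measure ::
    "(real ^ 'd) set \<Rightarrow> 'i set \<Rightarrow> ('i \<Rightarrow> (real ^ 'm) set) \<Rightarrow> ('i \<Rightarrow> real ^ 'm \<Rightarrow> real ^ 'd) \<Rightarrow>
     ('i \<Rightarrow> real ^ 'd \<Rightarrow> real) \<Rightarrow> (real ^ 'd) measure \<Rightarrow> bool" where
  "volume_measure M I U g p \<nu> \<longleftrightarrow>
     space \<nu> = M \<and> sets \<nu> = sets (restrict_space borel M) \<and>
     (\<forall>h \<in> borel_measurable \<nu>.
        (\<integral>\<^sup>+y. h y \<partial>\<nu>) =
        (\<integral>\<^sup>+i. (\<integral>\<^sup>+x\<in>U i. h (g i x) *
             ennreal (p i (g i x) *
               sqrt (det (transpose (jacobian (g i) (at x)) ** jacobian (g i) (at x)))) \<partial>lborel)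
          \<partial>count_space I))"

definition shannon_entropy :: "'a measure \<Rightarrow> ('a \<Rightarrow> real) \<Rightarrow> real" where
  "shannon_entropy \<nu> f = - (\<integral>x. f x * ln (f x) \<partial>\<nu>)"

(* Distances are counted with multiplicity.  The value 0 when F - {x} has fewer than k points
   is a convention. *)
definition nn_dist :: "nat \<Rightarrow> 'a::metric_space \<Rightarrow> 'a set \<Rightarrow> real" where
  "nn_dist k x F =
     (if k \<le> card (F - {x})
      then sorted_list_of_multiset (image_mset (dist x) (mset_set (F - {x}))) ! (k - 1)
      else 0)"

definition knn_psi :: "nat \<Rightarrow> real" where
  "knn_psi k = (\<Sum>j=1..<k. 1 / real j) - euler_mascheroni"

(* x 1, ..., x N is the sample; the index 0 is not used. *)
definition knn_entropy :: "nat \<Rightarrow> nat \<Rightarrow> nat \<Rightarrow> (nat \<Rightarrow> 'a::metric_space) \<Rightarrow> real" where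
  "knn_entropy m k N x =
     (1 / real N) * (\<Sum>i=1..N.
        ln (nn_dist k (x i) (x ` {1..N}) ^ m * unit_ball_vol (real m) * (real N - 1)
            * exp (- knn_psi k)))"

end

theory Submission
  imports Defs
begin

text \<open>
  Write \<open>\<rho>\<^sub>i\<close> for the distance from \<open>X\<^sub>i\<close> to its \<open>k\<close>th nearest neighbour, \<open>W\<^sub>i = V\<^sub>m (N - 1) \<rho>\<^sub>i\<^sup>m\<close>,
  and \<open>F\<^sub>N(s)\<close> for the proportion of the indices \<open>i \<le> N\<close> with \<open>ln W\<^sub>i > s\<close>. Since \<open>a\<close> is the integral over \<open>s\<close> of
  \<open>1{s < a} - 1{s \<le> 0}\<close>, the error of the estimator is the integral of \<open>F\<^sub>N - F\<close>, where
  \<open>F(s) = E p\<^sub>k(e\<^sup>s f(X))\<close> and \<open>p\<^sub>k(\<lambda>)\<close> is the probability that a Poisson variable of mean \<open>\<lambda>\<close> is less than \<open>k\<close>;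
  that the corresponding integral of \<open>p\<^sub>k(e\<^sup>s)\<close> is \<open>\<psi>(k)\<close> reduces to \<open>\<Gamma>'(1) = -\<gamma>\<close>. By the Cauchy-Schwarz inequality with weight
  \<open>exp (\<bar>s\<bar> / 2)\<close> and dominated convergence, it suffices that \<open>E (F\<^sub>N(s) - F(s))\<^sup>2\<close> is
  \<open>O(exp (- \<bar>s\<bar>))\<close> uniformly in \<open>N\<close> and tends to \<open>0\<close> for every \<open>s\<close>.

  The bound for \<open>s < 0\<close> holds because balls of radius \<open>r\<close> have mass \<open>O(r\<^sup>m)\<close>; that for \<open>s > 0\<close>
  is deterministic, because the support is covered by \<open>O(r\<^sup>-\<^sup>m)\<close> sets of diameter at most \<open>r\<close> and at most \<open>k\<close> points of
  each have \<open>\<rho>\<^sub>i > r\<close>. For the limit, the mass of the ball of radius \<open>r\<close> divided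
  by \<open>V\<^sub>m r\<^sup>m\<close> converges to \<open>f\<close> in \<open>L\<^sup>1\<close>, and the numbers of points in two disjoint balls are negatively
  dependent. The mass estimates come from local linearisation of the charts and from the invariance of \<open>\<nu>\<close>
  under change of charts.
\<close>

text \<open>Cutting the logarithm into levels trades \<open>ln W\<close>, which is unbounded in both
  directions, for indicators, and each level is a counting problem: with V_m (N - 1) r^m = e^s, the
  event \<open>ln W > s\<close> says that fewer than k of the other N - 1 points lie within r of the
  given point. Given the position x of that point the count is binomial with mean near e^s f(x),
  hence the Poisson limit. The density is only bounded and measurable, so ball masses can be
  compared with it in an averaged sense at best. Convergence in L^1 is the right mode, because a
  binomial probability with n trials is Lipschitz in the success probability with constant n, and n
  = e^s / (V_m r^m) is exactly the normalisation of the ball mass. The averages over balls are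
  bounded on L^1 uniformly in r, which reduces their convergence to continuous functions, where a
  limit at each centre is enough. The weight exp (|s| / 2) is chosen so that both its reciprocal and
  its product with the error bound exp (- |s|) are multiples of exp (- |s| / 2), which is
  integrable.\<close>

section \<open>Change of variables over finite index types\<close>

text \<open>The change of variables theorem of the library requires a well-ordered index type, so it is applied
  to a copy of the index type that carries an arbitrary well-order.\<close>

typedef 'a wo = "UNIV :: 'a set" by simp

lemma bij_Abs_wo: "bij Abs_wo" and bij_Rep_wo: "bij Rep_wo"
  by (rule o_bij[of Rep_wo] o_bij[of Abs_wo]; simp add: fun_eq_iff Abs_wo_inverse Rep_wo_inverse)+

instance wo :: (finite) finite
proof
  have "(UNIV :: 'a wo set) = range Abs_wo"
    using bij_Abs_wo by (auto simp: bij_def)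
  then show "finite (UNIV :: 'a wo set)"
    by (metis finite finite_imageI)
qed

definition wo_index :: "'a::finite wo \<Rightarrow> nat" where
  "wo_index = (SOME h. inj h)"

lemma inj_wo_index: "inj wo_index"
proof -
  have "\<exists>h :: 'a wo \<Rightarrow> nat. inj h"
    using finite_imp_inj_to_nat_seg[of "UNIV :: 'a wo set"] by auto
  then show ?thesis
    unfolding wo_index_def by (rule someI_ex)
qed

instantiation wo :: (finite) wellorder
begin

definition less_eq_wo :: "'a wo \<Rightarrow> 'a wo \<Rightarrow> bool" where
  "less_eq_wo x y \<longleftrightarrow> wo_index x \<le> wo_index y"

definition less_wo :: "'a wo \<Rightarrow> 'a wo \<Rightarrow> bool" where
  "less_wo x y \<longleftrightarrow> wo_index x < wo_index y"

instance
proof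
  fix x y z :: "'a wo"
  show "(x < y) = (x \<le> y \<and> \<not> y \<le> x)" "x \<le> x" "x \<le> y \<or> y \<le> x"
    by (auto simp: less_eq_wo_def less_wo_def)
  show "x \<le> z" if "x \<le> y" "y \<le> z"
    using that by (simp add: less_eq_wo_def)
  show "x = y" if "x \<le> y" "y \<le> x"
    using that by (simp add: less_eq_wo_def injD[OF inj_wo_index])
  show "P x" if step: "\<And>x. (\<And>y. y < x \<Longrightarrow> P y) \<Longrightarrow> P x" for P
  proof (induction "wo_index x" arbitrary: x rule: less_induct)
    case less
    then show ?case
      using step by (simp add: less_wo_def)
  qed
qed

end

section \<open>Reindexing of coordinates: Lebesgue measure and determinants\<close>

definition to_wo :: "'b ^ 'm::finite \<Rightarrow> 'b ^ 'm wo" where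
  "to_wo x = (\<chi> i. x $ Rep_wo i)"

definition of_wo :: "'b ^ 'm wo \<Rightarrow> 'b ^ 'm::finite" where
  "of_wo y = (\<chi> i. y $ Abs_wo i)"

lemma of_wo_to_wo [simp]: "of_wo (to_wo x) = x" and to_wo_of_wo [simp]: "to_wo (of_wo y) = y"
  by (simp_all add: to_wo_def of_wo_def vec_eq_iff Abs_wo_inverse Rep_wo_inverse)

lemma linear_to_wo: "linear (to_wo :: real ^ 'm::finite \<Rightarrow> _)"
  and linear_of_wo: "linear (of_wo :: _ \<Rightarrow> real ^ 'm::finite)"
  by (auto intro!: linearI simp: to_wo_def of_wo_def vec_eq_iff)

lemma borel_measurable_to_wo [measurable]: "(to_wo :: real ^ 'm::finite \<Rightarrow> _) \<in> borel_measurable borel"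
  and borel_measurable_of_wo [measurable]: "(of_wo :: _ \<Rightarrow> real ^ 'm::finite) \<in> borel_measurable borel"
  by (auto intro!: borel_measurable_continuous_onI linear_continuous_on linear_linear[THEN iffD2] 
      linear_to_wo linear_of_wo simp: linear_conv_bounded_linear[symmetric])

text \<open>Lebesgue measure is determined by its values on boxes, and the preimage of a box is the
  box with the same edges in another order.\<close>

lemma distr_of_wo: "distr lborel borel (of_wo :: _ \<Rightarrow> real ^ 'm::finite) = lborel"
proof (rule sym, rule lborel_eqI)
  fix l u :: "real ^ 'm"
  assume le: "\<And>b. b \<in> Basis \<Longrightarrow> l \<bullet> b \<le> u \<bullet> b"
  have le': "l $ i \<le> u $ i" for i
    using le[of "axis i 1"] by (simp add: inner_axis)
  have prod: "(\<Prod>b\<in>Basis. (v :: real ^ 'n::finite) \<bullet> b) = (\<Prod>i\<in>UNIV. v $ i)" for v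
    unfolding Basis_vec_def
    by (simp add: UNION_singleton_eq_range, subst prod.reindex)
       (auto simp: inj_on_def axis_eq_axis inner_axis)
  have "of_wo -` box l u = box (to_wo l) (to_wo u)"
  proof -
    have "(\<forall>i. l $ i < x $ Abs_wo i) \<longleftrightarrow> (\<forall>j. l $ Rep_wo j < x $ j)" for x
      by (metis Rep_wo_inverse Abs_wo_inverse UNIV_I)
    moreover have "(\<forall>i. x $ Abs_wo i < u $ i) \<longleftrightarrow> (\<forall>j. x $ j < u $ Rep_wo j)" for x
      by (metis Rep_wo_inverse Abs_wo_inverse UNIV_I)
    ultimately show ?thesis
      by (simp add: set_eq_iff mem_box_cart of_wo_def to_wo_def all_conj_distrib)
  qed
  then have "emeasure (distr lborel borel of_wo) (box l u) = emeasure lborel (box (to_wo l) (to_wo u))"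
    by (simp add: emeasure_distr)
  also have "\<dots> = (\<Prod>b\<in>Basis. (to_wo u - to_wo l) \<bullet> b)"
    unfolding emeasure_lborel_box_eq
    by (auto simp: Basis_vec_def inner_axis to_wo_def le')
  also have "(\<Prod>b\<in>Basis. (to_wo u - to_wo l) \<bullet> b) = (\<Prod>b\<in>Basis. (u - l) \<bullet> b)"
    unfolding prod by (simp add: to_wo_def) (rule prod.reindex_bij_betw[OF bij_Rep_wo])
  finally show "emeasure (distr lborel borel of_wo) (box l u) = (\<Prod>b\<in>Basis. (u - l) \<bullet> b)" .
qed simp

text \<open>Rows and columns are reindexed by the same bijection. In the Leibniz formula this
  conjugates each permutation, which changes neither its sign nor the product attached to
  it.\<close>

lemma det_to_wo:
  fixes A :: "real ^ 'm::finite ^ 'm"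
  shows "det (\<chi> i. to_wo (A $ Rep_wo i)) = det A"
proof -
  let ?c = "map_permutation UNIV (Abs_wo :: 'm \<Rightarrow> 'm wo)"
  have bij: "bij_betw ?c {p. p permutes UNIV} {p. p permutes UNIV}"
    by (rule bij_betw_byWitness[where f' = "map_permutation UNIV Rep_wo"])
       (auto simp: map_permutation_compose_inv[OF bij_Abs_wo] map_permutation_compose_inv[OF bij_Rep_wo]
          Abs_wo_inverse Rep_wo_inverse intro: map_permutation_permutes bij_Abs_wo bij_Rep_wo)
  have inj: "inj (Abs_wo :: 'm \<Rightarrow> 'm wo)"
    using bij_Abs_wo by (rule bij_is_inj)
  have range: "range (Abs_wo :: 'm \<Rightarrow> 'm wo) = UNIV"
    using bij_Abs_wo by (rule bij_is_surj)
  have inv: "inv (Abs_wo :: 'm \<Rightarrow> 'm wo) = Rep_wo"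
    by (rule inv_equality) (simp_all add: Abs_wo_inverse Rep_wo_inverse)
  have c: "?c p i = Abs_wo (p (Rep_wo i))" for p i
    unfolding map_permutation_def range inv by (simp add: restrict_id_def)
  have "det (\<chi> i. to_wo (A $ Rep_wo i)) =
        (\<Sum>p | p permutes UNIV. of_int (sign p) * (\<Prod>i\<in>UNIV. A $ Rep_wo i $ Rep_wo (p i)))"
    by (simp add: det_def to_wo_def)
  also have "\<dots> = (\<Sum>p | p permutes UNIV. of_int (sign (?c p)) *
                   (\<Prod>i\<in>UNIV. A $ Rep_wo i $ Rep_wo (?c p i)))"
    by (rule sum.reindex_bij_betw[OF bij, symmetric])
  also have "\<dots> = (\<Sum>p | p permutes UNIV. of_int (sign p) * (\<Prod>i\<in>UNIV. A $ i $ p i))"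
  proof (rule sum.cong, simp)
    fix p :: "'m \<Rightarrow> 'm" assume "p \<in> {p. p permutes UNIV}"
    then have "sign (?c p) = sign p"
      by (intro sign_map_permutation) (auto simp: inj)
    moreover have "(\<Prod>i\<in>UNIV. A $ Rep_wo i $ Rep_wo (?c p i)) = (\<Prod>i\<in>UNIV. A $ i $ p i)"
      unfolding c by (simp add: Abs_wo_inverse) (rule prod.reindex_bij_betw[OF bij_Rep_wo])
    ultimately show "of_int (sign (?c p)) * (\<Prod>i\<in>UNIV. A $ Rep_wo i $ Rep_wo (?c p i)) =
        of_int (sign p) * (\<Prod>i\<in>UNIV. A $ i $ p i)"
      by simp
  qed
  finally show ?thesis
    by (simp add: det_def)
qed

lemma det_matrix_to_wo:
  fixes h :: "real ^ 'm::finite \<Rightarrow> real ^ 'm"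
  shows "det (matrix (to_wo \<circ> h \<circ> of_wo)) = det (matrix h)"
proof -
  have "of_wo (axis j 1) = (axis (Rep_wo j) 1 :: real ^ 'm)" for j :: "'m wo"
  proof -
    have "Abs_wo i = j \<longleftrightarrow> i = Rep_wo j" for i
      using Abs_wo_inverse[of i] Rep_wo_inverse[of j] by auto
    then show ?thesis
      by (simp add: of_wo_def axis_def vec_eq_iff)
  qed
  then have "matrix (to_wo \<circ> h \<circ> of_wo) = (\<chi> i. to_wo (matrix h $ Rep_wo i))"
    by (simp add: matrix_def to_wo_def) 
  then show ?thesis
    by (simp add: det_to_wo)
qed

section \<open>Change of variables for nonnegative functions\<close>

lemma set_integrableI_nonneg:
  fixes f :: "'a \<Rightarrow> real"
  assumes "(\<lambda>x. indicator S x * f x) \<in> borel_measurable M" "\<And>x. x \<in> S \<Longrightarrow> 0 \<le> f x"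
    and "(\<integral>\<^sup>+x\<in>S. ennreal (f x) \<partial>M) < \<infinity>"
  shows "set_integrable M S f"
proof -
  have "(\<integral>\<^sup>+x. ennreal (indicator S x * f x) \<partial>M) = (\<integral>\<^sup>+x\<in>S. ennreal (f x) \<partial>M)"
    by (intro nn_integral_cong) (simp add: indicator_def)
  with assms show ?thesis
    unfolding set_integrable_def by (intro integrableI_nonneg) (auto simp: indicator_def)
qed

text \<open>The classical theorem concerns absolutely integrable functions, whereas infinite
  integrals must be allowed here. Both sides are integrals of \<open>h\<close> against a measure, so
  it suffices that two measures agree on Borel sets. \<open>D\<close> supplies a Borel version of
  the Jacobian, because \<open>\<phi>'\<close> is given pointwise and carries no
  measurability.\<close>

lemma nn_integral_change_of_variables_wellorder:
  fixes \<phi> :: "real ^ 'm::{finite,wellorder} \<Rightarrow> real ^ 'm::_" and h :: "real ^ 'm::_ \<Rightarrow> ennreal"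
  assumes S: "open S" and im: "open (\<phi> ` S)"
    and der: "\<And>x. x \<in> S \<Longrightarrow> (\<phi> has_derivative \<phi>' x) (at x)"
    and inj: "inj_on \<phi> S"
    and D: "D \<in> borel_measurable borel" "\<And>x. x \<in> S \<Longrightarrow> D x = \<bar>det (matrix (\<phi>' x))\<bar>"
    and h: "h \<in> borel_measurable borel"
  shows "(\<integral>\<^sup>+y\<in>\<phi> ` S. h y \<partial>lborel) = (\<integral>\<^sup>+x\<in>S. h (\<phi> x) * ennreal (D x) \<partial>lborel)"
proof -
  note [measurable] = borel_open[OF S] borel_open[OF im] D(1) h
  \<comment> \<open>\<open>\<phi>\<close> is arbitrary off \<open>S\<close>; \<open>\<psi>\<close>
    is a total Borel function that agrees with it on \<open>S\<close>.\<close>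
  define \<psi> where "\<psi> x = (if x \<in> S then \<phi> x else 0)" for x
  have "continuous_on S \<phi>"
    using der by (meson continuous_at_imp_continuous_on has_derivative_continuous)
  then have [measurable]: "\<psi> \<in> borel_measurable borel"
    unfolding \<psi>_def by (intro borel_measurable_continuous_on_if) auto
  let ?M1 = "density lborel (indicator (\<phi> ` S))"
  let ?M2 = "distr (density lborel (\<lambda>x. ennreal (D x) * indicator S x)) borel \<psi>"
  have "?M1 = ?M2"
  proof (rule measure_eqI)
    fix A :: "(real ^ 'm::_) set" assume "A \<in> sets ?M1"
    then have [measurable]: "A \<in> sets borel" by simp
    let ?f = "indicator A :: real ^ 'm::_ \<Rightarrow> real"
    let ?F = "\<lambda>x. \<bar>det (matrix (\<phi>' x))\<bar> * ?f (\<phi> x)"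
    let ?G = "\<lambda>x. D x * ?f (\<psi> x)"
    have FG: "?F x = ?G x" if "x \<in> S" for x
      using that D by (simp add: \<psi>_def)
    have D0: "0 \<le> D x" if "x \<in> S" for x
      using D that by simp
    have cv: "?F absolutely_integrable_on S \<and> integral S ?F = b \<longleftrightarrow>
        ?f absolutely_integrable_on (\<phi> ` S) \<and> integral (\<phi> ` S) ?f = b" for b
    proof -
      have S': "S \<in> sets lebesgue" using S by simp
      \<comment> \<open>The theorem is about vector-valued functions, so the real indicator is
        embedded into \<open>real ^ 1\<close> by \<open>vec\<close>.\<close>
      have "(\<lambda>x. \<bar>det (matrix (\<phi>' x))\<bar> *\<^sub>R (vec (?f (\<phi> x)) :: real ^ 1)) absolutely_integrable_on S \<and>
         integral S (\<lambda>x. \<bar>det (matrix (\<phi>' x))\<bar> *\<^sub>R vec (?f (\<phi> x))) = (vec b :: real ^ 1) \<longleftrightarrow>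
        (\<lambda>x. vec (?f x) :: real ^ 1) absolutely_integrable_on (\<phi> ` S) \<and>
         integral (\<phi> ` S) (\<lambda>x. vec (?f x)) = (vec b :: real ^ 1)"
        using der by (intro has_absolute_integral_change_of_variables[OF S' _ inj]) (auto intro: has_derivative_at_withinI)
      then show ?thesis
        by (simp add: absolutely_integrable_on_1_iff integral_on_1_eq)
    qed
    have abs_int: "(q has_integral integral B q) B"
      if "q absolutely_integrable_on B" for q :: "real ^ 'm::_ \<Rightarrow> real" and B
      using that by (simp add: has_integral_integral[symmetric] set_lebesgue_integral_eq_integral)
    have L: "emeasure ?M1 A = (\<integral>\<^sup>+x. ennreal (?f x) * indicator (\<phi> ` S) x \<partial>lborel)"
      by (subst emeasure_density) (auto simp: indicator_def intro!: nn_integral_cong)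
    have R: "emeasure ?M2 A = (\<integral>\<^sup>+x. ennreal (?G x) * indicator S x \<partial>lborel)"
    proof -
      have "\<psi> -` A \<in> sets borel"
        using measurable_sets[of \<psi> borel borel A] by simp
      then show ?thesis
        by (subst emeasure_distr; simp; subst emeasure_density)
           (auto simp: indicator_def D0 intro!: nn_integral_cong)
    qed
    have R': "emeasure ?M2 A = (\<integral>\<^sup>+x. ennreal (?F x) * indicator S x \<partial>lborel)"
      unfolding R
    proof (rule nn_integral_cong)
      show "ennreal (?G x) * indicator S x = ennreal (?F x) * indicator S x" for x
        by (cases "x \<in> S") (simp_all only: FG indicator_simps mult_zero_right not_False_eq_True)
    qed
    \<comment> \<open>Finiteness of either measure on \<open>A\<close> gives integrability on that
      side, and the equivalence \<open>cv\<close> carries it to the other side with the same value.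
      Two infinite values are equal anyway.\<close>
    consider (fin1) "emeasure ?M1 A < \<infinity>" | (fin2) "emeasure ?M2 A < \<infinity>"
      | (inf) "emeasure ?M1 A = \<infinity>" "emeasure ?M2 A = \<infinity>"
      by (metis infinity_ennreal_def less_top)
    then show "emeasure ?M1 A = emeasure ?M2 A"
    proof cases
      case fin1
      then have "set_integrable lborel (\<phi> ` S) ?f"
        unfolding L by (intro set_integrableI_nonneg) auto
      then have "?f absolutely_integrable_on (\<phi> ` S)"
        unfolding set_integrable_def by (simp add: integrable_completion)
      then have "(?f has_integral integral (\<phi> ` S) ?f) (\<phi> ` S)" "(?F has_integral integral (\<phi> ` S) ?f) S"
        using cv[of "integral (\<phi> ` S) ?f"] abs_int[of "\<phi> ` S" ?f] abs_int[of S ?F]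
        by auto
      then show ?thesis
        unfolding L R' by (simp add: nn_integral_has_integral_lebesgue')
    next
      case fin2
      then have "set_integrable lborel S ?G"
        unfolding R by (intro set_integrableI_nonneg) (auto simp: D0)
      then have "?G absolutely_integrable_on S"
        unfolding set_integrable_def by (simp add: integrable_completion)
      then have "?F absolutely_integrable_on S"
        by (rule set_integrable_cong[THEN iffD1, rotated -1]) (auto simp: FG)
      then have "(?f has_integral integral S ?F) (\<phi> ` S)" "(?F has_integral integral S ?F) S"
        using cv[of "integral S ?F"] abs_int[of "\<phi> ` S" ?f] abs_int[of S ?F]
        by auto
      then show ?thesis
        unfolding L R' by (simp add: nn_integral_has_integral_lebesgue')
    qed simp
  qed simp
  have "(\<integral>\<^sup>+y\<in>\<phi> ` S. h y \<partial>lborel) = (\<integral>\<^sup>+y. h y \<partial>?M1)"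
    by (subst nn_integral_density) (auto simp: mult.commute)
  also have "\<dots> = (\<integral>\<^sup>+y. h y \<partial>?M2)"
    using \<open>?M1 = ?M2\<close> by simp
  also have "\<dots> = (\<integral>\<^sup>+x. ennreal (D x) * indicator S x * h (\<psi> x) \<partial>lborel)"
    by (simp add: nn_integral_distr nn_integral_density)
  also have "\<dots> = (\<integral>\<^sup>+x\<in>S. h (\<phi> x) * ennreal (D x) \<partial>lborel)"
    by (intro nn_integral_cong) (simp add: \<psi>_def indicator_def mult.commute)
  finally show ?thesis .
qed

lemma nn_integral_of_wo:
  fixes h :: "real ^ 'm::finite \<Rightarrow> ennreal"
  assumes "h \<in> borel_measurable borel"
  shows "(\<integral>\<^sup>+x. h x \<partial>lborel) = (\<integral>\<^sup>+y. h (of_wo y) \<partial>lborel)"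
  using assms by (subst distr_of_wo[symmetric]) (simp add: nn_integral_distr)

text \<open>Conjugation by the reindexing turns \<open>\<phi>\<close> into a map over a well-ordered
  index type. It preserves Lebesgue measure and the determinant of the derivative, so both sides are
  unchanged.\<close>

lemma nn_integral_change_of_variables:
  fixes \<phi> :: "real ^ 'm::finite \<Rightarrow> real ^ 'm" and h :: "real ^ 'm \<Rightarrow> ennreal"
  assumes S: "open S" and im: "open (\<phi> ` S)"
    and der: "\<And>x. x \<in> S \<Longrightarrow> (\<phi> has_derivative \<phi>' x) (at x)"
    and inj: "inj_on \<phi> S"
    and D: "D \<in> borel_measurable borel" "\<And>x. x \<in> S \<Longrightarrow> D x = \<bar>det (matrix (\<phi>' x))\<bar>"
    and h: "h \<in> borel_measurable borel"
  shows "(\<integral>\<^sup>+y\<in>\<phi> ` S. h y \<partial>lborel) = (\<integral>\<^sup>+x\<in>S. h (\<phi> x) * ennreal (D x) \<partial>lborel)"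
proof -
  note [measurable] = borel_open[OF S] borel_open[OF im] D(1) h
  have cont: "continuous_on S \<phi>"
    using der by (meson continuous_at_imp_continuous_on has_derivative_continuous)
  have cont_of: "continuous_on B (of_wo :: _ \<Rightarrow> real ^ 'm)" for B
    by (auto intro!: linear_continuous_on simp: linear_conv_bounded_linear[symmetric] linear_of_wo)
  let ?\<phi> = "to_wo \<circ> \<phi> \<circ> of_wo" and ?S = "of_wo -` S"
  have S': "open ?S"
    using cont_of[of UNIV] S by (simp add: open_vimage)
  have im_eq: "?\<phi> ` ?S = of_wo -` (\<phi> ` S)"
    by (auto simp: image_iff) (metis of_wo_to_wo to_wo_of_wo vimage_eq)
  have im': "open (?\<phi> ` ?S)"
    unfolding im_eq using cont_of[of UNIV] im by (simp add: open_vimage)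
  have der': "(?\<phi> has_derivative (to_wo \<circ> \<phi>' (of_wo y) \<circ> of_wo)) (at y)" if "y \<in> ?S" for y
  proof -
    have "((\<phi> \<circ> of_wo) has_derivative (\<phi>' (of_wo y) \<circ> of_wo)) (at y)"
      using that linear_of_wo by (intro diff_chain_at linear_imp_has_derivative der) auto
    then have "((to_wo \<circ> (\<phi> \<circ> of_wo)) has_derivative (to_wo \<circ> (\<phi>' (of_wo y) \<circ> of_wo))) (at y)"
      by (rule diff_chain_at) (rule linear_imp_has_derivative, rule linear_to_wo)
    then show ?thesis
      by (simp add: o_assoc)
  qed
  have inj': "inj_on ?\<phi> ?S"
    using inj by (auto simp: inj_on_def) (metis of_wo_to_wo to_wo_of_wo)
  define \<psi> where "\<psi> x = (if x \<in> S then \<phi> x else 0)" for x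
  have [measurable]: "\<psi> \<in> borel_measurable borel"
    unfolding \<psi>_def using cont by (intro borel_measurable_continuous_on_if) auto
  have "(\<integral>\<^sup>+y\<in>\<phi> ` S. h y \<partial>lborel) = (\<integral>\<^sup>+y\<in>?\<phi> ` ?S. h (of_wo y) \<partial>lborel)"
    unfolding im_eq by (subst nn_integral_of_wo) (auto simp: indicator_def)
  also have "\<dots> = (\<integral>\<^sup>+y\<in>?S. h (of_wo (?\<phi> y)) * ennreal (D (of_wo y)) \<partial>lborel)"
    by (rule nn_integral_change_of_variables_wellorder[OF S' im' der' inj'])
       (use D(2) in \<open>auto simp: det_matrix_to_wo\<close>)
  also have "\<dots> = (\<integral>\<^sup>+y. h (\<psi> (of_wo y)) * ennreal (D (of_wo y)) * indicator S (of_wo y) \<partial>lborel)"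
    by (intro nn_integral_cong) (auto simp: \<psi>_def indicator_def)
  also have "\<dots> = (\<integral>\<^sup>+x. h (\<psi> x) * ennreal (D x) * indicator S x \<partial>lborel)"
    by (rule nn_integral_of_wo[symmetric]) simp
  also have "\<dots> = (\<integral>\<^sup>+x\<in>S. h (\<phi> x) * ennreal (D x) \<partial>lborel)"
    by (intro nn_integral_cong) (auto simp: \<psi>_def indicator_def)
  finally show ?thesis .
qed

lemma emeasure_linear_vimage_cball:
  fixes T :: "real ^ 'm::finite \<Rightarrow> real ^ 'm"
  assumes T: "linear T" and inj: "inj T" and r: "0 \<le> r"
  shows "emeasure lborel {u. norm (T u) \<le> r} =
           ennreal (unit_ball_vol (real CARD('m)) * r ^ CARD('m) / \<bar>det (matrix T)\<bar>)"
proof -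
  let ?c = "\<bar>det (matrix T)\<bar>"
  have c: "0 < ?c"
    using det_nz_iff_inj[OF T] inj by simp
  have surj: "range T = UNIV"
    using linear_injective_imp_surjective[OF T inj] by simp
  have [measurable]: "T \<in> borel_measurable borel"
    using T by (intro borel_measurable_continuous_onI linear_continuous_on) (simp add: linear_conv_bounded_linear)
  have "(\<integral>\<^sup>+y\<in>range T. indicator (cball 0 r) y \<partial>lborel) =
        (\<integral>\<^sup>+x\<in>UNIV. indicator (cball 0 r) (T x) * ennreal ?c \<partial>lborel)"
    using T inj by (intro nn_integral_change_of_variables[where \<phi>' = "\<lambda>_. T"])
      (auto simp: surj linear_imp_has_derivative intro!: borel_measurable_indicator)
  then have "emeasure lborel (cball (0 :: real ^ 'm) r) = 
     (\<integral>\<^sup>+x. ennreal ?c * indicator {u. norm (T u) \<le> r} x \<partial>lborel)"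
    by (simp add: surj indicator_def[of "{u. norm (T u) \<le> r}"] indicator_def[of _ "T _"] mult.commute)
  also have "\<dots> = ennreal ?c * emeasure lborel {u. norm (T u) \<le> r}"
    by (subst nn_integral_cmult) auto
  finally have eq: "ennreal (unit_ball_vol (real CARD('m)) * r ^ CARD('m)) = ennreal ?c * emeasure lborel {u. norm (T u) \<le> r}"
    using r by (simp add: emeasure_cball)
  have "emeasure lborel {u. norm (T u) \<le> r} = ennreal (1 / ?c) * (ennreal ?c * emeasure lborel {u. norm (T u) \<le> r})"
    unfolding mult.assoc[symmetric] ennreal_mult'[symmetric]
    using c by (simp add: ennreal_mult[symmetric])
  also have "\<dots> = ennreal (unit_ball_vol (real CARD('m)) * r ^ CARD('m) / ?c)"
    unfolding eq[symmetric] using c r by (subst ennreal_mult[symmetric]) auto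
  finally show ?thesis .
qed

section \<open>Charts\<close>

text \<open>The range of \<open>A\<close> is isometric to \<open>real ^ 'm\<close>, and
  \<open>T\<close> is \<open>A\<close> followed by such an isometry. Equal norms give equal inner
  products by polarisation, hence equal Gram matrices, and for the square matrix of \<open>T\<close>
  the Gram determinant is the square of the determinant. Volume elements in the ambient space thus
  become ordinary Jacobians.\<close>

lemma gram_factor:
  fixes A :: "real ^ 'm::finite ^ 'd::finite"
  assumes inj: "inj ((*v) A)"
  obtains T :: "real ^ 'm \<Rightarrow> real ^ 'm"
  where "linear T" "inj T" "\<And>u. norm (T u) = norm (A *v u)"
    "\<bar>det (matrix T)\<bar> = sqrt (det (transpose A ** A))"
proof -
  have lin: "linear ((*v) A)" by simp
  have sub: "subspace (range ((*v) A))"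
    using lin by (simp add: linear_subspace_image)
  have "dim (range ((*v) A)) = dim (UNIV :: (real ^ 'm) set)"
    using inj by (simp add: dim_image_eq)
  from isometries_subspaces[OF sub subspace_UNIV this] obtain f :: "real ^ 'd \<Rightarrow> real ^ 'm"
    where f: "linear f" "\<And>x. x \<in> range ((*v) A) \<Longrightarrow> norm (f x) = norm x"
    by metis
  define T where "T u = f (A *v u)" for u
  have norm: "norm (T u) = norm (A *v u)" for u
    by (simp add: T_def f)
  have linT: "linear T"
    unfolding T_def using linear_compose[OF lin f(1)] by (simp add: o_def)
  have injT: "inj T"
    using norm inj by (metis injI linT lin linear_injective_0 norm_eq_zero)
  have inner: "T u \<bullet> T v = (A *v u) \<bullet> (A *v v)" for u v
    unfolding dot_norm
    by (metis norm linear_add[OF linT] linear_add[OF lin])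
  have gram: "((transpose B ** B) *v y) \<bullet> x = (B *v y) \<bullet> (B *v x)" for B :: "real ^ 'm ^ 'k::finite" and x y
    by (simp only: matrix_vector_mul_assoc[symmetric] transpose_matrix_vector dot_lmul_matrix)
  have "transpose A ** A = transpose (matrix T) ** matrix T"
    unfolding matrix_eq
  proof (intro allI, rule vector_eq_rdot[THEN iffD1], intro allI)
    show "((transpose A ** A) *v y) \<bullet> x = ((transpose (matrix T) ** matrix T) *v y) \<bullet> x" for x y
      unfolding gram matrix_vector_mul(2)[OF linT] by (simp only: inner)
  qed
  then have "det (transpose A ** A) = (det (matrix T))\<^sup>2"
    by (simp add: det_mul det_transpose power2_eq_square)
  then show thesis
    using that[OF linT injT norm] by simp
qed

definition chart_density :: "(real ^ 'm::finite \<Rightarrow> real ^ 'd::finite) \<Rightarrow> real ^ 'm \<Rightarrow> real" where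
  "chart_density g x = sqrt (det (transpose (jacobian g (at x)) ** jacobian g (at x)))"

context
  fixes M :: "(real ^ 'd::finite) set" and U :: "(real ^ 'm::finite) set" and g
  assumes chart: "C1_chart M U g"
begin

lemma chart_open: "open U" and chart_inj: "inj_on g U" and chart_image: "g ` U \<subseteq> M"
  and chart_jacobian_continuous: "continuous_on U (\<lambda>u. jacobian g (at u))"
  and chart_openin: "open V \<Longrightarrow> V \<subseteq> U \<Longrightarrow> openin (top_of_set M) (g ` V)"
  and chart_jacobian_inj: "u \<in> U \<Longrightarrow> inj ((*v) (jacobian g (at u)))"
  using chart by (auto simp: C1_chart_def full_rank_injective)

lemma chart_derivative: "u \<in> U \<Longrightarrow> (g has_derivative (*v) (jacobian g (at u))) (at u)"
  using chart by (auto simp: C1_chart_def differentiable_on_eq_differentiable_at jacobian_works)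

lemma chart_continuous: "continuous_on U g"
  using chart_derivative by (meson continuous_at_imp_continuous_on has_derivative_continuous)

lemma chart_density_pos: "u \<in> U \<Longrightarrow> 0 < chart_density g u"
proof -
  assume "u \<in> U"
  then obtain T :: "real ^ 'm \<Rightarrow> real ^ 'm" where T: "linear T" "inj T"
    "\<bar>det (matrix T)\<bar> = sqrt (det (transpose (jacobian g (at u)) ** jacobian g (at u)))"
    using gram_factor[OF chart_jacobian_inj] by metis
  moreover have "det (matrix T) \<noteq> 0"
    using T by (simp add: det_nz_iff_inj)
  ultimately show ?thesis
    unfolding chart_density_def by (metis zero_less_abs_iff)
qed

lemma chart_density_continuous: "continuous_on U (chart_density g)"
  unfolding chart_density_def det_def matrix_matrix_mult_def transpose_def
  using chart_jacobian_continuous by (simp, intro continuous_intros)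

text \<open>Differentiability at \<open>u0\<close> would only compare points with \<open>u0\<close>.
  Continuity of the Jacobian makes the derivative of \<open>g\<close> minus its linearisation small
  on a whole ball, and the mean value inequality then compares any two points of it.\<close>

lemma chart_local_linear:
  assumes u0: "u0 \<in> U" and e: "0 < e"
  obtains \<delta> where "0 < \<delta>" "cball u0 \<delta> \<subseteq> U"
    "\<And>u v. u \<in> cball u0 \<delta> \<Longrightarrow> v \<in> cball u0 \<delta> \<Longrightarrow>
       norm (g u - g v - jacobian g (at u0) *v (u - v)) \<le> e * norm (u - v)"
proof -
  let ?A = "jacobian g (at u0)"
  \<comment> \<open>The operator norm is at most the number of entries times a bound for the
    entries, so an error of \<open>e / ?n\<close> in each entry suffices.\<close>
  let ?n = "real CARD('d) * real CARD('m)"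
  have "isCont (\<lambda>u. jacobian g (at u)) u0"
    using chart_jacobian_continuous chart_open u0 by (simp add: continuous_on_eq_continuous_at)
  moreover have "0 < e / ?n" using e by simp
  ultimately obtain d1 where d1: "0 < d1" "\<And>u. dist u u0 < d1 \<Longrightarrow> dist (jacobian g (at u)) ?A < e / ?n"
    unfolding continuous_at_eps_delta by (metis)
  obtain d2 where d2: "0 < d2" "cball u0 d2 \<subseteq> U"
    using chart_open u0 open_contains_cball by blast
  define \<delta> where "\<delta> = min (d1 / 2) d2"
  have \<delta>: "0 < \<delta>" "cball u0 \<delta> \<subseteq> U" "\<And>u. u \<in> cball u0 \<delta> \<Longrightarrow> dist u u0 < d1"
    using d1 d2 by (auto simp: \<delta>_def dist_commute)
  have "norm ((g u - ?A *v u) - (g v - ?A *v v)) \<le> e * norm (u - v)"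
    if uv: "u \<in> cball u0 \<delta>" "v \<in> cball u0 \<delta>" for u v
  proof (rule differentiable_bound[OF _ _ _ uv])
    fix w assume w: "w \<in> cball u0 \<delta>"
    let ?f' = "(*v) (jacobian g (at w) - ?A)"
    have "((\<lambda>u. g u - ?A *v u) has_derivative (\<lambda>x. jacobian g (at w) *v x - ?A *v x)) (at w)"
      using w \<delta> by (intro has_derivative_diff chart_derivative linear_imp_has_derivative) auto
    moreover have "?f' = (\<lambda>x. jacobian g (at w) *v x - ?A *v x)"
      by (simp add: fun_eq_iff matrix_vector_mult_diff_rdistrib)
    ultimately show "((\<lambda>u. g u - ?A *v u) has_derivative ?f') (at w within cball u0 \<delta>)"
      by (metis has_derivative_at_withinI)
    have "onorm ?f' \<le> real CARD('d) * real CARD('m) * (e / ?n)"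
    proof (rule onorm_le_matrix_component)
      fix i j
      have "\<bar>(jacobian g (at w) - ?A) $ i $ j\<bar> \<le> norm (jacobian g (at w) - ?A)"
        by (meson component_le_norm_cart order_trans Finite_Cartesian_Product.norm_nth_le)
      also have "\<dots> \<le> e / ?n"
        using d1(2)[OF \<delta>(3)[OF w]] by (simp add: dist_norm)
      finally show "\<bar>(jacobian g (at w) - ?A) $ i $ j\<bar> \<le> e / ?n" .
    qed
    then show "onorm ?f' \<le> e" by simp
  qed simp
  then show thesis
    using that[OF \<delta>(1,2)] by (simp add: matrix_vector_mult_diff_distrib algebra_simps)
qed

text \<open>The linearisation is bounded below by \<open>B\<close>, and a linearisation error of
  \<open>B / 2\<close> leaves half of this. The lower estimate later controls ball masses, the upper
  one controls covers.\<close>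

lemma chart_bilipschitz:
  assumes u0: "u0 \<in> U"
  obtains \<delta> c L where "0 < \<delta>" "0 < c" "0 < L" "cball u0 \<delta> \<subseteq> U"
    "\<And>u v. u \<in> cball u0 \<delta> \<Longrightarrow> v \<in> cball u0 \<delta> \<Longrightarrow> c * dist u v \<le> dist (g u) (g v)"
    "\<And>u v. u \<in> cball u0 \<delta> \<Longrightarrow> v \<in> cball u0 \<delta> \<Longrightarrow> dist (g u) (g v) \<le> L * dist u v"
proof -
  let ?A = "jacobian g (at u0)"
  obtain B where B: "0 < B" "\<And>x. B * norm x \<le> norm (?A *v x)"
    using linear_inj_bounded_below_pos[OF _ chart_jacobian_inj[OF u0]] by (metis matrix_vector_mul_linear)
  obtain K where K: "0 < K" "\<And>x. norm (?A *v x) \<le> norm x * K"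
    using bounded_linear.pos_bounded[OF matrix_vector_mul_bounded_linear, of ?A] by blast
  obtain \<delta> where \<delta>: "0 < \<delta>" "cball u0 \<delta> \<subseteq> U"
    "\<And>u v. u \<in> cball u0 \<delta> \<Longrightarrow> v \<in> cball u0 \<delta> \<Longrightarrow> norm (g u - g v - ?A *v (u - v)) \<le> B / 2 * norm (u - v)"
    using chart_local_linear[OF u0, of "B / 2"] B by auto
  show thesis
  proof
    show "0 < \<delta>" "0 < B / 2" "0 < B / 2 + K" "cball u0 \<delta> \<subseteq> U"
      using \<delta> B K by auto
    fix u v assume uv: "u \<in> cball u0 \<delta>" "v \<in> cball u0 \<delta>"
    show "B / 2 * dist u v \<le> dist (g u) (g v)"
      using \<delta>(3)[OF uv] B(2)[of "u - v"] norm_triangle_ineq2[of "?A *v (u - v)" "?A *v (u - v) - (g u - g v)"]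
      by (simp add: dist_norm norm_minus_commute)
    show "dist (g u) (g v) \<le> (B / 2 + K) * dist u v"
      using \<delta>(3)[OF uv] K(2)[of "u - v"] norm_triangle_ineq[of "?A *v (u - v)" "(g u - g v) - ?A *v (u - v)"]
      by (simp add: dist_norm algebra_simps)
  qed
qed

end

text \<open>With a left inverse \<open>L\<close> of \<open>A\<close>, the equation
  \<open>g (\<phi> w) = h w\<close> becomes \<open>p = L (D q) + L Rh - L Rg\<close> for the
  increments \<open>p\<close> of \<open>\<phi>\<close> and \<open>q\<close> of its argument. The
  remainder \<open>Rg\<close> is small relative to \<open>p\<close> and not to \<open>q\<close>, so
  \<open>p\<close> is first bounded crudely by a multiple of \<open>q\<close>; only then is the
  total error small relative to \<open>q\<close>.\<close>

lemma has_derivative_factor: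
  fixes \<phi> :: "'a::real_normed_vector \<Rightarrow> 'b::euclidean_space" and g :: "'b \<Rightarrow> 'c::euclidean_space"
  assumes S: "open S" "v \<in> S" and fact: "\<And>w. w \<in> S \<Longrightarrow> g (\<phi> w) = h w"
    and h: "(h has_derivative D) (at v)" and g: "(g has_derivative A) (at (\<phi> v))"
    and inj: "inj A" and cont: "isCont \<phi> v"
  obtains B where "(\<phi> has_derivative B) (at v)" "A \<circ> B = D"
proof -
  have linA: "linear A" and linD: "bounded_linear D"
    using g h has_derivative_linear has_derivative_bounded_linear by blast+
  obtain L where L: "linear L" "L \<circ> A = id"
    using linear_injective_left_inverse[OF linA inj] by blast
  then have LA: "L (A x) = x" for x
    by (metis comp_apply id_apply)
  have bL: "bounded_linear L"
    using L by (simp add: linear_conv_bounded_linear)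
  obtain K where K: "0 < K" "\<And>x. norm (L x) \<le> norm x * K"
    using bounded_linear.pos_bounded[OF bL] by blast
  obtain K' where K': "0 < K'" "\<And>x. norm (D x) \<le> norm x * K'"
    using bounded_linear.pos_bounded[OF linD] by blast
  have "(\<phi> has_derivative (L \<circ> D)) (at v)"
    unfolding has_derivative_at_alt
  proof (intro conjI allI impI)
    show "bounded_linear (L \<circ> D)"
      using bL linD by (simp add: bounded_linear_compose o_def)
    fix e0 :: real assume e0: "0 < e0"
    define C where "C = 2 * K * (K' + 1)"
    \<comment> \<open>The three bounds serve in turn to dominate the term from \<open>Rh\<close> by
      a fixed multiple of the increment \<open>q\<close>, to absorb the term from \<open>Rg\<close>
      into half of \<open>p\<close>, and to keep the final error below \<open>e0\<close>.\<close>
    define e where "e = min 1 (min (1 / (2 * K)) (e0 / (K * (1 + C))))"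
    have C: "0 < C" using K K' by (simp add: C_def)
    have e: "0 < e" "e \<le> 1" "e * K \<le> 1 / 2" "K * (e + e * C) \<le> e0"
    proof -
      have "e \<le> 1 / (2 * K)" "e \<le> e0 / (K * (1 + C))" by (simp_all add: e_def)
      then have "e * (2 * K) \<le> 1" "e * (K * (1 + C)) \<le> e0"
        using K C by (simp_all only: pos_le_divide_eq mult_pos_pos add_pos_pos zero_less_one zero_less_numeral)
      then show "e * K \<le> 1 / 2" "K * (e + e * C) \<le> e0"
        by (simp_all add: algebra_simps)
    qed (use K C e0 in \<open>auto simp: e_def\<close>)
    obtain d1 where d1: "0 < d1" "\<And>y. norm (y - \<phi> v) < d1 \<Longrightarrow>
        norm (g y - g (\<phi> v) - A (y - \<phi> v)) \<le> e * norm (y - \<phi> v)"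
      using g e(1) unfolding has_derivative_at_alt by metis
    obtain d2 where d2: "0 < d2" "\<And>w. norm (w - v) < d2 \<Longrightarrow> norm (h w - h v - D (w - v)) \<le> e * norm (w - v)"
      using h e(1) unfolding has_derivative_at_alt by metis
    obtain d3 where d3: "0 < d3" "\<And>w. norm (w - v) < d3 \<Longrightarrow> norm (\<phi> w - \<phi> v) < d1"
      using cont d1(1) unfolding continuous_at_eps_delta dist_norm by metis
    obtain d4 where d4: "0 < d4" "\<And>w. norm (w - v) < d4 \<Longrightarrow> w \<in> S"
      using S by (metis open_dist dist_norm)
    show "\<exists>d>0. \<forall>y. norm (y - v) < d \<longrightarrow> norm (\<phi> y - \<phi> v - (L \<circ> D) (y - v)) \<le> e0 * norm (y - v)"
    proof (intro exI[of _ "min d2 (min d3 d4)"] conjI allI impI)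
      fix w assume w: "norm (w - v) < min d2 (min d3 d4)"
      let ?p = "\<phi> w - \<phi> v" and ?q = "w - v"
      let ?Rg = "g (\<phi> w) - g (\<phi> v) - A ?p" and ?Rh = "h w - h v - D ?q"
      have Rg: "norm ?Rg \<le> e * norm ?p" and Rh: "norm ?Rh \<le> e * norm ?q"
        using w d1 d2 d3 by auto
      have "A ?p = D ?q + ?Rh - ?Rg"
        using fact w d4 S(2) by simp
      then have "L (A ?p) = L (D ?q + ?Rh - ?Rg)" by simp
      then have p: "?p = L (D ?q) + L ?Rh - L ?Rg"
        by (simp only: LA linear_add[OF L(1)] linear_diff[OF L(1)])
      have LRg: "norm (L ?Rg) \<le> e * K * norm ?p" and LRh: "norm (L ?Rh) \<le> e * K * norm ?q"
        using order_trans[OF K(2) mult_right_mono[OF Rg]] order_trans[OF K(2) mult_right_mono[OF Rh]] K(1)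
        by (simp_all add: mult_ac)
      have "norm ?p \<le> norm (L (D ?q)) + norm (L ?Rh) + norm (L ?Rg)"
        by (subst p) (rule order_trans[OF norm_triangle_ineq4 add_right_mono[OF norm_triangle_ineq]])
      moreover have "norm (L (D ?q)) \<le> K' * K * norm ?q"
        using order_trans[OF K(2) mult_right_mono[OF K'(2)]] K(1) by (simp add: mult_ac)
      moreover have "e * K * norm ?p \<le> 1 / 2 * norm ?p"
        using e(3) by (rule mult_right_mono) simp
      moreover have "e * K * norm ?q \<le> 1 * K * norm ?q"
        using e(2) K(1) by (intro mult_right_mono) auto
      moreover have "C * norm ?q = 2 * (K' * K * norm ?q) + 2 * (1 * K * norm ?q)"
        by (simp add: C_def algebra_simps)
      ultimately have pq: "norm ?p \<le> C * norm ?q"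
        using LRg LRh by linarith
      have "norm (?p - L (D ?q)) = norm (L ?Rh - L ?Rg)"
        by (rule arg_cong[where f = norm]) (subst p, simp)
      also have "\<dots> \<le> e * K * norm ?q + e * K * norm ?p"
        by (rule order_trans[OF norm_triangle_ineq4 add_mono[OF LRh LRg]])
      also have "\<dots> \<le> e * K * norm ?q + e * K * (C * norm ?q)"
        using pq e(1) K(1) by (intro add_left_mono mult_left_mono) auto
      also have "\<dots> = K * (e + e * C) * norm ?q"
        by (simp add: algebra_simps)
      also have "\<dots> \<le> e0 * norm ?q"
        using e(4) by (rule mult_right_mono) simp
      finally show "norm (?p - (L \<circ> D) ?q) \<le> e0 * norm ?q" by simp
    qed (use d2 d3 d4 in auto)
  qed
  \<comment> \<open>\<open>L\<close> inverts \<open>A\<close> on one side only, so this identity is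
    not algebraic: it compares two derivatives of \<open>h\<close> at the same point.\<close>
  moreover have "A \<circ> (L \<circ> D) = D"
  proof -
    have "((g \<circ> \<phi>) has_derivative (A \<circ> (L \<circ> D))) (at v)"
      using calculation g by (rule diff_chain_at)
    moreover have "(h has_derivative (A \<circ> (L \<circ> D))) (at v)"
      by (rule has_derivative_transform_within_open[OF calculation S]) (simp add: fact)
    ultimately show ?thesis
      using h has_derivative_unique by blast
  qed
  ultimately show thesis
    using that by blast
qed

text \<open>\<open>\<phi>\<close> is the transition map. Continuity comes from the charts being open
  maps into \<open>M\<close>, and differentiability from \<open>has_derivative_factor\<close>. The
  Jacobian of \<open>h\<close> is that of \<open>g\<close> times the square matrix of
  \<open>B\<close>; the Gram determinant factors accordingly, which gives the transformation of the
  densities.\<close>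

lemma chart_transition:
  fixes M :: "(real ^ 'd::finite) set" and U V :: "(real ^ 'm::finite) set"
  assumes g: "C1_chart M U g" and h: "C1_chart M V h"
  defines "\<phi> \<equiv> inv_into U g \<circ> h"
  defines "S \<equiv> {v \<in> V. h v \<in> g ` U}"
  shows "open S" "inj_on \<phi> S" "\<phi> ` S = {u \<in> U. g u \<in> h ` V}"
    and "\<And>v. v \<in> S \<Longrightarrow> g (\<phi> v) = h v"
    and "\<And>v. v \<in> S \<Longrightarrow> \<exists>B. (\<phi> has_derivative B) (at v) \<and>
       chart_density h v = chart_density g (\<phi> v) * \<bar>det (matrix B)\<bar>"
proof -
  have pre_open: "open {v \<in> V. h v \<in> g ` W}" if W: "open W" "W \<subseteq> U" for W
  proof -
    have "openin (top_of_set V) (V \<inter> h -` (g ` W))"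
      using chart_continuous[OF h] chart_openin[OF g W] chart_image[OF h]
      by (intro continuous_openin_preimage) auto
    moreover have "V \<inter> h -` (g ` W) = {v \<in> V. h v \<in> g ` W}" by auto
    ultimately show ?thesis
      using chart_open[OF h] by (simp add: openin_open_eq)
  qed
  show S: "open S"
    unfolding S_def by (rule pre_open) (auto simp: chart_open[OF g])
  show fact: "g (\<phi> v) = h v" if "v \<in> S" for v
    using that by (auto simp: S_def \<phi>_def f_inv_into_f)
  have \<phi>U: "\<phi> v \<in> U" if "v \<in> S" for v
    using that by (auto simp: S_def \<phi>_def inv_into_into)
  show "inj_on \<phi> S"
    by (rule inj_onI) (metis (mono_tags, lifting) S_def chart_inj[OF h] fact inj_onD mem_Collect_eq)
  show "\<phi> ` S = {u \<in> U. g u \<in> h ` V}"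
  proof (intro equalityI subsetI)
    fix u assume u: "u \<in> {u \<in> U. g u \<in> h ` V}"
    then obtain v where v: "v \<in> V" "g u = h v" by auto
    then have "v \<in> S" "\<phi> v = u"
      using u inv_into_f_f[OF chart_inj[OF g], of u] by (auto simp: S_def \<phi>_def v(2)[symmetric])
    then show "u \<in> \<phi> ` S" by auto
  qed (use \<phi>U fact S_def in auto)
  have cont: "continuous_on S \<phi>"
    unfolding continuous_on_open_vimage[OF S]
  proof (intro allI impI)
    fix W :: "(real ^ 'm) set" assume "open W"
    then have "open {v \<in> V. h v \<in> g ` (W \<inter> U)}"
      using chart_open[OF g] by (intro pre_open) auto
    moreover have "{v \<in> V. h v \<in> g ` (W \<inter> U)} = \<phi> -` W \<inter> S"
    proof (intro equalityI subsetI)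
      fix v assume "v \<in> {v \<in> V. h v \<in> g ` (W \<inter> U)}"
      then obtain u where u: "v \<in> V" "u \<in> W" "u \<in> U" "h v = g u" by auto
      then show "v \<in> \<phi> -` W \<inter> S"
        using inv_into_f_f[OF chart_inj[OF g], of u] by (simp add: S_def \<phi>_def)
    next
      fix v assume "v \<in> \<phi> -` W \<inter> S"
      then show "v \<in> {v \<in> V. h v \<in> g ` (W \<inter> U)}"
        using \<phi>U[of v] fact[of v] by (auto simp: S_def intro!: image_eqI[of "h v" g "\<phi> v"])
    qed
    ultimately show "open (\<phi> -` W \<inter> S)" by simp
  qed
  show "\<exists>B. (\<phi> has_derivative B) (at v) \<and> chart_density h v = chart_density g (\<phi> v) * \<bar>det (matrix B)\<bar>"
    if v: "v \<in> S" for v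
  proof -
    let ?A = "jacobian g (at (\<phi> v))" and ?D = "jacobian h (at v)"
    have "isCont \<phi> v"
      using cont S v by (simp add: continuous_on_eq_continuous_at)
    moreover have "v \<in> V" using v by (simp add: S_def)
    ultimately obtain B where B: "(\<phi> has_derivative B) (at v)" "(*v) ?A \<circ> B = (*v) ?D"
      using has_derivative_factor[OF S v fact chart_derivative[OF h] chart_derivative[OF g \<phi>U[OF v]] 
          chart_jacobian_inj[OF g \<phi>U[OF v]]] by metis
    have lin: "linear B"
      using B(1) has_derivative_linear by blast
    have "matrix ((*v) ?D) = matrix ((*v) ?A) ** matrix B"
      using matrix_compose[OF lin, of "(*v) ?A"] B(2) by simp
    then have "?D = ?A ** matrix B"
      by simp
    then have "transpose ?D ** ?D = transpose (matrix B) ** (transpose ?A ** ?A) ** matrix B"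
      by (simp add: matrix_transpose_mul matrix_mul_assoc)
    then have "det (transpose ?D ** ?D) = det (transpose ?A ** ?A) * (det (matrix B))\<^sup>2"
      by (simp add: det_mul det_transpose power2_eq_square)
    then have "chart_density h v = chart_density g (\<phi> v) * \<bar>det (matrix B)\<bar>"
      unfolding chart_density_def by (simp add: real_sqrt_mult)
    with B show ?thesis by blast
  qed
qed

section \<open>The volume measure\<close>

locale manifold_volume =
  fixes M :: "(real ^ 'd::finite) set" and I :: "'i set"
    and U :: "'i \<Rightarrow> (real ^ 'm::finite) set" and g :: "'i \<Rightarrow> real ^ 'm \<Rightarrow> real ^ 'd"
    and p :: "'i \<Rightarrow> real ^ 'd \<Rightarrow> real" and \<nu> :: "(real ^ 'd) measure"
  assumes atlas: "C1_atlas M I U g"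
    and unity: "partition_of_unity M I U g p"
    and volume: "volume_measure M I U g p \<nu>"
begin

lemma space_nu: "space \<nu> = M" and sets_nu: "sets \<nu> = sets (restrict_space borel M)"
  using volume by (auto simp: volume_measure_def)

lemma borel_measurable_nu: "h \<in> borel_measurable borel \<Longrightarrow> h \<in> borel_measurable \<nu>"
  by (simp add: measurable_cong_sets[OF sets_nu refl] measurable_restrict_space1)

text \<open>Local finiteness plus compactness; this makes the sum over \<open>I\<close> finite for
  functions that live on a compact patch.\<close>

lemma finite_unity_on_compact:
  assumes "compact C" "C \<subseteq> M"
  shows "finite {i \<in> I. \<exists>z\<in>C. p i z \<noteq> 0}"
proof -
  have "\<forall>y\<in>C. \<exists>W. open W \<and> y \<in> W \<and> finite {i \<in> I. \<exists>z\<in>M \<inter> W. p i z \<noteq> 0}"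
  proof
    fix y assume "y \<in> C"
    then obtain W where W: "openin (top_of_set M) W" "y \<in> W" "finite {i \<in> I. \<exists>z\<in>W. p i z \<noteq> 0}"
      using unity assms unfolding partition_of_unity_def by blast
    moreover obtain W' where "open W'" "W = M \<inter> W'"
      using W(1) by (metis openin_open)
    ultimately show "\<exists>W. open W \<and> y \<in> W \<and> finite {i \<in> I. \<exists>z\<in>M \<inter> W. p i z \<noteq> 0}"
      by blast
  qed
  from bchoice[OF this] obtain W
    where W: "\<forall>y\<in>C. open (W y) \<and> y \<in> W y \<and> finite {i \<in> I. \<exists>z\<in>M \<inter> W y. p i z \<noteq> 0}"
    by (rule exE)
  obtain T where T: "T \<subseteq> C" "finite T" "C \<subseteq> (\<Union>y\<in>T. W y)"
    by (rule compactE_image[OF assms(1), of C W]) (use W in auto)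
  have "{i \<in> I. \<exists>z\<in>C. p i z \<noteq> 0} \<subseteq> (\<Union>y\<in>T. {i \<in> I. \<exists>z\<in>M \<inter> W y. p i z \<noteq> 0})"
  proof
    fix i assume "i \<in> {i \<in> I. \<exists>z\<in>C. p i z \<noteq> 0}"
    then obtain z where z: "i \<in> I" "z \<in> C" "p i z \<noteq> 0" by auto
    then obtain y where "y \<in> T" "z \<in> W y" using T(3) by auto
    then show "i \<in> (\<Union>y\<in>T. {i \<in> I. \<exists>z\<in>M \<inter> W y. p i z \<noteq> 0})"
      using z assms(2) by auto
  qed
  moreover have "finite (\<Union>y\<in>T. {i \<in> I. \<exists>z\<in>M \<inter> W y. p i z \<noteq> 0})"
    using T(1) W by (intro finite_UN_I[OF T(2)]) (meson subsetD)
  ultimately show ?thesis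
    by (rule finite_subset)
qed

text \<open>The volume does not depend on the atlas: for an integrand that lives on one compact
  patch, any chart \<open>h\<close>, in the atlas or not, computes the integral. Each term of the
  definition is moved to \<open>h\<close> by the transition map, and under the common integral the
  functions \<open>p i\<close> add up to 1.\<close>

lemma nn_integral_chart:
  fixes h :: "real ^ 'm \<Rightarrow> real ^ 'd" and q :: "real ^ 'd \<Rightarrow> ennreal"
  assumes h: "C1_chart M V h" and Q: "compact Q" "Q \<subseteq> V"
    and q[measurable]: "q \<in> borel_measurable borel" and q0: "\<And>y. y \<in> M - h ` Q \<Longrightarrow> q y = 0"
  shows "(\<integral>\<^sup>+y. q y \<partial>\<nu>) = (\<integral>\<^sup>+v\<in>Q. q (h v) * ennreal (chart_density h v) \<partial>lborel)"
proof -
  have V: "open V" using chart_open[OF h] .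
  have Qb[measurable]: "Q \<in> sets borel" using Q(1) by (simp add: borel_compact)
  have p_cont: "continuous_on M (p i)" and p_nonneg: "y \<in> M \<Longrightarrow> 0 \<le> p i y"
    and p_zero: "y \<in> M - g i ` U i \<Longrightarrow> p i y = 0" and gi: "C1_chart M (U i) (g i)" if "i \<in> I" for i y
    using that unity atlas by (auto simp: partition_of_unity_def C1_atlas_def)
  \<comment> \<open>This and the next two definitions are total Borel versions of functions that are
    controlled only on \<open>V\<close>.\<close>
  define h0 where "h0 v = (if v \<in> V then h v else 0)" for v
  have [measurable]: "h0 \<in> borel_measurable borel"
    unfolding h0_def using chart_continuous[OF h] V by (intro borel_measurable_continuous_on_if) auto
  define J where "J v = (if v \<in> V then chart_density h v else 0)" for v
  have [measurable]: "J \<in> borel_measurable borel"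
    unfolding J_def using chart_density_continuous[OF h] V by (intro borel_measurable_continuous_on_if) auto
  define ph where "ph i v = (if v \<in> V then p i (h v) else 0)" for i v
  have ph[measurable]: "ph i \<in> borel_measurable borel" if "i \<in> I" for i
    unfolding ph_def using p_cont[OF that] chart_continuous[OF h] V chart_image[OF h]
    by (intro borel_measurable_continuous_on_if) (auto intro: continuous_on_compose2)
  have local: "(\<integral>\<^sup>+x\<in>U i. q (g i x) * ennreal (p i (g i x) * chart_density (g i) x) \<partial>lborel) =
      (\<integral>\<^sup>+v\<in>Q. q (h v) * ennreal (p i (h v) * chart_density h v) \<partial>lborel)" if i: "i \<in> I" for i
  proof -
    let ?\<phi> = "inv_into V h \<circ> g i" and ?S = "{x \<in> U i. g i x \<in> h ` V}"
    note tr = chart_transition[OF h gi[OF i]]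
    have "\<exists>B. \<forall>v\<in>?S. (?\<phi> has_derivative B v) (at v) \<and>
        chart_density (g i) v = chart_density h (?\<phi> v) * \<bar>det (matrix (B v))\<bar>"
      using tr(5) by (intro bchoice) blast
    then obtain B where B: "\<And>v. v \<in> ?S \<Longrightarrow> (?\<phi> has_derivative B v) (at v)"
      "\<And>v. v \<in> ?S \<Longrightarrow> chart_density (g i) v = chart_density h (?\<phi> v) * \<bar>det (matrix (B v))\<bar>"
      by blast
    have \<phi>V: "?\<phi> x \<in> V" if "x \<in> ?S" for x
      using tr(3) that by blast
    have cont: "continuous_on ?S ?\<phi>"
      using B(1) by (meson continuous_at_imp_continuous_on has_derivative_continuous)
    \<comment> \<open>\<open>B\<close> comes from a choice without measurability; this quotient of
      continuous densities is a Borel function with the value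
      \<open>\<bar>det (matrix (B x))\<bar>\<close> on \<open>?S\<close>.\<close>
    define D where "D x = (if x \<in> ?S then chart_density (g i) x / chart_density h (?\<phi> x) else 0)" for x
    have D[measurable]: "D \<in> borel_measurable borel"
    proof -
      have "continuous_on ?S (\<lambda>x. chart_density h (?\<phi> x))"
        using \<phi>V by (intro continuous_on_compose2[OF chart_density_continuous[OF h] cont]) auto
      moreover have "continuous_on ?S (chart_density (g i))"
        by (rule continuous_on_subset[OF chart_density_continuous[OF gi[OF i]]]) auto
      moreover have "\<forall>x\<in>?S. chart_density h (?\<phi> x) \<noteq> 0"
        using chart_density_pos[OF h \<phi>V] by force
      ultimately have "continuous_on ?S (\<lambda>x. chart_density (g i) x / chart_density h (?\<phi> x))"
        by (intro continuous_on_divide)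
      then show ?thesis
        unfolding D_def using tr(1) by (intro borel_measurable_continuous_on_if) auto
    qed
    let ?H = "\<lambda>v. q (h0 v) * ennreal (ph i v * J v) * indicator Q v"
    have "open (?\<phi> ` ?S)"
      using cont tr(1,2) by (rule invariance_of_domain)
    then have cv: "(\<integral>\<^sup>+v\<in>?\<phi> ` ?S. ?H v \<partial>lborel) = (\<integral>\<^sup>+x\<in>?S. ?H (?\<phi> x) * ennreal (D x) \<partial>lborel)"
    proof (rule nn_integral_change_of_variables[OF tr(1) _ B(1) tr(2) D])
      show "D x = \<bar>det (matrix (B x))\<bar>" if "x \<in> ?S" for x
        using that B(2)[OF that] chart_density_pos[OF h \<phi>V[OF that]] by (simp add: D_def)
      show "?H \<in> borel_measurable borel"
        using ph[OF i] by measurable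
    qed
    have "(\<integral>\<^sup>+v\<in>Q. q (h v) * ennreal (p i (h v) * chart_density h v) \<partial>lborel) = (\<integral>\<^sup>+v\<in>?\<phi> ` ?S. ?H v \<partial>lborel)"
    proof (rule nn_integral_cong)
      fix v
      show "q (h v) * ennreal (p i (h v) * chart_density h v) * indicator Q v = ?H v * indicator (?\<phi> ` ?S) v"
      proof (cases "v \<in> Q")
        case True
        then have v: "v \<in> V" using Q by auto
        show ?thesis
        proof (cases "h v \<in> g i ` U i")
          case True
          then have "v \<in> ?\<phi> ` ?S" unfolding tr(3) using v by auto
          then show ?thesis using v by (simp add: h0_def ph_def J_def)
        next
          case False
          then have "p i (h v) = 0" using p_zero[OF i] v chart_image[OF h] by auto
          then show ?thesis using v by (simp add: ph_def)
        qed
      qed simp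
    qed
    also have "\<dots> = (\<integral>\<^sup>+x\<in>?S. ?H (?\<phi> x) * ennreal (D x) \<partial>lborel)"
      by (rule cv)
    also have "\<dots> = (\<integral>\<^sup>+x\<in>U i. q (g i x) * ennreal (p i (g i x) * chart_density (g i) x) \<partial>lborel)"
    proof (rule nn_integral_cong)
      fix x
      show "?H (?\<phi> x) * ennreal (D x) * indicator ?S x =
          q (g i x) * ennreal (p i (g i x) * chart_density (g i) x) * indicator (U i) x"
      proof (cases "x \<in> U i \<and> g i x \<in> h ` Q")
        case True
        then have x: "x \<in> ?S" using Q by auto
        note v = \<phi>V[OF x] and hv = tr(4)[OF x]
        have "?\<phi> x \<in> Q"
        proof -
          obtain w where "w \<in> Q" "g i x = h w" using True by auto
          then show ?thesis
            using inv_into_f_f[OF chart_inj[OF h], of w] Q(2) by auto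
        qed
        moreover have "0 \<le> p i (g i x)"
          using p_nonneg[OF i] chart_image[OF gi[OF i]] x by auto
        moreover have "ennreal (p i (g i x) * chart_density h (?\<phi> x)) * ennreal (D x) =
            ennreal (p i (g i x) * chart_density (g i) x)"
          using chart_density_pos[OF h v] chart_density_pos[OF gi[OF i], of x] x calculation(2)
          by (subst ennreal_mult[symmetric]) (auto simp: D_def)
        moreover have "h0 (?\<phi> x) = g i x" "ph i (?\<phi> x) = p i (g i x)" "J (?\<phi> x) = chart_density h (?\<phi> x)"
          using v hv by (simp_all only: h0_def ph_def J_def if_True)
        ultimately show ?thesis
          using x by (simp only: indicator_simps mem_Collect_eq mult.assoc mult_1_right mult_1_left)
      next
        case False
        show ?thesis
        proof (cases "x \<in> U i")
          case True
          then have "q (g i x) = 0"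
            using False q0 chart_image[OF gi[OF i]] by auto
          then show ?thesis
            using \<phi>V[of x] tr(4)[of x] by (cases "x \<in> ?S") (auto simp: h0_def)
        qed simp
      qed
    qed
    finally show ?thesis by simp
  qed
  let ?F = "{i \<in> I. \<exists>z\<in>h ` Q. p i z \<noteq> 0}"
  have hQ: "h ` Q \<subseteq> M"
    using Q chart_image[OF h] by auto
  have "compact (h ` Q)"
    using Q chart_continuous[OF h] by (intro compact_continuous_image) (auto intro: continuous_on_subset)
  then have F: "finite ?F"
    using finite_unity_on_compact hQ by blast
  have qm: "q \<in> borel_measurable \<nu>"
    using borel_measurable_nu[OF q] .
  have "(\<integral>\<^sup>+y. q y \<partial>\<nu>) = (\<integral>\<^sup>+i. (\<integral>\<^sup>+x\<in>U i. q (g i x) * ennreal (p i (g i x) * chart_density (g i) x) \<partial>lborel) \<partial>count_space I)"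
    using volume qm unfolding volume_measure_def chart_density_def by blast
  also have "\<dots> = (\<integral>\<^sup>+i. (\<integral>\<^sup>+v\<in>Q. q (h v) * ennreal (p i (h v) * chart_density h v) \<partial>lborel) \<partial>count_space I)"
    by (rule nn_integral_cong) (simp add: local)
  also have "\<dots> = (\<Sum>i\<in>?F. (\<integral>\<^sup>+v\<in>Q. q (h v) * ennreal (p i (h v) * chart_density h v) \<partial>lborel))"
  proof (rule nn_integral_count_space'[OF F])
    fix i assume "i \<in> I" "i \<notin> ?F"
    then have "p i (h v) = 0" if "v \<in> Q" for v using that by auto
    then have "(\<integral>\<^sup>+v\<in>Q. q (h v) * ennreal (p i (h v) * chart_density h v) \<partial>lborel) = (\<integral>\<^sup>+v. 0 \<partial>lborel :: (real ^ 'm) measure)"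
      by (intro nn_integral_cong) (auto simp: indicator_def)
    then show "(\<integral>\<^sup>+v\<in>Q. q (h v) * ennreal (p i (h v) * chart_density h v) \<partial>lborel) = 0" by simp
  qed auto
  also have "\<dots> = (\<Sum>i\<in>?F. (\<integral>\<^sup>+v. q (h0 v) * ennreal (ph i v * J v) * indicator Q v \<partial>lborel))"
    using Q(2) by (intro sum.cong nn_integral_cong) (auto simp: h0_def ph_def J_def indicator_def)
  also have "\<dots> = (\<integral>\<^sup>+v. (\<Sum>i\<in>?F. q (h0 v) * ennreal (ph i v * J v) * indicator Q v) \<partial>lborel)"
  proof (rule nn_integral_sum[symmetric])
    fix i assume "i \<in> ?F"
    then have [measurable]: "ph i \<in> borel_measurable borel" by (intro ph) simp
    show "(\<lambda>v. q (h0 v) * ennreal (ph i v * J v) * indicator Q v) \<in> borel_measurable lborel"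
      by measurable
  qed
  also have "\<dots> = (\<integral>\<^sup>+v\<in>Q. q (h v) * ennreal (chart_density h v) \<partial>lborel)"
  proof (rule nn_integral_cong)
    fix v
    show "(\<Sum>i\<in>?F. q (h0 v) * ennreal (ph i v * J v) * indicator Q v) = 
        q (h v) * ennreal (chart_density h v) * indicator Q v"
    proof (cases "v \<in> Q")
      case v: True
      then have vV: "v \<in> V" and hv: "h v \<in> M" using Q(2) hQ by auto
      have "(\<Sum>i\<in>?F. p i (h v)) = (\<Sum>i | i \<in> I \<and> p i (h v) \<noteq> 0. p i (h v))"
        using F v by (intro sum.mono_neutral_right) auto
      also have "\<dots> = 1"
        using unity hv unfolding partition_of_unity_def by blast
      finally have one: "(\<Sum>i\<in>?F. p i (h v)) = 1" .
      have "(\<Sum>i\<in>?F. ennreal (p i (h v) * chart_density h v)) = ennreal (\<Sum>i\<in>?F. p i (h v) * chart_density h v)"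
        using p_nonneg hv chart_density_pos[OF h vV] by (intro sum_ennreal) auto
      also have "\<dots> = ennreal (chart_density h v)"
        unfolding sum_distrib_right[symmetric] one by simp
      finally show ?thesis
        using v vV by (simp add: h0_def ph_def J_def sum_distrib_left[symmetric])
    qed simp
  qed
  finally show ?thesis .
qed

end

section \<open>Masses of small balls\<close>

context manifold_volume
begin

lemma emeasure_chart:
  fixes h :: "real ^ 'm \<Rightarrow> real ^ 'd"
  assumes h: "C1_chart M V h" and Q: "compact Q" "Q \<subseteq> V"
    and A: "A \<in> sets borel" "A \<inter> M \<subseteq> h ` Q"
  shows "emeasure \<nu> (A \<inter> M) = (\<integral>\<^sup>+v\<in>{v\<in>Q. h v \<in> A}. ennreal (chart_density h v) \<partial>lborel)"
proof -
  have "emeasure \<nu> (A \<inter> M) = (\<integral>\<^sup>+y. indicator (A \<inter> M) y \<partial>\<nu>)"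
    using A by (subst nn_integral_indicator) (auto simp: sets_nu sets_restrict_space)
  also have "\<dots> = (\<integral>\<^sup>+y. indicator A y \<partial>\<nu>)"
    by (intro nn_integral_cong) (auto simp: space_nu indicator_def)
  also have "\<dots> = (\<integral>\<^sup>+v\<in>Q. indicator A (h v) * ennreal (chart_density h v) \<partial>lborel)"
    by (rule nn_integral_chart[OF h Q]) (use A in \<open>auto simp: indicator_def\<close>)
  also have "\<dots> = (\<integral>\<^sup>+v\<in>{v\<in>Q. h v \<in> A}. ennreal (chart_density h v) \<partial>lborel)"
    by (intro nn_integral_cong) (auto simp: indicator_def)
  finally show ?thesis .
qed

text \<open>If the ball meets the patch at \<open>h w\<close>, every point of the intersection is
  within \<open>2 * r\<close> of \<open>h w\<close>, so its parameter is within
  \<open>2 / c * r\<close> of \<open>w\<close>. The mass is at most a bound for the density times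
  the volume of that parameter ball. The centre \<open>x\<close> may be anywhere, even off
  \<open>M\<close>.\<close>

lemma emeasure_patch_cball:
  fixes h :: "real ^ 'm \<Rightarrow> real ^ 'd"
  assumes h: "C1_chart M V h" and \<delta>: "0 < \<delta>" "cball u \<delta> \<subseteq> V" and c: "0 < c"
    and lower: "\<And>v w. v \<in> cball u \<delta> \<Longrightarrow> w \<in> cball u \<delta> \<Longrightarrow> c * dist v w \<le> dist (h v) (h w)"
  obtains K where "0 < K"
    "\<And>x r. 0 < r \<Longrightarrow> emeasure \<nu> (h ` cball u \<delta> \<inter> cball x r) \<le> ennreal (K * r ^ CARD('m))"
proof -
  let ?Q = "cball u \<delta>"
  obtain B where B: "0 < B" "\<And>v. v \<in> ?Q \<Longrightarrow> chart_density h v \<le> B"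
  proof -
    have "compact (chart_density h ` ?Q)"
      using chart_density_continuous[OF h] \<delta> by (intro compact_continuous_image) (auto intro: continuous_on_subset)
    then obtain B where "\<forall>y\<in>chart_density h ` ?Q. norm y \<le> B"
      using compact_imp_bounded bounded_iff by metis
    then show thesis
      by (intro that[of "max B 1"]) (force simp: abs_le_iff le_max_iff_disj)+
  qed
  define K where "K = B * (unit_ball_vol (real CARD('m)) * (2 / c) ^ CARD('m))"
  have "0 < K"
    using B c by (simp add: K_def)
  have hQ: "compact (h ` ?Q)"
    using \<delta> chart_continuous[OF h] by (intro compact_continuous_image) (auto intro: continuous_on_subset)
  have hM: "h ` ?Q \<subseteq> M"
    using \<delta> chart_image[OF h] by auto
  have "emeasure \<nu> (h ` ?Q \<inter> cball x r) \<le> ennreal (K * r ^ CARD('m))" if r: "0 < r" for x r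
  proof -
    let ?A = "h ` ?Q \<inter> cball x r"
    let ?S = "{v \<in> ?Q. h v \<in> ?A}"
    have "emeasure \<nu> ?A = emeasure \<nu> (?A \<inter> M)"
      using hM by (simp add: Int_absorb2 inf.coboundedI1)
    also have "\<dots> = (\<integral>\<^sup>+v\<in>?S. ennreal (chart_density h v) \<partial>lborel)"
      using \<delta> hQ by (intro emeasure_chart[OF h]) (auto simp: borel_compact)
    also have "\<dots> \<le> ennreal (K * r ^ CARD('m))"
    proof (cases "?S = {}")
      case False
      then obtain w where w: "w \<in> ?S" by blast
      have sub: "?S \<subseteq> cball w (2 / c * r)"
      proof
        fix v assume v: "v \<in> ?S"
        have "c * dist w v \<le> dist (h w) (h v)" using v w lower by auto
        also have "\<dots> \<le> 2 * r"
          using v w dist_triangle2[of "h w" "h v" x] by (auto simp: dist_commute)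
        finally show "v \<in> cball w (2 / c * r)"
          using c by (simp add: field_simps)
      qed
      have "(\<integral>\<^sup>+v\<in>?S. ennreal (chart_density h v) \<partial>lborel) \<le> (\<integral>\<^sup>+v. ennreal B * indicator (cball w (2 / c * r)) v \<partial>lborel)"
        using sub B by (intro nn_integral_mono) (auto simp: indicator_def ennreal_leI)
      also have "\<dots> = ennreal B * emeasure lborel (cball w (2 / c * r))"
        by (subst nn_integral_cmult_indicator) auto
      also have "\<dots> = ennreal (K * r ^ CARD('m))"
        using B c r by (simp add: emeasure_cball K_def ennreal_mult[symmetric] power_mult_distrib power_divide)
      finally show ?thesis .
    qed simp
    finally show ?thesis .
  qed
  with \<open>0 < K\<close> show thesis by (rule that)
qed

lemma emeasure_ellipsoid:
  fixes A :: "real ^ 'k::finite ^ 'l::finite" and u :: "real ^ 'k"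
  assumes inj: "inj ((*v) A)" and r: "0 \<le> r"
  shows "emeasure lborel {v. norm (A *v (v - u)) \<le> r} =
           ennreal (unit_ball_vol (real CARD('k)) * r ^ CARD('k) / sqrt (det (transpose A ** A)))"
proof -
  obtain T where T: "linear T" "inj T" "\<And>u. norm (T u) = norm (A *v u)"
    "\<bar>det (matrix T)\<bar> = sqrt (det (transpose A ** A))"
    using gram_factor[OF inj] by metis
  have [measurable]: "T \<in> borel_measurable borel"
    using T by (intro borel_measurable_continuous_onI linear_continuous_on) (simp add: linear_conv_bounded_linear)
  have "emeasure lborel {v. norm (T v) \<le> r} = emeasure (distr lborel borel ((+) (- u))) {v. norm (T v) \<le> r}"
    by (simp add: lborel_distr_plus)
  also have "\<dots> = emeasure lborel {v. norm (T (v - u)) \<le> r}"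
    by (subst emeasure_distr) (auto simp: vimage_def)
  finally show ?thesis
    using emeasure_linear_vimage_cball[OF T(1,2) r] T(3,4) by simp
qed

text \<open>Near \<open>x\<close> the chart differs from its linearisation by a relative error
  \<open>e\<close>, so the preimage of the ball lies between the ellipsoids of radii
  \<open>r / (1 + e)\<close> and \<open>r / (1 - e)\<close>, and the density stays within the
  factors \<open>1 - e\<close> and \<open>1 + e\<close> of its value at the centre. The volume of an
  ellipsoid carries the reciprocal of that value, so the chart cancels.\<close>

lemma volume_sandwich:
  assumes x: "x \<in> M" and e: "0 < e" "e < 1"
  shows "\<forall>\<^sub>F r in at_right 0.
     ennreal ((1 - e) / (1 + e) ^ CARD('m) * (unit_ball_vol (real CARD('m)) * r ^ CARD('m))) \<le> emeasure \<nu> (cball x r \<inter> M) \<and>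
     emeasure \<nu> (cball x r \<inter> M) \<le> ennreal ((1 + e) / (1 - e) ^ CARD('m) * (unit_ball_vol (real CARD('m)) * r ^ CARD('m)))"
proof -
  let ?V = "unit_ball_vol (real CARD('m))" and ?m = "CARD('m)"
  obtain i where "i \<in> I" "x \<in> g i ` U i"
    using atlas x unfolding C1_atlas_def by blast
  then obtain V and h :: "real ^ 'm \<Rightarrow> real ^ 'd" and u where h: "C1_chart M V h" and u: "u \<in> V" "x = h u"
    using atlas unfolding C1_atlas_def by blast
  let ?A = "jacobian h (at u)" and ?J = "chart_density h u"
  note inj = chart_jacobian_inj[OF h u(1)]
  have J: "0 < ?J" using chart_density_pos[OF h u(1)] .
  obtain B where B: "0 < B" "\<And>w. B * norm w \<le> norm (?A *v w)"
    using linear_inj_bounded_below_pos[OF _ inj] by (metis matrix_vector_mul_linear)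
  \<comment> \<open>By the lower bound \<open>B\<close>, an error of \<open>e * B\<close> relative
    to \<open>v - u\<close> is an error of at most \<open>e\<close> relative to
    \<open>?A *v (v - u)\<close>.\<close>
  have "0 < e * B" using e B by simp
  then obtain \<delta>1 where \<delta>1: "0 < \<delta>1" "cball u \<delta>1 \<subseteq> V"
    "\<And>v w. v \<in> cball u \<delta>1 \<Longrightarrow> w \<in> cball u \<delta>1 \<Longrightarrow> norm (h v - h w - ?A *v (v - w)) \<le> (e * B) * norm (v - w)"
    using chart_local_linear[OF h u(1)] by metis
  have "isCont (chart_density h) u"
    using chart_density_continuous[OF h] chart_open[OF h] u by (simp add: continuous_on_eq_continuous_at)
  moreover have "0 < e * ?J" using e J by simp
  ultimately obtain \<delta>2 where \<delta>2: "0 < \<delta>2" "\<And>v. dist v u < \<delta>2 \<Longrightarrow> dist (chart_density h v) ?J < e * ?J"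
    unfolding continuous_at_eps_delta by metis
  define \<delta> where "\<delta> = min \<delta>1 (\<delta>2 / 2)"
  let ?Q = "cball u \<delta>"
  have \<delta>: "0 < \<delta>" "?Q \<subseteq> V" using \<delta>1 \<delta>2 by (auto simp: \<delta>_def)
  have lin: "norm (h v - x - ?A *v (v - u)) \<le> e * norm (?A *v (v - u))" if "v \<in> ?Q" for v
  proof -
    have "norm (h v - x - ?A *v (v - u)) \<le> (e * B) * norm (v - u)"
      using that \<delta>1(3)[of v u] u \<delta> by (auto simp: \<delta>_def)
    also have "\<dots> \<le> e * norm (?A *v (v - u))"
      using B(2)[of "v - u"] e by (simp add: mult.assoc)
    finally show ?thesis .
  qed
  have Jv: "(1 - e) * ?J \<le> chart_density h v" "chart_density h v \<le> (1 + e) * ?J" if "v \<in> ?Q" for v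
  proof -
    have "dist v u < \<delta>2" using that \<delta>2(1) by (auto simp: \<delta>_def dist_commute)
    from \<delta>2(2)[OF this] have "\<bar>chart_density h v - ?J\<bar> < e * ?J"
      by (simp add: dist_real_def)
    then show "(1 - e) * ?J \<le> chart_density h v" "chart_density h v \<le> (1 + e) * ?J"
      unfolding abs_less_iff by (simp_all add: algebra_simps)
  qed
  \<comment> \<open>Other parts of \<open>M\<close> could come back close to \<open>x\<close>;
    openness of the chart as a map into \<open>M\<close> excludes this for small balls.\<close>
  obtain r0 where r0: "0 < r0" "cball x r0 \<inter> M \<subseteq> h ` ?Q"
  proof -
    have "openin (top_of_set M) (h ` ball u \<delta>)"
      using \<delta> by (intro chart_openin[OF h]) auto
    then obtain W where W: "open W" "h ` ball u \<delta> = M \<inter> W" by (metis openin_open)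
    have "x \<in> W" using W \<delta> u(2) by auto
    then obtain r0 where "0 < r0" "cball x r0 \<subseteq> W" using W(1) open_contains_cball by blast
    moreover have "h ` ball u \<delta> \<subseteq> h ` ?Q" by auto
    ultimately show thesis using W(2) by (intro that[of r0]) auto
  qed
  \<comment> \<open>The condition \<open>r < B * \<delta>\<close> keeps the smaller ellipsoid inside
    the parameter ball \<open>?Q\<close>.\<close>
  have "ennreal ((1 - e) / (1 + e) ^ ?m * (?V * r ^ ?m)) \<le> emeasure \<nu> (cball x r \<inter> M) \<and>
     emeasure \<nu> (cball x r \<inter> M) \<le> ennreal ((1 + e) / (1 - e) ^ ?m * (?V * r ^ ?m))"
    if r: "0 < r" "r < r0" "r < B * \<delta>" for r
  proof -
    let ?S = "{v \<in> ?Q. h v \<in> cball x r}"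
    let ?E = "\<lambda>s. {v. norm (?A *v (v - u)) \<le> s}"
    have E: "emeasure lborel (?E s) = ennreal (?V * s ^ ?m / ?J)" if "0 \<le> s" for s
      unfolding chart_density_def using that by (rule emeasure_ellipsoid[OF inj])
    have [measurable]: "?E s \<in> sets borel" for s
    proof -
      have "closed (?E s)"
        by (intro closed_Collect_le continuous_intros linear_continuous_on_compose[OF _ matrix_vector_mul_linear])
      then show ?thesis by (rule borel_closed)
    qed
    have nu: "emeasure \<nu> (cball x r \<inter> M) = (\<integral>\<^sup>+v\<in>?S. ennreal (chart_density h v) \<partial>lborel)"
      using \<delta> r r0 by (intro emeasure_chart[OF h]) auto
    have up: "?S \<subseteq> ?E (r / (1 - e))"
    proof
      fix v assume v: "v \<in> ?S"
      then have "norm (?A *v (v - u)) - norm (h v - x) \<le> e * norm (?A *v (v - u))"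
        using lin[of v] norm_triangle_ineq2[of "?A *v (v - u)" "h v - x"] by (simp add: norm_minus_commute)
      moreover have "norm (h v - x) \<le> r" using v by (simp add: dist_norm norm_minus_commute)
      ultimately show "v \<in> ?E (r / (1 - e))"
        using e by (simp add: field_simps)
    qed
    have lo: "?E (r / (1 + e)) \<subseteq> ?S"
    proof
      fix v assume "v \<in> ?E (r / (1 + e))"
      then have v: "norm (?A *v (v - u)) * (1 + e) \<le> r"
        using e by (simp add: field_simps)
      have "B * norm (v - u) \<le> norm (?A *v (v - u))" by (rule B(2))
      also have "\<dots> \<le> norm (?A *v (v - u)) * (1 + e)" using e by (simp add: mult_le_cancel_left1)
      also have "\<dots> < B * \<delta>" using v r by simp
      finally have vQ: "v \<in> ?Q" using B(1) by (simp add: dist_norm norm_minus_commute)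
      have "norm (h v - x) \<le> norm (?A *v (v - u)) + norm (h v - x - ?A *v (v - u))"
        by (rule norm_triangle_sub)
      also have "\<dots> \<le> norm (?A *v (v - u)) * (1 + e)"
        using lin[OF vQ] by (simp add: algebra_simps)
      finally have "norm (h v - x) \<le> r" using v by simp
      then show "v \<in> ?S" using vQ by (simp add: dist_norm norm_minus_commute)
    qed
    have "emeasure \<nu> (cball x r \<inter> M) \<le> (\<integral>\<^sup>+v. ennreal ((1 + e) * ?J) * indicator (?E (r / (1 - e))) v \<partial>lborel)"
      unfolding nu using up Jv(2) by (intro nn_integral_mono) (auto simp: indicator_def intro!: ennreal_leI)
    also have "\<dots> = ennreal ((1 + e) * ?J) * ennreal (?V * (r / (1 - e)) ^ ?m / ?J)"
      using e r by (subst nn_integral_cmult_indicator) (simp_all add: E)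
    also have "\<dots> = ennreal ((1 + e) / (1 - e) ^ ?m * (?V * r ^ ?m))"
      using e r J by (subst ennreal_mult[symmetric]) (simp_all add: power_divide)
    finally have upper: "emeasure \<nu> (cball x r \<inter> M) \<le> \<dots>" .
    have "ennreal ((1 - e) / (1 + e) ^ ?m * (?V * r ^ ?m)) = ennreal ((1 - e) * ?J) * ennreal (?V * (r / (1 + e)) ^ ?m / ?J)"
      using e r J by (subst ennreal_mult[symmetric]) (simp_all add: power_divide)
    also have "\<dots> = (\<integral>\<^sup>+v. ennreal ((1 - e) * ?J) * indicator (?E (r / (1 + e))) v \<partial>lborel)"
      using e r by (subst nn_integral_cmult_indicator) (simp_all add: E)
    also have "\<dots> \<le> emeasure \<nu> (cball x r \<inter> M)"
      unfolding nu using lo Jv(1) by (intro nn_integral_mono) (auto simp: indicator_def intro!: ennreal_leI)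
    finally show ?thesis using upper by blast
  qed
  note sandwich = this
  have "\<forall>\<^sub>F r in at_right 0. 0 < r \<and> r < min r0 (B * \<delta>)"
    using r0(1) B(1) \<delta>(1) by (subst eventually_at_right[of _ 1]) (auto intro!: exI[of _ "min r0 (B * \<delta>)"])
  then show ?thesis
    by (rule eventually_mono) (intro sandwich, simp_all)
qed

end

text \<open>Quantitative form of upper box dimension at most \<open>m\<close>. Scales above 1 are
  excluded because the bound would eventually drop below 1 there.\<close>

definition fine_covers :: "nat \<Rightarrow> real \<Rightarrow> 'a::metric_space set \<Rightarrow> bool" where
  "fine_covers m N C \<longleftrightarrow> (\<forall>r. 0 < r \<longrightarrow> r \<le> 1 \<longrightarrow>
     (\<exists>P. finite P \<and> real (card P) \<le> N / r ^ m \<and> C \<subseteq> \<Union>P \<and> (\<forall>A\<in>P. \<forall>x\<in>A. \<forall>y\<in>A. dist x y \<le> r)))"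

lemma fine_coversI:
  assumes "\<And>r. 0 < r \<Longrightarrow> r \<le> 1 \<Longrightarrow> \<exists>P. finite P \<and> real (card P) \<le> N / r ^ m \<and> C \<subseteq> \<Union>P \<and>
    (\<forall>A\<in>P. \<forall>x\<in>A. \<forall>y\<in>A. dist x y \<le> r)"
  shows "fine_covers m N C"
  using assms unfolding fine_covers_def by simp

lemma fine_coversE:
  assumes "fine_covers m N C" "0 < r" "r \<le> 1"
  obtains P where "finite P" "real (card P) \<le> N / r ^ m" "C \<subseteq> \<Union>P"
    "\<forall>A\<in>P. \<forall>x\<in>A. \<forall>y\<in>A. dist x y \<le> r"
proof -
  from assms have "\<exists>P. finite P \<and> real (card P) \<le> N / r ^ m \<and> C \<subseteq> \<Union>P \<and> (\<forall>A\<in>P. \<forall>x\<in>A. \<forall>y\<in>A. dist x y \<le> r)"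
    unfolding fine_covers_def by simp
  then show thesis by (elim exE conjE) (rule that)
qed

lemma fine_covers_subset: "fine_covers m N C \<Longrightarrow> K \<subseteq> C \<Longrightarrow> fine_covers m N K"
  unfolding fine_covers_def by (meson order_trans)

lemma fine_covers_Un:
  assumes "fine_covers m N1 C" "fine_covers m N2 D"
  shows "fine_covers m (N1 + N2) (C \<union> D)"
proof (rule fine_coversI)
  fix r :: real assume r: "0 < r" "r \<le> 1"
  obtain P where P: "finite P" "real (card P) \<le> N1 / r ^ m" "C \<subseteq> \<Union>P"
    "\<forall>A\<in>P. \<forall>x\<in>A. \<forall>y\<in>A. dist x y \<le> r"
    by (rule fine_coversE[OF assms(1) r])
  obtain R where R: "finite R" "real (card R) \<le> N2 / r ^ m" "D \<subseteq> \<Union>R"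
    "\<forall>A\<in>R. \<forall>x\<in>A. \<forall>y\<in>A. dist x y \<le> r"
    by (rule fine_coversE[OF assms(2) r])
  have "real (card (P \<union> R)) \<le> real (card P) + real (card R)"
    using card_Un_le[of P R] by linarith
  then have "real (card (P \<union> R)) \<le> (N1 + N2) / r ^ m"
    using P(2) R(2) by (simp add: add_divide_distrib)
  moreover have "\<forall>A\<in>P \<union> R. \<forall>x\<in>A. \<forall>y\<in>A. dist x y \<le> r"
    using P(4) R(4) by (metis Un_iff)
  moreover have "C \<union> D \<subseteq> \<Union>(P \<union> R)"
    using P(3) R(3) by (metis Union_Un_distrib Un_mono)
  ultimately show "\<exists>P. finite P \<and> real (card P) \<le> (N1 + N2) / r ^ m \<and> C \<union> D \<subseteq> \<Union>P \<and>
      (\<forall>A\<in>P. \<forall>x\<in>A. \<forall>y\<in>A. dist x y \<le> r)"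
    using P(1) R(1) by (intro exI[of _ "P \<union> R"] conjI) simp_all
qed

text \<open>The parameter ball is cut along a cubic grid of side \<open>s\<close>, and the cells,
  indexed by the integer vectors \<open>\<kappa> v\<close>, are mapped by \<open>h\<close>.\<close>

lemma lipschitz_image_cover:
  fixes h :: "real ^ 'k::finite \<Rightarrow> 'b::metric_space"
  assumes L: "0 < L" and \<delta>: "0 < \<delta>"
    and lip: "\<And>v w. v \<in> cball u \<delta> \<Longrightarrow> w \<in> cball u \<delta> \<Longrightarrow> dist (h v) (h w) \<le> L * dist v w"
  shows "\<exists>N. fine_covers CARD('k) N (h ` cball u \<delta>)"
proof (rule exI, rule fine_coversI)
  fix r :: real assume r: "0 < r" "r \<le> 1"
  let ?k = "CARD('k)"
  \<comment> \<open>Two points of one cell differ by at most \<open>s\<close> in each of the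
    \<open>?k\<close> coordinates, so their images are within \<open>L * ?k * s = r\<close>.\<close>
  define s where "s = r / (L * real ?k)"
  have s: "0 < s" using r L by (simp add: s_def)
  define \<kappa> where "\<kappa> v = (\<lambda>i. \<lfloor>(v :: real ^ 'k) $ i / s\<rfloor>)" for v
  let ?Q = "cball u \<delta>"
  let ?Z = "PiE UNIV (\<lambda>i. {\<lfloor>(u $ i - \<delta>) / s\<rfloor>..\<lfloor>(u $ i + \<delta>) / s\<rfloor>})"
  let ?P = "(\<lambda>z. h ` {v \<in> ?Q. \<kappa> v = z}) ` (\<kappa> ` ?Q)"
  have sub: "\<kappa> ` ?Q \<subseteq> ?Z"
  proof (clarsimp simp: PiE_def extensional_def \<kappa>_def)
    fix v i assume "dist u v \<le> \<delta>"
    then have "\<bar>v $ i - u $ i\<bar> \<le> \<delta>"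
      using component_le_norm_cart[of "v - u" i] by (simp add: dist_norm norm_minus_commute)
    then have "(u $ i - \<delta>) / s \<le> v $ i / s" "v $ i / s \<le> (u $ i + \<delta>) / s"
      using s by (auto intro!: divide_right_mono)
    then show "\<lfloor>(u $ i - \<delta>) / s\<rfloor> \<le> \<lfloor>v $ i / s\<rfloor> \<and> \<lfloor>v $ i / s\<rfloor> \<le> \<lfloor>(u $ i + \<delta>) / s\<rfloor>"
      by (intro conjI floor_mono)
  qed
  have finZ: "finite ?Z" by (intro finite_PiE) auto
  have "card ?P \<le> card ?Z"
    by (rule order_trans[OF card_image_le card_mono]) (use finZ sub in \<open>auto intro: finite_subset\<close>)
  also have "real (card ?Z) = (\<Prod>i\<in>UNIV. real (card {\<lfloor>(u $ i - \<delta>) / s\<rfloor>..\<lfloor>(u $ i + \<delta>) / s\<rfloor>}))"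
    by (simp add: card_PiE)
  also have "\<dots> \<le> (\<Prod>i\<in>(UNIV :: 'k set). (2 * \<delta> * L * ?k + 2) / r)"
  proof (rule prod_mono, intro conjI)
    fix i
    let ?a = "(u $ i - \<delta>) / s" and ?b = "(u $ i + \<delta>) / s"
    have "?a \<le> ?b" using s \<delta> by (intro divide_right_mono) auto
    then have "real (card {\<lfloor>?a\<rfloor>..\<lfloor>?b\<rfloor>}) = of_int \<lfloor>?b\<rfloor> - of_int \<lfloor>?a\<rfloor> + 1"
      using floor_mono[of ?a ?b] by (simp add: of_nat_nat)
    also have "\<dots> \<le> ?b - ?a + 2"
      by linarith
    also have "?b - ?a = 2 * \<delta> * L * ?k / r"
      using r L by (simp add: s_def field_simps)
    \<comment> \<open>The additive 2 from rounding is absorbed because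
      \<open>r \<le> 1\<close>.\<close>
    also have "2 * \<delta> * L * ?k / r + 2 \<le> (2 * \<delta> * L * ?k + 2) / r"
      using r by (simp add: field_simps)
    finally show "real (card {\<lfloor>?a\<rfloor>..\<lfloor>?b\<rfloor>}) \<le> (2 * \<delta> * L * ?k + 2) / r" by simp
  qed simp
  also have "\<dots> = (2 * \<delta> * L * ?k + 2) ^ ?k / r ^ ?k"
    by (simp add: power_divide)
  finally have card: "real (card ?P) \<le> (2 * \<delta> * L * ?k + 2) ^ ?k / r ^ ?k" by simp
  have "dist x y \<le> r" if "A \<in> ?P" "x \<in> A" "y \<in> A" for A x y
  proof -
    obtain v w where vw: "v \<in> ?Q" "w \<in> ?Q" "\<kappa> v = \<kappa> w" "x = h v" "y = h w"
      using \<open>A \<in> ?P\<close> \<open>x \<in> A\<close> \<open>y \<in> A\<close> by auto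
    have "\<bar>(v - w) $ i\<bar> \<le> s" for i
    proof -
      have "\<lfloor>v $ i / s\<rfloor> = \<lfloor>w $ i / s\<rfloor>" using vw(3) by (simp add: \<kappa>_def fun_eq_iff)
      then have "\<bar>v $ i / s - w $ i / s\<bar> \<le> 1" by linarith
      then show ?thesis
        using s by (simp add: diff_divide_distrib[symmetric] field_simps)
    qed
    then have "norm (v - w) \<le> (\<Sum>i\<in>(UNIV :: 'k set). s)"
      by (intro order_trans[OF norm_le_l1_cart] sum_mono)
    then have "L * dist v w \<le> L * (?k * s)"
      using L by (simp add: dist_norm)
    also have "\<dots> = r" using L by (simp add: s_def)
    finally show ?thesis
      using lip[OF vw(1,2)] vw by simp
  qed
  moreover have "finite ?P" using finZ sub finite_subset by blast
  moreover have "h ` ?Q \<subseteq> \<Union>?P" by auto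
  ultimately show "\<exists>P. finite P \<and> real (card P) \<le> (2 * \<delta> * L * ?k + 2) ^ ?k / r ^ ?k \<and> h ` ?Q \<subseteq> \<Union>P \<and>
      (\<forall>A\<in>P. \<forall>x\<in>A. \<forall>y\<in>A. dist x y \<le> r)"
    using card by (intro exI[of _ ?P]) blast
qed

section \<open>From charts to compact subsets of the manifold\<close>

context manifold_volume
begin

text \<open>The mass bound and the covering bound hold near each point with local constants. They
  pass to finite unions, so compactness yields one pair of constants near a whole compact
  set.\<close>

definition regular_piece :: "(real ^ 'd) set \<Rightarrow> bool" where
  "regular_piece C \<longleftrightarrow> compact C \<and> C \<subseteq> M \<and>
     (\<exists>K>0. \<forall>x. \<forall>r>0. emeasure \<nu> (C \<inter> cball x r) \<le> ennreal (K * r ^ CARD('m))) \<and>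
     (\<exists>N. fine_covers CARD('m) N C)"

lemma regular_piece_empty: "regular_piece {}"
proof -
  have "fine_covers CARD('m) 0 ({} :: (real ^ 'd) set)"
    by (rule fine_coversI) (auto intro!: exI[of _ "{}"])
  then show ?thesis
    unfolding regular_piece_def by (intro conjI exI[of _ "1 :: real"] exI[of _ "0 :: real"]) auto
qed

lemma sets_nu_borel: "A \<in> sets borel \<Longrightarrow> A \<subseteq> M \<Longrightarrow> A \<in> sets \<nu>"
  unfolding sets_nu sets_restrict_space by (rule image_eqI[of A _ A]) auto

lemma regular_piece_Un:
  assumes C: "regular_piece C" and D: "regular_piece D"
  shows "regular_piece (C \<union> D)"
proof -
  from C obtain K1 N1 where C': "compact C" "C \<subseteq> M" "0 < K1"
    "\<forall>x. \<forall>r>0. emeasure \<nu> (C \<inter> cball x r) \<le> ennreal (K1 * r ^ CARD('m))" "fine_covers CARD('m) N1 C"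
    unfolding regular_piece_def by (elim conjE exE) (rule that)
  from D obtain K2 N2 where D': "compact D" "D \<subseteq> M" "0 < K2"
    "\<forall>x. \<forall>r>0. emeasure \<nu> (D \<inter> cball x r) \<le> ennreal (K2 * r ^ CARD('m))" "fine_covers CARD('m) N2 D"
    unfolding regular_piece_def by (elim conjE exE) (rule that)
  have "emeasure \<nu> ((C \<union> D) \<inter> cball x r) \<le> ennreal ((K1 + K2) * r ^ CARD('m))" if r: "0 < r" for x r
  proof -
    have "emeasure \<nu> ((C \<union> D) \<inter> cball x r) \<le> emeasure \<nu> (C \<inter> cball x r) + emeasure \<nu> (D \<inter> cball x r)"
      unfolding Int_Un_distrib2 using C'(1,2) D'(1,2)
      by (intro emeasure_subadditive sets_nu_borel) (auto simp: borel_compact)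
    also have "\<dots> \<le> ennreal (K1 * r ^ CARD('m)) + ennreal (K2 * r ^ CARD('m))"
      using C' D' r by (intro add_mono) auto
    also have "\<dots> = ennreal ((K1 + K2) * r ^ CARD('m))"
      using C' D' r by (subst ennreal_plus[symmetric]) (auto simp: algebra_simps)
    finally show ?thesis .
  qed
  moreover have "0 < K1 + K2" using C' D' by simp
  ultimately show ?thesis
    unfolding regular_piece_def using C'(1,2) D'(1,2) fine_covers_Un[OF C'(5) D'(5)]
    by (intro conjI exI[of _ "K1 + K2"] exI[of _ "N1 + N2"]) auto
qed

lemma ex_regular_piece:
  assumes y: "y \<in> M"
  shows "\<exists>W C. open W \<and> y \<in> W \<and> regular_piece C \<and> W \<inter> M \<subseteq> C"
proof -
  obtain i where "i \<in> I" "y \<in> g i ` U i"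
    using atlas y unfolding C1_atlas_def by blast
  then obtain V and h :: "real ^ 'm \<Rightarrow> real ^ 'd" and u where h: "C1_chart M V h" and u: "u \<in> V" "y = h u"
    using atlas unfolding C1_atlas_def by blast
  obtain \<delta> c L where b: "0 < \<delta>" "0 < c" "0 < L" "cball u \<delta> \<subseteq> V"
    "\<And>u' v. u' \<in> cball u \<delta> \<Longrightarrow> v \<in> cball u \<delta> \<Longrightarrow> c * dist u' v \<le> dist (h u') (h v)"
    "\<And>u' v. u' \<in> cball u \<delta> \<Longrightarrow> v \<in> cball u \<delta> \<Longrightarrow> dist (h u') (h v) \<le> L * dist u' v"
    using chart_bilipschitz[OF h u(1)] by metis
  let ?C = "h ` cball u \<delta>"
  have "regular_piece ?C"
    unfolding regular_piece_def
  proof (intro conjI)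
    show "compact ?C"
      using b chart_continuous[OF h] by (intro compact_continuous_image) (auto intro: continuous_on_subset)
    show "?C \<subseteq> M" by (rule order_trans[OF image_mono[OF b(4)] chart_image[OF h]])
    show "\<exists>K>0. \<forall>x. \<forall>r>0. emeasure \<nu> (?C \<inter> cball x r) \<le> ennreal (K * r ^ CARD('m))"
      by (rule emeasure_patch_cball[OF h b(1,4,2,5)]) auto
    show "\<exists>N. fine_covers CARD('m) N ?C"
      by (rule lipschitz_image_cover[OF b(3,1,6)])
  qed
  moreover have "openin (top_of_set M) (h ` ball u \<delta>)"
    using b by (intro chart_openin[OF h]) auto
  then obtain W where W: "open W" "h ` ball u \<delta> = M \<inter> W" by (metis openin_open)
  moreover have "y \<in> W" using W b(1) u(2) by auto
  moreover have "h ` ball u \<delta> \<subseteq> ?C" by auto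
  ultimately show ?thesis by (intro exI[of _ W] exI[of _ ?C]) auto
qed

text \<open>The piece contains a neighbourhood of \<open>K\<close> in \<open>M\<close> and not just
  \<open>K\<close>, because the limit of ball masses at a point of \<open>K\<close> sees all nearby
  points of \<open>M\<close>.\<close>

lemma compact_subset_regular_piece:
  assumes K: "compact K" "K \<subseteq> M"
  obtains W C where "open W" "K \<subseteq> W" "regular_piece C" "W \<inter> M \<subseteq> C"
proof -
  have "\<forall>y\<in>K. \<exists>WC. open (fst WC) \<and> y \<in> fst WC \<and> regular_piece (snd WC) \<and> fst WC \<inter> M \<subseteq> snd WC"
    using ex_regular_piece K(2) by fastforce
  from bchoice[OF this] obtain F
    where F: "\<forall>y\<in>K. open (fst (F y)) \<and> y \<in> fst (F y) \<and> regular_piece (snd (F y)) \<and> fst (F y) \<inter> M \<subseteq> snd (F y)"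
    by (rule exE)
  obtain T where T: "T \<subseteq> K" "finite T" "K \<subseteq> (\<Union>y\<in>T. fst (F y))"
    by (rule compactE_image[OF K(1), of K "\<lambda>y. fst (F y)"]) (use F in auto)
  have "regular_piece (\<Union>y\<in>T. snd (F y))"
    using T(2,1) by (induction T rule: finite_induct) (use F in \<open>auto intro: regular_piece_empty regular_piece_Un\<close>)
  moreover have "open (\<Union>y\<in>T. fst (F y))" using F T(1) by blast
  moreover have "(\<Union>y\<in>T. fst (F y)) \<inter> M \<subseteq> (\<Union>y\<in>T. snd (F y))" using F T(1) by blast
  ultimately show thesis using T(3) that by blast
qed

text \<open>\<open>\<nu>\<close> may be infinite and lives on \<open>M\<close>.
  \<open>\<Lambda>\<close> is its restriction to a compact piece, viewed as a finite Borel measure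
  on the whole space. Small balls centred in \<open>K\<close> have the same mass for both, and so do
  integrals of functions that vanish on \<open>M - K\<close>.\<close>

lemma local_measure:
  assumes K: "compact K" "K \<subseteq> M"
  obtains \<Lambda> c N where "finite_measure \<Lambda>" "sets \<Lambda> = sets borel" "0 < c"
    "\<And>x r. 0 < r \<Longrightarrow> measure \<Lambda> (cball x r) \<le> c * r ^ CARD('m)"
    "\<And>x. x \<in> K \<Longrightarrow> ((\<lambda>r. measure \<Lambda> (cball x r) / (unit_ball_vol (real CARD('m)) * r ^ CARD('m))) \<longlongrightarrow> 1) (at_right 0)"
    "fine_covers CARD('m) N K"
    "\<And>h. h \<in> borel_measurable borel \<Longrightarrow> (\<And>y. y \<in> M - K \<Longrightarrow> h y = 0) \<Longrightarrow> (\<integral>\<^sup>+y. h y \<partial>\<nu>) = (\<integral>\<^sup>+y. h y \<partial>\<Lambda>)"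
proof -
  obtain W C where W: "open W" "K \<subseteq> W" "W \<inter> M \<subseteq> C" and "regular_piece C"
    using compact_subset_regular_piece[OF K] by metis
  then obtain c N where C: "compact C" "C \<subseteq> M" "0 < c"
     "\<forall>x. \<forall>r>0. emeasure \<nu> (C \<inter> cball x r) \<le> ennreal (c * r ^ CARD('m))" "fine_covers CARD('m) N C"
    unfolding regular_piece_def by (elim conjE exE) (rule that)
  have KC: "K \<subseteq> C" using W K by auto
  have Cb[measurable]: "C \<in> sets borel" using C(1) by (rule borel_compact)
  have ind[measurable]: "(indicator C :: _ \<Rightarrow> ennreal) \<in> borel_measurable \<nu>"
    by (rule borel_measurable_nu) simp
  have id[measurable]: "(\<lambda>x. x) \<in> measurable \<nu> borel"
    by (rule borel_measurable_nu) simp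
  define \<Lambda> where "\<Lambda> = distr (density \<nu> (indicator C)) borel (\<lambda>x. x)"
  have sets: "sets \<Lambda> = sets borel" by (simp add: \<Lambda>_def)
  have int: "(\<integral>\<^sup>+y. h y \<partial>\<Lambda>) = (\<integral>\<^sup>+y. indicator C y * h y \<partial>\<nu>)" if [measurable]: "h \<in> borel_measurable borel" for h
  proof -
    have [measurable]: "h \<in> borel_measurable \<nu>" by (rule borel_measurable_nu) fact
    show ?thesis unfolding \<Lambda>_def by (simp add: nn_integral_distr nn_integral_density)
  qed
  have em: "emeasure \<Lambda> A = emeasure \<nu> (C \<inter> A)" if A[measurable]: "A \<in> sets borel" for A
  proof -
    have "C \<inter> A \<in> sets \<nu>"
      using C(2) by (intro sets_nu_borel) auto
    then show ?thesis
      using int[of "indicator A"] sets by (simp add: indicator_inter_arith[symmetric] A)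
  qed
  have "finite_measure \<Lambda>"
  proof
    obtain R where R: "0 < R" "C \<subseteq> cball 0 R"
      using compact_imp_bounded[OF C(1)] bounded_pos by (metis mem_cball_0 subsetI)
    have "emeasure \<Lambda> (space \<Lambda>) = emeasure \<nu> (C \<inter> cball 0 R)"
      using R(2) em[of UNIV] by (simp add: \<Lambda>_def Int_absorb2)
    also have "\<dots> \<le> ennreal (c * R ^ CARD('m))" using C(4) R(1) by blast
    also have "\<dots> < \<infinity>" by simp
    finally show "emeasure \<Lambda> (space \<Lambda>) \<noteq> \<infinity>" by simp
  qed
  then interpret finite_measure \<Lambda> .
  show thesis
  proof (rule that[OF \<open>finite_measure \<Lambda>\<close> sets C(3)])
    show "measure \<Lambda> (cball x r) \<le> c * r ^ CARD('m)" if "0 < r" for x r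
    proof -
      have "ennreal (measure \<Lambda> (cball x r)) \<le> ennreal (c * r ^ CARD('m))"
        using C(4)[rule_format, OF that, of x] em[of "cball x r"] by (simp add: emeasure_eq_measure)
      then show ?thesis
        using C(3) that by (subst (asm) ennreal_le_iff) auto
    qed
    show "fine_covers CARD('m) N K" using C(5) KC by (rule fine_covers_subset)
    show "(\<integral>\<^sup>+y. h y \<partial>\<nu>) = (\<integral>\<^sup>+y. h y \<partial>\<Lambda>)"
      if h: "h \<in> borel_measurable borel" "\<And>y. y \<in> M - K \<Longrightarrow> h y = 0" for h
      unfolding int[OF h(1)] using h(2) KC by (intro nn_integral_cong) (auto simp: space_nu indicator_def)
    fix x assume x: "x \<in> K"
    let ?V = "unit_ball_vol (real CARD('m))"
    let ?q = "\<lambda>r. measure \<Lambda> (cball x r) / (?V * r ^ CARD('m))"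
    obtain r0 where r0: "0 < r0" "cball x r0 \<subseteq> W"
      using W(1,2) x open_contains_cball by blast
    have near: "\<forall>\<^sub>F r in at_right 0. 0 < r \<and> r < r0"
      using r0(1) by (subst eventually_at_right[of _ 1]) (auto intro!: exI[of _ r0])
    have V: "0 < ?V" by simp
    have sandwich: "\<forall>\<^sub>F r in at_right 0. (1 - e) / (1 + e) ^ CARD('m) \<le> ?q r \<and> ?q r \<le> (1 + e) / (1 - e) ^ CARD('m)"
      if e: "0 < e" "e < 1" for e
    proof -
      have "x \<in> M" using x K by auto
      from volume_sandwich[OF this e] near show ?thesis
      proof eventually_elim
        case (elim r)
        have "cball x r \<inter> M = C \<inter> cball x r"
          using elim r0 W(3) C(2) by (auto simp: subset_iff)
        then have "emeasure \<nu> (cball x r \<inter> M) = ennreal (measure \<Lambda> (cball x r))"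
          using em[of "cball x r"] by (simp add: emeasure_eq_measure)
        moreover have "0 \<le> (1 + e) / (1 - e) ^ CARD('m) * (?V * r ^ CARD('m))" using e elim by simp
        moreover have "0 < ?V * r ^ CARD('m)" using V elim by simp
        ultimately show ?case
          using elim by (simp add: pos_le_divide_eq pos_divide_le_eq)
      qed
    qed
    \<comment> \<open>Both constants of \<open>sandwich\<close> tend to 1 with \<open>e\<close>, so
      each bound \<open>a\<close> below or above 1 is beaten by a suitable \<open>e\<close>.\<close>
    have lim: "((\<lambda>e :: real. (1 - e) / (1 + e) ^ CARD('m)) \<longlongrightarrow> 1) (at_right 0)"
         "((\<lambda>e. (1 + e) / (1 - e) ^ CARD('m)) \<longlongrightarrow> 1) (at_right (0::real))"
      by (auto intro!: tendsto_eq_intros)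
    show "(?q \<longlongrightarrow> 1) (at_right 0)"
    proof (rule order_tendstoI)
      fix a :: real assume "a < 1"
      then have "\<forall>\<^sub>F e in at_right 0. a < (1 - e) / (1 + e) ^ CARD('m)" by (rule order_tendstoD(1)[OF lim(1)])
      moreover have "\<forall>\<^sub>F e in at_right 0. 0 < e \<and> e < (1 :: real)"
        by (subst eventually_at_right[of _ 1]) (auto intro!: exI[of _ 1])
      ultimately have "\<forall>\<^sub>F e in at_right 0. 0 < e \<and> e < 1 \<and> a < (1 - e) / (1 + e) ^ CARD('m)"
        by eventually_elim simp
      then obtain e where "0 < e" "e < 1" "a < (1 - e) / (1 + e) ^ CARD('m)"
        using eventually_happens[of _ "at_right (0 :: real)"] by auto
      with sandwich[of e] show "\<forall>\<^sub>F r in at_right 0. a < ?q r"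
        by (auto elim: eventually_mono)
    next
      fix a :: real assume "1 < a"
      then have "\<forall>\<^sub>F e in at_right 0. (1 + e) / (1 - e) ^ CARD('m) < a" by (rule order_tendstoD(2)[OF lim(2)])
      moreover have "\<forall>\<^sub>F e in at_right 0. 0 < e \<and> e < (1 :: real)"
        by (subst eventually_at_right[of _ 1]) (auto intro!: exI[of _ 1])
      ultimately have "\<forall>\<^sub>F e in at_right 0. 0 < e \<and> e < 1 \<and> (1 + e) / (1 - e) ^ CARD('m) < a"
        by eventually_elim simp
      then obtain e where "0 < e" "e < 1" "(1 + e) / (1 - e) ^ CARD('m) < a"
        using eventually_happens[of _ "at_right (0 :: real)"] by auto
      with sandwich[of e] show "\<forall>\<^sub>F r in at_right 0. ?q r < a"
        by (auto elim: eventually_mono)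
    qed
  qed
qed

end

section \<open>Differentiation in mean\<close>

text \<open>Regularity squeezes \<open>A\<close> between a compact and an open set whose difference
  has mass less than \<open>e\<close>; a Urysohn function between them differs from the indicator
  only on that difference.\<close>

lemma finite_measure_continuous_approx_indicator:
  fixes \<Lambda> :: "'a::euclidean_space measure"
  assumes fin: "finite_measure \<Lambda>" and sets: "sets \<Lambda> = sets borel" and A: "A \<in> sets borel" and e: "0 < e"
  obtains q :: "'a \<Rightarrow> real" where "continuous_on UNIV q" "\<And>x. 0 \<le> q x" "\<And>x. q x \<le> 1"
    "(\<integral>x. \<bar>indicator A x - q x\<bar> \<partial>\<Lambda>) < e"
proof -
  interpret finite_measure \<Lambda> by fact
  have top: "emeasure \<Lambda> (space \<Lambda>) \<noteq> \<infinity>" using emeasure_finite by simp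
  \<comment> \<open>When \<open>A\<close> has mass below \<open>e / 2\<close> the difference is
    negative and \<open>ennreal\<close> truncates it; the empty set then serves as
    \<open>C\<close>.\<close>
  have "ennreal (measure \<Lambda> A - e / 2) < (SUP K\<in>{K. K \<subseteq> A \<and> compact K}. emeasure \<Lambda> K) \<or> measure \<Lambda> A - e / 2 < 0"
  proof -
    have "measure \<Lambda> A - e / 2 < 0 \<or> ennreal (measure \<Lambda> A - e / 2) < emeasure \<Lambda> A"
      using e by (cases "measure \<Lambda> A - e / 2 < 0") (auto simp: emeasure_eq_measure ennreal_less_iff not_less)
    then show ?thesis
      unfolding inner_regular[OF sets top A, symmetric] by blast
  qed
  then obtain C where C: "compact C" "C \<subseteq> A" "measure \<Lambda> A - e / 2 < measure \<Lambda> C"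
  proof
    assume "ennreal (measure \<Lambda> A - e / 2) < (SUP K\<in>{K. K \<subseteq> A \<and> compact K}. emeasure \<Lambda> K)"
    then obtain C where "compact C" "C \<subseteq> A" "ennreal (measure \<Lambda> A - e / 2) < emeasure \<Lambda> C"
      unfolding less_SUP_iff by auto
    then show thesis
      by (intro that[of C]) (auto simp: emeasure_eq_measure, meson ennreal_leI leD not_le)
  next
    assume "measure \<Lambda> A - e / 2 < 0"
    then show thesis by (intro that[of "{}"]) auto
  qed
  have "(INF U\<in>{U. A \<subseteq> U \<and> open U}. emeasure \<Lambda> U) < ennreal (measure \<Lambda> A + e / 2)"
    unfolding outer_regular[OF sets top A, symmetric] using e by (simp add: emeasure_eq_measure ennreal_less_iff)
  then obtain W where W: "open W" "A \<subseteq> W" "emeasure \<Lambda> W < ennreal (measure \<Lambda> A + e / 2)"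
    unfolding INF_less_iff by auto
  then have W': "measure \<Lambda> W < measure \<Lambda> A + e / 2"
    by (simp add: emeasure_eq_measure ennreal_less_iff)
  have "closed C" "closed (- W)" "C \<inter> - W = {}" using C W by (auto simp: compact_imp_closed)
  from Urysohn[OF this, of "1 :: real" 0] obtain q :: "'a \<Rightarrow> real"
    where q: "continuous_on UNIV q" "\<And>x. q x \<in> closed_segment 1 0" "\<And>x. x \<in> C \<Longrightarrow> q x = 1" "\<And>x. x \<in> - W \<Longrightarrow> q x = 0"
    by metis
  have q01: "0 \<le> q x" "q x \<le> 1" for x
    using q(2)[of x] by (auto simp: closed_segment_eq_real_ivl split: if_splits)
  have Cb: "C \<in> sets \<Lambda>" and Wb: "W \<in> sets \<Lambda>" using C W by (auto simp: sets borel_compact)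
  have "(\<integral>x. \<bar>indicator A x - q x\<bar> \<partial>\<Lambda>) \<le> (\<integral>x. indicator (W - C) x \<partial>\<Lambda>)"
  proof (rule integral_mono')
    show "integrable \<Lambda> (indicator (W - C) :: 'a \<Rightarrow> real)"
      using Cb Wb by (intro integrable_real_indicator) (auto simp: emeasure_eq_measure)
    show "\<bar>indicator A x - q x\<bar> \<le> indicator (W - C) x" for x
      using C(2) W(2) q01[of x] q(3,4)[of x] by (cases "x \<in> C"; cases "x \<in> W") (auto simp: indicator_def)
  qed simp
  also have "\<dots> = measure \<Lambda> (W - C)"
    using sets_eq_imp_space_eq[OF sets] by simp
  also have "\<dots> = measure \<Lambda> W - measure \<Lambda> C"
    using C W Cb Wb by (intro finite_measure_Diff) auto
  also have "\<dots> < e" using W' C(3) by linarith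
  finally show thesis using that q(1) q01 by blast
qed

lemma continuous_dense_L1:
  fixes \<Lambda> :: "'a::euclidean_space measure" and F :: "'a \<Rightarrow> real"
  assumes fin: "finite_measure \<Lambda>" and sets: "sets \<Lambda> = sets borel" and F: "integrable \<Lambda> F" and e: "0 < e"
  obtains q :: "'a \<Rightarrow> real" and B where "continuous_on UNIV q" "\<And>x. \<bar>q x\<bar> \<le> B" "(\<integral>x. \<bar>F x - q x\<bar> \<partial>\<Lambda>) < e"
proof -
  interpret finite_measure \<Lambda> by fact
  have intq: "integrable \<Lambda> q" if "continuous_on UNIV q" "\<And>x. \<bar>q x\<bar> \<le> B" for q :: "'a \<Rightarrow> real" and B
  proof (rule integrable_const_bound[of _ B])
    show "q \<in> borel_measurable \<Lambda>"
      using borel_measurable_continuous_onI[OF that(1)] by (simp add: measurable_cong_sets[OF sets refl])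
  qed (use that in auto)
  \<comment> \<open>Quantifying over all errors inside \<open>P\<close> lets the induction steps use
    their hypotheses at \<open>e / 2\<close>.\<close>
  define P where "P F \<longleftrightarrow> (\<forall>e>0. \<exists>q B. continuous_on UNIV q \<and> (\<forall>x. \<bar>q x\<bar> \<le> B) \<and> (\<integral>x. \<bar>F x - q x\<bar> \<partial>\<Lambda>) < e)"
    for F :: "'a \<Rightarrow> real"
  from F have "P F"
  proof (induction rule: integrable_induct)
    case (base A c)
    show ?case
      unfolding P_def
    proof (intro allI impI)
      fix e :: real assume e: "0 < e"
      then have pos: "0 < e / (\<bar>c\<bar> + 1)" by simp
      obtain q :: "'a \<Rightarrow> real" where q: "continuous_on UNIV q" "\<And>x. 0 \<le> q x" "\<And>x. q x \<le> 1"
        "(\<integral>x. \<bar>indicator A x - q x\<bar> \<partial>\<Lambda>) < e / (\<bar>c\<bar> + 1)"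
        by (rule finite_measure_continuous_approx_indicator[OF fin sets base(1)[unfolded sets] pos]) (rule that)
      have "(\<integral>x. \<bar>indicator A x *\<^sub>R c - q x * c\<bar> \<partial>\<Lambda>) = (\<integral>x. \<bar>c\<bar> * \<bar>indicator A x - q x\<bar> \<partial>\<Lambda>)"
        by (intro Bochner_Integration.integral_cong) (simp_all add: abs_mult[symmetric] algebra_simps)
      also have "\<dots> = \<bar>c\<bar> * (\<integral>x. \<bar>indicator A x - q x\<bar> \<partial>\<Lambda>)" by simp
      also have "\<dots> \<le> (\<bar>c\<bar> + 1) * (\<integral>x. \<bar>indicator A x - q x\<bar> \<partial>\<Lambda>)"
        by (intro mult_right_mono) auto
      also have "\<dots> < e" using q(4) by (simp add: field_simps)
      finally have "(\<integral>x. \<bar>indicator A x *\<^sub>R c - q x * c\<bar> \<partial>\<Lambda>) < e" .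
      moreover have "\<bar>q x * c\<bar> \<le> \<bar>c\<bar>" for x
        using q(2,3)[of x] by (simp add: abs_mult mult_left_le_one_le)
      moreover have "continuous_on UNIV (\<lambda>x. q x * c)" using q(1) by (intro continuous_intros)
      ultimately show "\<exists>q B. continuous_on UNIV q \<and> (\<forall>x. \<bar>q x\<bar> \<le> B) \<and> (\<integral>x. \<bar>indicator A x *\<^sub>R c - q x\<bar> \<partial>\<Lambda>) < e"
        by blast
    qed
  next
    case (add f g)
    show ?case
      unfolding P_def
    proof (intro allI impI)
      fix e :: real assume "0 < e"
      then have e2: "0 < e / 2" by simp
      obtain q B where q: "continuous_on UNIV q" "\<forall>x. \<bar>q x\<bar> \<le> B" "(\<integral>x. \<bar>f x - q x\<bar> \<partial>\<Lambda>) < e / 2"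
        using add(3) e2 unfolding P_def by blast
      obtain q' B' where q': "continuous_on UNIV q'" "\<forall>x. \<bar>q' x\<bar> \<le> B'" "(\<integral>x. \<bar>g x - q' x\<bar> \<partial>\<Lambda>) < e / 2"
        using add(4) e2 unfolding P_def by blast
      have qi: "integrable \<Lambda> q" "integrable \<Lambda> q'"
        by (rule intq[OF q(1)], use q(2) in blast) (rule intq[OF q'(1)], use q'(2) in blast)
      have "(\<integral>x. \<bar>f x + g x - (q x + q' x)\<bar> \<partial>\<Lambda>) \<le> (\<integral>x. \<bar>f x - q x\<bar> + \<bar>g x - q' x\<bar> \<partial>\<Lambda>)"
        using add(1,2) qi by (intro integral_mono) auto
      also have "\<dots> = (\<integral>x. \<bar>f x - q x\<bar> \<partial>\<Lambda>) + (\<integral>x. \<bar>g x - q' x\<bar> \<partial>\<Lambda>)"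
        using add(1,2) qi by (intro Bochner_Integration.integral_add) auto
      also have "\<dots> < e" using q(3) q'(3) by simp
      finally have "(\<integral>x. \<bar>f x + g x - (q x + q' x)\<bar> \<partial>\<Lambda>) < e" .
      moreover have "\<forall>x. \<bar>q x + q' x\<bar> \<le> B + B'" using q(2) q'(2) by (meson abs_triangle_ineq add_mono order_trans)
      moreover have "continuous_on UNIV (\<lambda>x. q x + q' x)" using q(1) q'(1) by (intro continuous_intros)
      ultimately show "\<exists>q B. continuous_on UNIV q \<and> (\<forall>x. \<bar>q x\<bar> \<le> B) \<and> (\<integral>x. \<bar>f x + g x - q x\<bar> \<partial>\<Lambda>) < e"
        by blast
    qed
  next
    case (lim f s)
    \<comment> \<open>The factor 3 of the majorant is 1 for \<open>f\<close> plus 2 for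
      \<open>s i\<close>, since the induction rule provides the bound \<open>2 * norm (f x)\<close>
      for \<open>s i\<close>.\<close>
    have "(\<lambda>i. \<integral>x. \<bar>f x - s i x\<bar> \<partial>\<Lambda>) \<longlonglongrightarrow> (\<integral>x. 0 \<partial>\<Lambda>)"
    proof (rule integral_dominated_convergence[where w = "\<lambda>x. 3 * \<bar>f x\<bar>"])
      show "AE x in \<Lambda>. (\<lambda>i. \<bar>f x - s i x\<bar>) \<longlonglongrightarrow> 0"
      proof (rule AE_I2)
        fix x assume "x \<in> space \<Lambda>"
        then have "(\<lambda>i. \<bar>f x - s i x\<bar>) \<longlonglongrightarrow> \<bar>f x - f x\<bar>"
          using lim(2) by (intro tendsto_intros) auto
        then show "(\<lambda>i. \<bar>f x - s i x\<bar>) \<longlonglongrightarrow> 0" by simp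
      qed
      show "AE x in \<Lambda>. norm \<bar>f x - s i x\<bar> \<le> 3 * \<bar>f x\<bar>" for i
        using lim(3) by (intro AE_I2) (smt (verit) real_norm_def)
    qed (use lim in auto)
    then have lim0: "(\<lambda>i. \<integral>x. \<bar>f x - s i x\<bar> \<partial>\<Lambda>) \<longlonglongrightarrow> 0" by simp
    show ?case
      unfolding P_def
    proof (intro allI impI)
      fix e :: real assume "0 < e"
      then have e2: "0 < e / 2" by simp
      have "\<forall>\<^sub>F i in sequentially. (\<integral>x. \<bar>f x - s i x\<bar> \<partial>\<Lambda>) < e / 2"
        using lim0 e2 by (rule order_tendstoD)
      then obtain i where i: "(\<integral>x. \<bar>f x - s i x\<bar> \<partial>\<Lambda>) < e / 2"
        using eventually_happens[of _ sequentially] by auto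
      obtain q B where q: "continuous_on UNIV q" "\<forall>x. \<bar>q x\<bar> \<le> B" "(\<integral>x. \<bar>s i x - q x\<bar> \<partial>\<Lambda>) < e / 2"
        using lim(5)[of i] e2 unfolding P_def by blast
      have qi: "integrable \<Lambda> q"
        by (rule intq[OF q(1)], use q(2) in blast)
      have "(\<integral>x. \<bar>f x - q x\<bar> \<partial>\<Lambda>) \<le> (\<integral>x. \<bar>f x - s i x\<bar> + \<bar>s i x - q x\<bar> \<partial>\<Lambda>)"
        using lim(1)[of i] lim(4) qi by (intro integral_mono) auto
      also have "\<dots> = (\<integral>x. \<bar>f x - s i x\<bar> \<partial>\<Lambda>) + (\<integral>x. \<bar>s i x - q x\<bar> \<partial>\<Lambda>)"
        using lim(1)[of i] lim(4) qi by (intro Bochner_Integration.integral_add) auto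
      also have "\<dots> < e" using q(3) i by simp
      finally show "\<exists>q B. continuous_on UNIV q \<and> (\<forall>x. \<bar>q x\<bar> \<le> B) \<and> (\<integral>x. \<bar>f x - q x\<bar> \<partial>\<Lambda>) < e"
        using q by blast
    qed
  qed
  then show thesis
    using that e unfolding P_def by metis
qed

text \<open>The upper bound is assumed at every centre, the limit only on \<open>K\<close>:
  interchanging the integrals in an average moves the centre to an arbitrary point.\<close>

locale ball_regular = finite_measure \<Lambda>
  for \<Lambda> :: "'a::euclidean_space measure" +
  fixes m :: nat and v c :: real and K :: "'a set"
  assumes sets_borel: "sets \<Lambda> = sets borel"
    and v_pos: "0 < v" and c_pos: "0 < c"
    and ball_le: "0 < r \<Longrightarrow> measure \<Lambda> (cball x r) \<le> c * r ^ m"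
    and K_borel: "K \<in> sets borel"
    and ball_lim: "x \<in> K \<Longrightarrow> ((\<lambda>r. measure \<Lambda> (cball x r) / (v * r ^ m)) \<longlongrightarrow> 1) (at_right 0)"
begin

text \<open>Normalised by \<open>v * r ^ m\<close> and not by the mass of the ball: when
  \<open>F\<close> is a density with respect to \<open>\<Lambda>\<close>, this is the ball mass over
  \<open>v * r ^ m\<close>, the quantity that is compared with the density of the sample.\<close>

definition average :: "real \<Rightarrow> ('a \<Rightarrow> real) \<Rightarrow> 'a \<Rightarrow> real" where
  "average r F x = (\<integral>y. (if dist x y \<le> r then F y else 0) \<partial>\<Lambda>) / (v * r ^ m)"

lemma measurable_borel [simp]: "h \<in> borel_measurable \<Lambda> \<longleftrightarrow> h \<in> borel_measurable borel"
  by (simp add: measurable_cong_sets[OF sets_borel refl])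

lemma borel_measurable_average:
  assumes "F \<in> borel_measurable borel"
  shows "average r F \<in> borel_measurable borel"
proof -
  have [measurable]: "F \<in> borel_measurable \<Lambda>" using assms by simp
  have "(\<lambda>x. \<integral>y. (if dist x y \<le> r then F y else 0) \<partial>\<Lambda>) \<in> borel_measurable borel"
  proof (rule borel_measurable_lebesgue_integral)
    have [measurable]: "snd \<in> measurable (borel \<Otimes>\<^sub>M \<Lambda>) \<Lambda>" "fst \<in> borel_measurable (borel \<Otimes>\<^sub>M \<Lambda>)" by simp_all
    have [measurable]: "snd \<in> borel_measurable ((borel :: 'a measure) \<Otimes>\<^sub>M \<Lambda>)"
      using measurable_snd[of "borel :: 'a measure" \<Lambda>] by (simp add: measurable_cong_sets[OF refl sets_borel])
    show "(\<lambda>(x, y). if dist x y \<le> r then F y else 0) \<in> borel_measurable (borel \<Otimes>\<^sub>M \<Lambda>)"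
      unfolding split_beta by measurable
  qed
  then show ?thesis
    unfolding average_def by simp
qed

lemma average_add:
  assumes "integrable \<Lambda> F" "integrable \<Lambda> G"
  shows "average r (\<lambda>y. F y + G y) x = average r F x + average r G x"
proof -
  have [measurable]: "F \<in> borel_measurable borel" "G \<in> borel_measurable borel"
    using assms borel_measurable_integrable measurable_borel by blast+
  have "integrable \<Lambda> (\<lambda>y. if dist x y \<le> r then H y else 0)" if "integrable \<Lambda> H" for H :: "'a \<Rightarrow> real"
  proof (rule Bochner_Integration.integrable_bound[OF that])
    have [measurable]: "H \<in> borel_measurable borel" using that borel_measurable_integrable measurable_borel by blast
    show "(\<lambda>y. if dist x y \<le> r then H y else 0) \<in> borel_measurable \<Lambda>" by simp
  qed auto
  note int = this[OF assms(1)] this[OF assms(2)]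
  have "(\<integral>y. (if dist x y \<le> r then F y + G y else 0) \<partial>\<Lambda>) =
      (\<integral>y. (if dist x y \<le> r then F y else 0) + (if dist x y \<le> r then G y else 0) \<partial>\<Lambda>)"
    by (intro Bochner_Integration.integral_cong) auto
  then show ?thesis
    unfolding average_def by (simp add: int add_divide_distrib)
qed

text \<open>As \<open>dist\<close> is symmetric, interchanging the integrals leaves
  \<open>\<bar>F y\<bar>\<close> times the mass of the ball about \<open>y\<close>. The constant
  \<open>c / v\<close> does not depend on \<open>r\<close>, which is what makes approximation by
  continuous functions effective.\<close>

lemma nn_integral_average_le:
  assumes F: "integrable \<Lambda> F" and r: "0 < r"
  shows "(\<integral>\<^sup>+x. ennreal \<bar>average r F x\<bar> \<partial>\<Lambda>) \<le> ennreal (c / v * (\<integral>y. \<bar>F y\<bar> \<partial>\<Lambda>))"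
proof -
  have [measurable]: "F \<in> borel_measurable borel"
    using F borel_measurable_integrable measurable_borel by blast
  interpret P: pair_sigma_finite \<Lambda> \<Lambda> ..
  have fs: "fst \<in> borel_measurable (\<Lambda> \<Otimes>\<^sub>M \<Lambda>)" "snd \<in> borel_measurable (\<Lambda> \<Otimes>\<^sub>M \<Lambda>)"
    using measurable_snd[of \<Lambda> \<Lambda>] measurable_fst[of \<Lambda> \<Lambda>] by (simp_all add: measurable_cong_sets[OF refl sets_borel])
  note fs[measurable]
  let ?w = "v * r ^ m"
  have w: "0 < ?w" using v_pos r by simp
  have "(\<integral>\<^sup>+x. ennreal \<bar>average r F x\<bar> \<partial>\<Lambda>) \<le>
        (\<integral>\<^sup>+x. \<integral>\<^sup>+y. ennreal ((if dist x y \<le> r then \<bar>F y\<bar> else 0) / ?w) \<partial>\<Lambda> \<partial>\<Lambda>)"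
  proof (rule nn_integral_mono)
    fix x
    have "average r F x = (\<integral>y. (if dist x y \<le> r then F y else 0) / ?w \<partial>\<Lambda>)"
      by (simp add: average_def)
    then have "ennreal \<bar>average r F x\<bar> \<le> (\<integral>\<^sup>+y. ennreal (norm ((if dist x y \<le> r then F y else 0) / ?w)) \<partial>\<Lambda>)"
    proof (cases "integrable \<Lambda> (\<lambda>y. (if dist x y \<le> r then F y else 0) / ?w)")
      case True
      then show ?thesis
        unfolding \<open>average r F x = _\<close> real_norm_def[symmetric] by (rule integral_norm_bound_ennreal)
    next
      case False
      then have "average r F x = 0"
        unfolding \<open>average r F x = _\<close> by (rule not_integrable_integral_eq)
      then show ?thesis by simp
    qed
    also have "\<dots> = (\<integral>\<^sup>+y. ennreal ((if dist x y \<le> r then \<bar>F y\<bar> else 0) / ?w) \<partial>\<Lambda>)"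
      using w by (intro nn_integral_cong) auto
    finally show "ennreal \<bar>average r F x\<bar> \<le> \<dots>" .
  qed
  also have "\<dots> = (\<integral>\<^sup>+y. \<integral>\<^sup>+x. ennreal ((if dist x y \<le> r then \<bar>F y\<bar> else 0) / ?w) \<partial>\<Lambda> \<partial>\<Lambda>)"
    by (rule P.Fubini') (simp add: split_beta)
  also have "\<dots> = (\<integral>\<^sup>+y. ennreal (\<bar>F y\<bar> / ?w * measure \<Lambda> (cball y r)) \<partial>\<Lambda>)"
  proof (rule nn_integral_cong)
    fix y
    have "(\<integral>\<^sup>+x. ennreal ((if dist x y \<le> r then \<bar>F y\<bar> else 0) / ?w) \<partial>\<Lambda>) =
        (\<integral>\<^sup>+x. ennreal (\<bar>F y\<bar> / ?w) * indicator (cball y r) x \<partial>\<Lambda>)"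
      by (intro nn_integral_cong) (auto simp: indicator_def dist_commute)
    also have "\<dots> = ennreal (\<bar>F y\<bar> / ?w) * emeasure \<Lambda> (cball y r)"
      by (intro nn_integral_cmult_indicator) (simp add: sets_borel)
    finally show "(\<integral>\<^sup>+x. ennreal ((if dist x y \<le> r then \<bar>F y\<bar> else 0) / ?w) \<partial>\<Lambda>) =
        ennreal (\<bar>F y\<bar> / ?w * measure \<Lambda> (cball y r))"
      using w by (simp add: emeasure_eq_measure ennreal_mult'[symmetric])
  qed
  also have "\<dots> \<le> (\<integral>\<^sup>+y. ennreal (c / v * \<bar>F y\<bar>) \<partial>\<Lambda>)"
  proof (intro nn_integral_mono ennreal_leI)
    fix y
    have "\<bar>F y\<bar> / ?w * measure \<Lambda> (cball y r) \<le> \<bar>F y\<bar> / ?w * (c * r ^ m)"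
      using w ball_le[OF r] by (intro mult_left_mono) auto
    also have "\<dots> = c / v * \<bar>F y\<bar>" using v_pos r by simp
    finally show "\<bar>F y\<bar> / ?w * measure \<Lambda> (cball y r) \<le> c / v * \<bar>F y\<bar>" .
  qed
  also have "\<dots> = ennreal (\<integral>y. c / v * \<bar>F y\<bar> \<partial>\<Lambda>)"
    using F c_pos v_pos by (intro nn_integral_eq_integral) auto
  finally show ?thesis by simp
qed

lemma average_le:
  assumes F: "\<And>y. \<bar>F y\<bar> \<le> B" "F \<in> borel_measurable borel" and r: "0 < r"
  shows "\<bar>average r F x\<bar> \<le> B * (measure \<Lambda> (cball x r) / (v * r ^ m))"
proof -
  have "\<bar>\<integral>y. (if dist x y \<le> r then F y else 0) \<partial>\<Lambda>\<bar> \<le> (\<integral>y. B * indicator (cball x r) y \<partial>\<Lambda>)"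
  proof (rule integral_abs_bound[THEN order_trans], rule integral_mono')
    show "integrable \<Lambda> (\<lambda>y. B * indicator (cball x r) y)"
      by (intro integrable_mult_right integrable_real_indicator) (auto simp: sets_borel emeasure_eq_measure)
    show "\<bar>if dist x y \<le> r then F y else 0\<bar> \<le> B * indicator (cball x r) y" for y
      using F(1)[of y] by (auto simp: indicator_def)
  qed (use order_trans[OF abs_ge_zero F(1)] in auto)
  also have "\<dots> = B * measure \<Lambda> (cball x r)"
    using sets_eq_imp_space_eq[OF sets_borel] by simp
  finally show ?thesis
    unfolding average_def using v_pos r by (simp add: abs_mult divide_right_mono)
qed

lemma ball_quotient_le: "0 < r \<Longrightarrow> measure \<Lambda> (cball x r) / (v * r ^ m) \<le> c / v"
  using ball_le[of r x] v_pos by (simp add: field_simps)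

text \<open>Up to \<open>q x\<close> times the ball quotient, which tends to 1, the average is that
  of the oscillation of \<open>q\<close> about \<open>x\<close>.\<close>

lemma average_continuous_tendsto:
  assumes q: "continuous_on UNIV q" "\<And>x. \<bar>q x\<bar> \<le> B" and r: "\<And>n. 0 < r n" "r \<longlonglongrightarrow> 0" and x: "x \<in> K"
  shows "(\<lambda>n. average (r n) q x) \<longlonglongrightarrow> q x"
proof -
  let ?a = "\<lambda>n. measure \<Lambda> (cball x (r n)) / (v * r n ^ m)"
  have qb: "q \<in> borel_measurable borel" using q(1) by (rule borel_measurable_continuous_onI)
  have "filterlim r (at_right 0) sequentially"
    using r less_imp_neq[OF r(1), symmetric] by (simp add: filterlim_at)
  with ball_lim[OF x] have a: "?a \<longlonglongrightarrow> 1" by (rule filterlim_compose)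
  have int: "integrable \<Lambda> (\<lambda>y. if dist x y \<le> r n then h y else 0)" if "\<And>y. \<bar>h y\<bar> \<le> C" "h \<in> borel_measurable borel"
    for h :: "'a \<Rightarrow> real" and C n
    using that order_trans[OF abs_ge_zero that(1)] by (intro integrable_const_bound[of _ C]) auto
  have "(\<lambda>n. average (r n) q x - q x * ?a n) \<longlonglongrightarrow> 0"
  proof (rule tendstoI)
    fix e :: real assume e: "0 < e"
    define e' where "e' = e / (2 * (c / v))"
    have e': "0 < e'" using e c_pos v_pos by (simp add: e'_def)
    have "isCont q x" using q(1) by (simp add: continuous_on_eq_continuous_at)
    then obtain d where d: "0 < d" "\<And>y. dist y x < d \<Longrightarrow> dist (q y) (q x) < e'"
      unfolding continuous_at_eps_delta using e' by metis
    have "\<forall>\<^sub>F n in sequentially. r n < d" using r(2) d(1) by (rule order_tendstoD)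
    then show "\<forall>\<^sub>F n in sequentially. dist (average (r n) q x - q x * ?a n) 0 < e"
    proof eventually_elim
      case (elim n)
      \<comment> \<open>The inner \<open>if\<close> makes the averaged function bounded by
        \<open>e'\<close> everywhere, as \<open>average_le\<close> demands.\<close>
      have "average (r n) q x - q x * ?a n = average (r n) (\<lambda>y. if dist x y \<le> r n then q y - q x else 0) x"
      proof -
        have "(\<integral>y. (if dist x y \<le> r n then q y else 0) \<partial>\<Lambda>) - q x * measure \<Lambda> (cball x (r n)) =
            (\<integral>y. (if dist x y \<le> r n then q y else 0) \<partial>\<Lambda>) - (\<integral>y. (if dist x y \<le> r n then q x else 0) \<partial>\<Lambda>)"
        proof -
          have "(\<integral>y. (if dist x y \<le> r n then q x else 0) \<partial>\<Lambda>) = (\<integral>y. q x * indicator (cball x (r n)) y \<partial>\<Lambda>)"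
            by (intro Bochner_Integration.integral_cong) (auto simp: indicator_def)
          then show ?thesis using sets_eq_imp_space_eq[OF sets_borel] by simp
        qed
        also have "\<dots> = (\<integral>y. (if dist x y \<le> r n then q y else 0) - (if dist x y \<le> r n then q x else 0) \<partial>\<Lambda>)"
          using int[of q B] int[of "\<lambda>_. q x" "\<bar>q x\<bar>"] q qb by (intro Bochner_Integration.integral_diff[symmetric]) auto
        also have "\<dots> = (\<integral>y. (if dist x y \<le> r n then (if dist x y \<le> r n then q y - q x else 0) else 0) \<partial>\<Lambda>)"
          by (intro Bochner_Integration.integral_cong) auto
        finally show ?thesis
          unfolding average_def by (simp add: diff_divide_distrib[symmetric])
      qed
      moreover have "\<bar>average (r n) (\<lambda>y. if dist x y \<le> r n then q y - q x else 0) x\<bar> \<le> e' * ?a n"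
      proof (rule average_le)
        show "\<bar>if dist x y \<le> r n then q y - q x else 0\<bar> \<le> e'" for y
          using d(2)[of y] elim e' by (auto simp: dist_commute dist_real_def intro!: less_imp_le)
      qed (use qb r in auto)
      moreover have "e' * ?a n \<le> e' * (c / v)"
        using ball_quotient_le[OF r(1)] e' by (intro mult_left_mono) auto
      moreover have "e' * (c / v) < e" using e c_pos v_pos by (simp add: e'_def)
      ultimately show ?case by simp
    qed
  qed
  from tendsto_add[OF this tendsto_mult_left[OF a, of "q x"]] show ?thesis by simp
qed

text \<open>\<open>F\<close> is replaced by a bounded continuous \<open>q\<close>. For
  \<open>q\<close> the pointwise limit on \<open>K\<close> passes to the integral by domination, and
  the replacement costs at most \<open>c / v + 1\<close> times the distance of \<open>F\<close> and
  \<open>q\<close>, uniformly in \<open>n\<close>.\<close>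

theorem average_tendsto_L1:
  assumes F: "integrable \<Lambda> F" and r: "\<And>n. 0 < r n" "r \<longlonglongrightarrow> 0"
  shows "(\<lambda>n. \<integral>\<^sup>+x\<in>K. ennreal \<bar>average (r n) F x - F x\<bar> \<partial>\<Lambda>) \<longlonglongrightarrow> 0"
proof -
  have Fb[measurable]: "F \<in> borel_measurable borel"
    using F borel_measurable_integrable measurable_borel by blast
  have small: "\<forall>\<^sub>F n in sequentially. (\<integral>\<^sup>+x\<in>K. ennreal \<bar>average (r n) F x - F x\<bar> \<partial>\<Lambda>) \<le> ennreal e"
    if e: "0 < e" for e
  proof -
    define \<eta> where "\<eta> = e / (2 * (c / v + 1))"
    have cv: "0 < c / v" using c_pos v_pos by simp
    have "e / (2 * D) * D = e / 2" if "0 < D" for D :: real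
      using that by (simp add: field_simps)
    with cv have \<eta>: "0 < \<eta>" "\<eta> * (c / v + 1) = e / 2"
      unfolding \<eta>_def using e by (simp, metis add_pos_pos zero_less_one)
    obtain q B where q: "continuous_on UNIV q" "\<And>x. \<bar>q x\<bar> \<le> B" "(\<integral>x. \<bar>F x - q x\<bar> \<partial>\<Lambda>) < \<eta>"
      by (rule continuous_dense_L1[OF finite_measure_axioms sets_borel F \<eta>(1)]) (rule that)
    have qb[measurable]: "q \<in> borel_measurable borel" using q(1) by (rule borel_measurable_continuous_onI)
    have qi: "integrable \<Lambda> q" using q(2) qb by (intro integrable_const_bound[of _ B]) auto
    have Fq: "integrable \<Lambda> (\<lambda>y. F y - q y)" using F qi by simp
    note K_borel[measurable]
    note [measurable] = borel_measurable_average[OF qb] borel_measurable_average[OF Fb]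
    have [measurable]: "average s (\<lambda>y. F y - q y) \<in> borel_measurable borel" for s
      by (rule borel_measurable_average) simp
    have "(\<lambda>n. \<integral>\<^sup>+x\<in>K. ennreal \<bar>average (r n) q x - q x\<bar> \<partial>\<Lambda>) \<longlonglongrightarrow> (\<integral>\<^sup>+x. 0 \<partial>\<Lambda>)"
    proof (rule nn_integral_dominated_convergence[where w = "\<lambda>_. ennreal (B * (c / v) + B)"])
      show "AE x in \<Lambda>. ennreal \<bar>average (r n) q x - q x\<bar> * indicator K x \<le> ennreal (B * (c / v) + B)" for n
      proof (rule AE_I2)
        fix x
        have "0 \<le> B" using order_trans[OF abs_ge_zero q(2)] .
        have "\<bar>average (r n) q x\<bar> \<le> B * (measure \<Lambda> (cball x (r n)) / (v * r n ^ m))"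
          by (rule average_le[OF q(2) qb r(1)])
        also have "\<dots> \<le> B * (c / v)"
          using ball_quotient_le[OF r(1)] \<open>0 \<le> B\<close> by (rule mult_left_mono)
        finally have "\<bar>average (r n) q x - q x\<bar> \<le> B * (c / v) + B"
          using q(2)[of x] by linarith
        then show "ennreal \<bar>average (r n) q x - q x\<bar> * indicator K x \<le> ennreal (B * (c / v) + B)"
          by (auto simp: indicator_def intro: ennreal_leI)
      qed
      show "(\<integral>\<^sup>+x. ennreal (B * (c / v) + B) \<partial>\<Lambda>) < \<infinity>"
        by (simp add: emeasure_eq_measure ennreal_mult_eq_top_iff less_top[symmetric])
      show "AE x in \<Lambda>. (\<lambda>n. ennreal \<bar>average (r n) q x - q x\<bar> * indicator K x) \<longlonglongrightarrow> 0"
      proof (rule AE_I2)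
        fix x
        show "(\<lambda>n. ennreal \<bar>average (r n) q x - q x\<bar> * indicator K x) \<longlonglongrightarrow> 0"
        proof (cases "x \<in> K")
          case True
          have "(\<lambda>n. \<bar>average (r n) q x - q x\<bar>) \<longlonglongrightarrow> \<bar>q x - q x\<bar>"
            by (intro tendsto_intros average_continuous_tendsto[OF q(1,2) r True])
          then have "(\<lambda>n. ennreal \<bar>average (r n) q x - q x\<bar>) \<longlonglongrightarrow> ennreal 0"
            by (intro tendsto_ennrealI) simp
          then show ?thesis using True by simp
        qed simp
      qed
    qed simp_all
    then have "(\<lambda>n. \<integral>\<^sup>+x\<in>K. ennreal \<bar>average (r n) q x - q x\<bar> \<partial>\<Lambda>) \<longlonglongrightarrow> 0" by simp
    moreover have "0 < ennreal (e / 2)" using e by simp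
    ultimately have "\<forall>\<^sub>F n in sequentially. (\<integral>\<^sup>+x\<in>K. ennreal \<bar>average (r n) q x - q x\<bar> \<partial>\<Lambda>) < ennreal (e / 2)"
      by (rule order_tendstoD)
    then show ?thesis
    proof eventually_elim
      case (elim n)
      have "(\<integral>\<^sup>+x\<in>K. ennreal \<bar>average (r n) F x - F x\<bar> \<partial>\<Lambda>) \<le>
         (\<integral>\<^sup>+x. (ennreal \<bar>average (r n) (\<lambda>y. F y - q y) x\<bar> + ennreal \<bar>F x - q x\<bar>) +
             ennreal \<bar>average (r n) q x - q x\<bar> * indicator K x \<partial>\<Lambda>)"
      proof (rule nn_integral_mono)
        fix x
        have "average (r n) F x = average (r n) (\<lambda>y. F y - q y) x + average (r n) q x"
          using average_add[OF Fq qi, of "r n" x] by simp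
        then have "\<bar>average (r n) F x - F x\<bar> \<le>
            \<bar>average (r n) (\<lambda>y. F y - q y) x\<bar> + \<bar>F x - q x\<bar> + \<bar>average (r n) q x - q x\<bar>"
          by linarith
        then have "ennreal \<bar>average (r n) F x - F x\<bar> \<le> ennreal \<bar>average (r n) (\<lambda>y. F y - q y) x\<bar> +
            ennreal \<bar>F x - q x\<bar> + ennreal \<bar>average (r n) q x - q x\<bar>"
          by (simp add: ennreal_plus[symmetric] ennreal_leI del: ennreal_plus)
        then show "ennreal \<bar>average (r n) F x - F x\<bar> * indicator K x \<le>
            (ennreal \<bar>average (r n) (\<lambda>y. F y - q y) x\<bar> + ennreal \<bar>F x - q x\<bar>) +
             ennreal \<bar>average (r n) q x - q x\<bar> * indicator K x"
          by (simp add: indicator_def)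
      qed
      also have "\<dots> = (\<integral>\<^sup>+x. ennreal \<bar>average (r n) (\<lambda>y. F y - q y) x\<bar> \<partial>\<Lambda>) + (\<integral>\<^sup>+x. ennreal \<bar>F x - q x\<bar> \<partial>\<Lambda>) +
           (\<integral>\<^sup>+x\<in>K. ennreal \<bar>average (r n) q x - q x\<bar> \<partial>\<Lambda>)"
        by (subst nn_integral_add, simp, simp, subst nn_integral_add) simp_all
      also have "\<dots> \<le> ennreal (c / v * (\<integral>y. \<bar>F y - q y\<bar> \<partial>\<Lambda>)) + ennreal (\<integral>y. \<bar>F y - q y\<bar> \<partial>\<Lambda>) + ennreal (e / 2)"
        using elim Fq by (intro add_mono nn_integral_average_le r) (auto simp: nn_integral_eq_integral)
      also have "\<dots> \<le> ennreal e"
      proof -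
        have sum: "ennreal x + ennreal y + ennreal z \<le> ennreal e"
          if "0 \<le> x" "0 \<le> y" "0 \<le> z" "x + y + z \<le> e" for x y z
          using that by (simp add: ennreal_plus[symmetric] ennreal_leI del: ennreal_plus)
        have "0 \<le> (\<integral>y. \<bar>F y - q y\<bar> \<partial>\<Lambda>)" by simp
        moreover from this have "0 \<le> c / v * (\<integral>y. \<bar>F y - q y\<bar> \<partial>\<Lambda>)"
          using cv by (intro mult_nonneg_nonneg) auto
        moreover have "(c / v + 1) * (\<integral>y. \<bar>F y - q y\<bar> \<partial>\<Lambda>) \<le> (c / v + 1) * \<eta>"
          using q(3) cv by (intro mult_left_mono) auto
        then have "c / v * (\<integral>y. \<bar>F y - q y\<bar> \<partial>\<Lambda>) + (\<integral>y. \<bar>F y - q y\<bar> \<partial>\<Lambda>) + e / 2 \<le> e"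
          using \<eta>(2) by (simp only: distrib_right distrib_left mult_1_left mult_1_right mult.commute[of \<eta>])
        ultimately show ?thesis
          using e by (intro sum) auto
      qed
      finally show ?case .
    qed
  qed
  show ?thesis
  proof (rule order_tendstoI)
    fix a :: ennreal assume "0 < a"
    then obtain e where e: "0 < e" "ennreal e < a"
    proof (cases a)
      case (real x)
      then show thesis using \<open>0 < a\<close> by (intro that[of "x / 2"]) (auto simp: ennreal_less_iff)
    next
      case top
      then show thesis by (intro that[of 1]) auto
    qed
    show "\<forall>\<^sub>F n in sequentially. (\<integral>\<^sup>+x\<in>K. ennreal \<bar>average (r n) F x - F x\<bar> \<partial>\<Lambda>) < a"
      using small[OF e(1)] by eventually_elim (rule le_less_trans[OF _ e(2)])
  qed simp
qed

end

section \<open>Counting sample points in disjoint sets\<close>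

text \<open>\<open>P (Bin (n, q) < k)\<close>, by conditioning on one trial: this is how one more sample point enters below.\<close>

fun binomial_less :: "nat \<Rightarrow> nat \<Rightarrow> real \<Rightarrow> real" where
  "binomial_less 0 k q = (if k = 0 then 0 else 1)"
| "binomial_less (Suc n) k q = q * binomial_less n (k - 1) q + (1 - q) * binomial_less n k q"

lemma binomial_less_0 [simp]: "binomial_less n 0 q = 0"
  by (induction n) auto

lemma binomial_less_bounds:
  assumes "0 \<le> q" "q \<le> 1"
  shows "0 \<le> binomial_less n k q \<and> binomial_less n k q \<le> 1 \<and> binomial_less n (k - 1) q \<le> binomial_less n k q"
proof (induction n arbitrary: k)
  case (Suc n)
  note IH = Suc[of k] Suc[of "k - 1"]
  have "0 \<le> binomial_less (Suc n) k q"
    using assms IH by simp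
  moreover have "binomial_less (Suc n) k q \<le> 1"
    using assms IH by (simp add: convex_bound_le)
  moreover have "binomial_less (Suc n) (k - 1) q \<le> binomial_less (Suc n) k q"
    using assms IH by (auto intro!: add_mono mult_left_mono)
  ultimately show ?case by blast
qed auto

text \<open>An additional trial matters only if it succeeds, which has probability
  \<open>q\<close>.\<close>

lemma binomial_less_Suc_le:
  assumes "0 \<le> q" "q \<le> 1"
  shows "binomial_less n k q \<le> binomial_less (Suc n) k q + q"
proof -
  have "binomial_less (Suc n) k q - binomial_less n k q = q * (binomial_less n (k - 1) q - binomial_less n k q)"
    by (simp add: algebra_simps)
  also have "\<dots> \<ge> q * (- 1)"
    using binomial_less_bounds[OF assms, of n k] binomial_less_bounds[OF assms, of n "k - 1"] assms(1)
    by (intro mult_left_mono) auto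
  finally show ?thesis by simp
qed

text \<open>Changing the success probability of one trial costs at most
  \<open>\<bar>q - q'\<bar>\<close>, because the two conditional probabilities differ by at most 1;
  the recursion adds up \<open>n\<close> such costs.\<close>

lemma binomial_less_lipschitz:
  assumes "0 \<le> q" "q \<le> 1" "0 \<le> q'" "q' \<le> 1"
  shows "\<bar>binomial_less n k q - binomial_less n k q'\<bar> \<le> real n * \<bar>q - q'\<bar>"
proof (induction n arbitrary: k)
  case (Suc n)
  let ?R = "binomial_less n"
  have "binomial_less (Suc n) k q - binomial_less (Suc n) k q' =
      q * (?R (k - 1) q - ?R (k - 1) q') + (1 - q) * (?R k q - ?R k q') + (q - q') * (?R (k - 1) q' - ?R k q')"
    by (simp add: algebra_simps)
  also have "\<bar>\<dots>\<bar> \<le> \<bar>q * (?R (k - 1) q - ?R (k - 1) q')\<bar> + \<bar>(1 - q) * (?R k q - ?R k q')\<bar> + \<bar>(q - q') * (?R (k - 1) q' - ?R k q')\<bar>"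
    by linarith
  also have "\<dots> \<le> q * (real n * \<bar>q - q'\<bar>) + (1 - q) * (real n * \<bar>q - q'\<bar>) + \<bar>q - q'\<bar> * 1"
    using assms Suc binomial_less_bounds[OF assms(3,4), of n k] binomial_less_bounds[OF assms(3,4), of n "k - 1"]
    unfolding abs_mult by (intro add_mono mult_mono) auto
  also have "\<dots> = real (Suc n) * \<bar>q - q'\<bar>" by (simp add: algebra_simps)
  finally show ?case .
qed simp

lemma binomial_less_at_0: "0 < k \<Longrightarrow> binomial_less n k 0 = 1"
  by (induction n) auto

lemma binomial_less_ge:
  assumes "0 \<le> q" "q \<le> 1" "0 < k"
  shows "1 - real n * q \<le> binomial_less n k q"
  using binomial_less_lipschitz[OF assms(1,2) order_refl zero_le_one, of n k] binomial_less_at_0[OF assms(3), of n] assms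
  by simp

lemma binomial_less_eq_sum: "binomial_less n k q = (\<Sum>j<k. real (n choose j) * q ^ j * (1 - q) ^ (n - j))"
proof (induction n arbitrary: k)
  case 0
  have "(\<Sum>j<k. real (0 choose j) * q ^ j * (1 - q) ^ (0 - j)) = (\<Sum>j<k. if j = 0 then 1 else 0)"
    by (intro sum.cong) auto
  then show ?case by simp
next
  case (Suc n)
  let ?b = "\<lambda>n j. real (n choose j) * q ^ j * (1 - q) ^ (n - j)"
  have step: "?b (Suc n) (Suc j) = q * ?b n j + (1 - q) * ?b n (Suc j)" for j
  proof (cases "j < n")
    case True
    then have "n - j = Suc (n - Suc j)" by simp
    then show ?thesis by (simp add: algebra_simps)
  qed (auto simp: binomial_eq_0)
  have zero: "?b (Suc n) 0 = (1 - q) * ?b n 0" by simp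
  show ?case
  proof (cases k)
    case 0
    then show ?thesis by simp
  next
    case k: (Suc l)
    have "(\<Sum>j<k. ?b (Suc n) j) = ?b (Suc n) 0 + (\<Sum>j<l. ?b (Suc n) (Suc j))"
      unfolding k by (rule sum.lessThan_Suc_shift)
    also have "\<dots> = q * (\<Sum>j<l. ?b n j) + (1 - q) * (?b n 0 + (\<Sum>j<l. ?b n (Suc j)))"
      unfolding step zero by (simp add: sum.distrib sum_distrib_left distrib_left)
    also have "?b n 0 + (\<Sum>j<l. ?b n (Suc j)) = (\<Sum>j<k. ?b n j)"
      unfolding k by (rule sum.lessThan_Suc_shift[symmetric])
    finally show ?thesis using Suc by (simp add: k)
  qed
qed

section \<open>The Poisson limit\<close>

definition poisson_less :: "nat \<Rightarrow> real \<Rightarrow> real" where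
  "poisson_less k l = (\<Sum>j<k. exp (- l) * l ^ j / fact j)"

lemma binomial_less_tendsto:
  "(\<lambda>n. binomial_less n k (l / real n)) \<longlonglongrightarrow> poisson_less k l"
  unfolding binomial_less_eq_sum poisson_less_def
proof (rule tendsto_sum)
  fix j
  have lim0: "(\<lambda>n. l / real n) \<longlonglongrightarrow> 0" and lim1: "(\<lambda>n. real i / real n) \<longlonglongrightarrow> 0" for i
    by (rule lim_const_over_n)+
  have A: "(\<lambda>n. real (n choose j) * (l / real n) ^ j) \<longlonglongrightarrow> l ^ j / fact j"
  proof -
    \<comment> \<open>The binomial coefficient is a product of \<open>j\<close> factors, a number
      fixed in \<open>n\<close>, so the powers of \<open>n\<close> cancel factor by factor.\<close>
    have "(\<lambda>n. \<Prod>i = 0..<j. (1 - real i / real n) * (l / real (j - i))) \<longlonglongrightarrow> (\<Prod>i = 0..<j. (1 - 0) * (l / real (j - i)))"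
      by (intro tendsto_intros lim1)
    also have "(\<Prod>i = 0..<j. (1 - 0) * (l / real (j - i))) = l ^ j / fact j"
    proof -
      have "(\<Prod>i = 0..<j. real (j - i)) = fact j"
        using fact_prod_rev[of j, where 'a = real] by simp
      then show ?thesis by (simp add: prod_dividef)
    qed
    finally have "(\<lambda>n. \<Prod>i = 0..<j. (1 - real i / real n) * (l / real (j - i))) \<longlonglongrightarrow> l ^ j / fact j" .
    moreover have "\<forall>\<^sub>F n in sequentially. (\<Prod>i = 0..<j. (1 - real i / real n) * (l / real (j - i))) = real (n choose j) * (l / real n) ^ j"
      using eventually_ge_at_top[of "Suc j"]
    proof eventually_elim
      case (elim n)
      have "real (n choose j) * (l / real n) ^ j = (\<Prod>i = 0..<j. real (n - i) / real (j - i)) * (\<Prod>i = 0..<j. l / real n)"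
        using elim by (subst binomial_altdef_of_nat) auto
      also have "\<dots> = (\<Prod>i = 0..<j. (1 - real i / real n) * (l / real (j - i)))"
        unfolding prod.distrib[symmetric] using elim by (intro prod.cong) (auto simp: field_simps of_nat_diff)
      finally show ?case by simp
    qed
    ultimately show ?thesis by (rule Lim_transform_eventually)
  qed
  have B: "(\<lambda>n. (1 - l / real n) ^ (n - j)) \<longlonglongrightarrow> exp (- l)"
  proof -
    have "(\<lambda>n. (1 + - l / real n) ^ n / (1 - l / real n) ^ j) \<longlonglongrightarrow> exp (- l) / (1 - 0) ^ j"
      by (intro tendsto_intros lim0 tendsto_exp_limit_sequentially) auto
    then have "(\<lambda>n. (1 - l / real n) ^ n / (1 - l / real n) ^ j) \<longlonglongrightarrow> exp (- l)" by simp
    moreover have "\<forall>\<^sub>F n in sequentially. l / real n < 1"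
      using lim0 by (rule order_tendstoD) simp
    then have "\<forall>\<^sub>F n in sequentially. (1 - l / real n) ^ n / (1 - l / real n) ^ j = (1 - l / real n) ^ (n - j)"
      using eventually_ge_at_top[of j]
    proof eventually_elim
      case (elim n)
      then have "1 - l / real n \<noteq> 0" by linarith
      from power_diff[OF this elim(2)] show ?case by simp
    qed
    ultimately show ?thesis by (rule Lim_transform_eventually)
  qed
  show "(\<lambda>n. real (n choose j) * (l / real n) ^ j * (1 - l / real n) ^ (n - j)) \<longlonglongrightarrow> exp (- l) * l ^ j / fact j"
    using tendsto_mult[OF A B] by (simp add: mult.commute)
qed

lemma poisson_less_bounds: "0 \<le> l \<Longrightarrow> 0 \<le> poisson_less k l \<and> poisson_less k l \<le> 1"
proof -
  assume l: "0 \<le> l"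
  have "\<forall>\<^sub>F n in sequentially. 0 \<le> binomial_less n k (l / real n) \<and> binomial_less n k (l / real n) \<le> 1"
    using eventually_ge_at_top[of "Suc (nat \<lceil>l\<rceil>)"]
  proof eventually_elim
    case (elim n)
    then have "l \<le> real n" by linarith
    then show ?case using l elim binomial_less_bounds[of "l / real n" n k] by simp
  qed
  then show ?thesis
    using binomial_less_tendsto[of k l]
    by (auto intro: tendsto_lowerbound tendsto_upperbound elim: eventually_mono)
qed

section \<open>Hit counts of independent points\<close>

context prob_space
begin

abbreviation hits :: "nat set \<Rightarrow> 'a set \<Rightarrow> (nat \<Rightarrow> 'a) \<Rightarrow> nat" where
  "hits J A x \<equiv> card {j \<in> J. x j \<in> A}"

lemma hits_measurable:
  assumes [measurable]: "A \<in> events" and "I \<subseteq> J"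
  shows "hits I A \<in> measurable (Pi\<^sub>M J (\<lambda>_. M)) (count_space UNIV)"
proof (rule measurable_card)
  fix i
  have "{x \<in> space (Pi\<^sub>M J (\<lambda>_. M)). i \<in> I \<and> x i \<in> A} \<in> sets (Pi\<^sub>M J (\<lambda>_. M))"
  proof (cases "i \<in> I")
    case True
    then have "i \<in> J" using assms by auto
    then show ?thesis by measurable
  qed simp
  then show "{x \<in> space (Pi\<^sub>M J (\<lambda>_. M)). i \<in> {j \<in> I. x j \<in> A}} \<in> sets (Pi\<^sub>M J (\<lambda>_. M))" by simp
qed

lemma hits_fun_upd:
  assumes "finite J" "i \<notin> J"
  shows "hits (insert i J) A (x(i := y)) = (if y \<in> A then Suc (hits J A x) else hits J A x)"
proof -
  have "{j \<in> insert i J. (x(i := y)) j \<in> A} = (if y \<in> A then insert i {j \<in> J. x j \<in> A} else {j \<in> J. x j \<in> A})"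
    using assms by auto
  then show ?thesis using assms by auto
qed

text \<open>Conditioning on the new point, which lies in \<open>A\<close>, in \<open>B\<close> or in
  neither. At the threshold 0 the truncated \<open>k - 1\<close> is still right, because no count is
  below 0.\<close>

lemma nn_integral_hits_insert:
  assumes A[measurable]: "A \<in> events" and B[measurable]: "B \<in> events" and disj: "A \<inter> B = {}"
    and J: "finite J" "i \<notin> J"
  defines "q \<equiv> \<lambda>J k l. \<integral>\<^sup>+x. of_bool (hits J A x < k \<and> hits J B x < l) \<partial>Pi\<^sub>M J (\<lambda>_. M)"
  shows "q (insert i J) k l =
     ennreal (prob A) * q J (k - 1) l + ennreal (prob B) * q J k (l - 1) + ennreal (1 - prob A - prob B) * q J k l"
proof -
  interpret product_sigma_finite "\<lambda>_ :: nat. M" ..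
  note [measurable] = hits_measurable[OF A] hits_measurable[OF B]
  have m: "(\<lambda>x. of_bool (hits J' A x < k \<and> hits J' B x < l) :: ennreal) \<in> borel_measurable (Pi\<^sub>M J' (\<lambda>_. M))" for J' k l
    by measurable
  let ?C = "space M - A - B"
  have C: "prob ?C = 1 - prob A - prob B"
  proof -
    have "?C = space M - (A \<union> B)" by auto
    then show ?thesis
      using prob_compl[of "A \<union> B"] finite_measure_Union[OF A B disj] by simp
  qed
  have "q (insert i J) k l = (\<integral>\<^sup>+x. (\<integral>\<^sup>+y. of_bool (hits (insert i J) A (x(i := y)) < k \<and> hits (insert i J) B (x(i := y)) < l) \<partial>M) \<partial>Pi\<^sub>M J (\<lambda>_. M))"
    unfolding q_def by (rule product_nn_integral_insert[OF J m])
  also have "\<dots> = (\<integral>\<^sup>+x. ennreal (prob A) * of_bool (hits J A x < k - 1 \<and> hits J B x < l) +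
      ennreal (prob B) * of_bool (hits J A x < k \<and> hits J B x < l - 1) +
      ennreal (1 - prob A - prob B) * of_bool (hits J A x < k \<and> hits J B x < l) \<partial>Pi\<^sub>M J (\<lambda>_. M))"
  proof (rule nn_integral_cong)
    fix x
    let ?a = "of_bool (hits J A x < k - 1 \<and> hits J B x < l) :: ennreal"
      and ?b = "of_bool (hits J A x < k \<and> hits J B x < l - 1) :: ennreal"
      and ?c = "of_bool (hits J A x < k \<and> hits J B x < l) :: ennreal"
    have "(\<integral>\<^sup>+y. of_bool (hits (insert i J) A (x(i := y)) < k \<and> hits (insert i J) B (x(i := y)) < l) \<partial>M) =
        (\<integral>\<^sup>+y. ?a * indicator A y + ?b * indicator B y + ?c * indicator ?C y \<partial>M)"
      unfolding hits_fun_upd[OF J] using disj by (intro nn_integral_cong) (auto simp: indicator_def)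
    also have "\<dots> = ?a * emeasure M A + ?b * emeasure M B + ?c * emeasure M ?C"
      by (subst nn_integral_add, simp, simp, subst nn_integral_add) (simp_all add: nn_integral_cmult_indicator)
    finally show "(\<integral>\<^sup>+y. of_bool (hits (insert i J) A (x(i := y)) < k \<and> hits (insert i J) B (x(i := y)) < l) \<partial>M) =
        ennreal (prob A) * ?a + ennreal (prob B) * ?b + ennreal (1 - prob A - prob B) * ?c"
      by (simp add: emeasure_eq_measure C mult.commute)
  qed
  also have "\<dots> = ennreal (prob A) * q J (k - 1) l + ennreal (prob B) * q J k (l - 1) + ennreal (1 - prob A - prob B) * q J k l"
    unfolding q_def using m[of J]
    by (subst nn_integral_add, simp, simp, subst nn_integral_add) (simp_all add: nn_integral_cmult)
  finally show ?thesis .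
qed

lemma prob_disjoint_le:
  assumes A: "A \<in> events" and B: "B \<in> events" and disj: "A \<inter> B = {}"
  shows "prob A + prob B \<le> 1"
  using finite_measure_Union[OF A B disj] prob_le_1[of "A \<union> B"] by simp

lemma nn_integral_hits:
  assumes A: "A \<in> events" and J: "finite J"
  shows "(\<integral>\<^sup>+x. of_bool (hits J A x < k) \<partial>Pi\<^sub>M J (\<lambda>_. M)) = ennreal (binomial_less (card J) k (prob A))"
proof -
  \<comment> \<open>The two-set recursion is used with an empty second set and threshold 1, which
    makes the second condition true.\<close>
  let ?q = "\<lambda>J k l. \<integral>\<^sup>+x. of_bool (hits J A x < k \<and> hits J {} x < l) \<partial>Pi\<^sub>M J (\<lambda>_. M)"
  have "?q J k 1 = ennreal (binomial_less (card J) k (prob A))"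
    using J
  proof (induction J arbitrary: k rule: finite_induct)
    case empty
    interpret E: prob_space "Pi\<^sub>M {} (\<lambda>_ :: nat. M)" by (rule prob_space_PiM) (rule prob_space_axioms)
    show ?case using E.emeasure_space_1 by (cases k) auto
  next
    case (insert i J)
    have "?q (insert i J) k 1 = ennreal (prob A) * ?q J (k - 1) 1 + ennreal (prob {}) * ?q J k (1 - 1) + ennreal (1 - prob A - prob {}) * ?q J k 1"
      by (rule nn_integral_hits_insert) (use A insert in auto)
    also have "\<dots> = ennreal (prob A) * ennreal (binomial_less (card J) (k - 1) (prob A)) +
        ennreal (1 - prob A) * ennreal (binomial_less (card J) k (prob A))"
      using insert.IH[of k] insert.IH[of "k - 1"] by simp
    also have "\<dots> = ennreal (binomial_less (card (insert i J)) k (prob A))"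
      using insert(1,2) binomial_less_bounds[of "prob A" "card J" k] binomial_less_bounds[of "prob A" "card J" "k - 1"]
      by (simp add: ennreal_mult[symmetric] ennreal_plus[symmetric] del: ennreal_plus)
    finally show ?case .
  qed
  then show ?thesis by simp
qed

text \<open>Negative dependence. It replaces the joint limit law of two counts, because the mean square
  error only needs an upper bound for their joint probability.\<close>

lemma nn_integral_hits_disjoint_le:
  assumes A: "A \<in> events" and B: "B \<in> events" and disj: "A \<inter> B = {}" and J: "finite J"
  shows "(\<integral>\<^sup>+x. of_bool (hits J A x < k \<and> hits J B x < l) \<partial>Pi\<^sub>M J (\<lambda>_. M)) \<le>
     ennreal (binomial_less (card J) k (prob A) * binomial_less (card J) l (prob B))"
  using J
proof (induction J arbitrary: k l rule: finite_induct)
  case empty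
  interpret E: prob_space "Pi\<^sub>M {} (\<lambda>_ :: nat. M)" by (rule prob_space_PiM) (rule prob_space_axioms)
  show ?case using E.emeasure_space_1 by (cases k; cases l) auto
next
  case (insert i J)
  let ?q = "\<lambda>J k l. \<integral>\<^sup>+x. of_bool (hits J A x < k \<and> hits J B x < l) \<partial>Pi\<^sub>M J (\<lambda>_. M)"
  let ?a = "prob A" and ?b = "prob B"
  let ?x = "binomial_less (card J) k ?a" and ?x' = "binomial_less (card J) (k - 1) ?a"
  let ?y = "binomial_less (card J) l ?b" and ?y' = "binomial_less (card J) (l - 1) ?b"
  have ab: "0 \<le> ?a" "0 \<le> ?b" "0 \<le> 1 - ?a - ?b" "?a \<le> 1" "?b \<le> 1"
    using prob_disjoint_le[OF A B disj] by auto
  have x: "0 \<le> ?x'" "?x' \<le> ?x" and y: "0 \<le> ?y'" "?y' \<le> ?y"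
    using binomial_less_bounds[OF ab(1,4), of "card J" k] binomial_less_bounds[OF ab(1,4), of "card J" "k - 1"]
      binomial_less_bounds[OF ab(2,5), of "card J" l] binomial_less_bounds[OF ab(2,5), of "card J" "l - 1"] by auto
  have "?q (insert i J) k l = ennreal ?a * ?q J (k - 1) l + ennreal ?b * ?q J k (l - 1) + ennreal (1 - ?a - ?b) * ?q J k l"
    using A B disj insert by (intro nn_integral_hits_insert) auto
  also have "\<dots> \<le> ennreal ?a * ennreal (?x' * ?y) + ennreal ?b * ennreal (?x * ?y') + ennreal (1 - ?a - ?b) * ennreal (?x * ?y)"
    by (intro add_mono mult_left_mono insert.IH) auto
  also have "\<dots> = ennreal (?a * (?x' * ?y) + ?b * (?x * ?y') + (1 - ?a - ?b) * (?x * ?y))"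
    using ab x y by (simp add: ennreal_mult[symmetric] ennreal_plus[symmetric] del: ennreal_plus)
  also have "\<dots> \<le> ennreal ((?a * ?x' + (1 - ?a) * ?x) * (?b * ?y' + (1 - ?b) * ?y))"
  proof (rule ennreal_leI)
    \<comment> \<open>This product is exactly the difference of the two sides: one point cannot lie
      in both sets, whereas independent counts would allow it.\<close>
    have "0 \<le> ?a * ?b * ((?x - ?x') * (?y - ?y'))"
      using ab x y by simp
    then show "?a * (?x' * ?y) + ?b * (?x * ?y') + (1 - ?a - ?b) * (?x * ?y) \<le> (?a * ?x' + (1 - ?a) * ?x) * (?b * ?y' + (1 - ?b) * ?y)"
      by (simp add: algebra_simps)
  qed
  finally show ?case using insert(1,2) by simp
qed

end

section \<open>The logarithmic mean of the limit law\<close>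

text \<open>The substitution \<open>x = exp s\<close>. The endpoint 0 is dropped because it is not
  in the range of \<open>exp\<close>, and nonnegativity turns the gauge integral into a Lebesgue
  integral.\<close>

lemma has_bochner_integral_exp_substitution:
  fixes f :: "real \<Rightarrow> real"
  assumes f: "(f has_integral b) {0..}" "\<And>x. 0 < x \<Longrightarrow> 0 \<le> f x"
    and meas: "(\<lambda>s. exp s * f (exp s)) \<in> borel_measurable borel"
  shows "has_bochner_integral lborel (\<lambda>s. exp s * f (exp s)) b"
proof -
  have "(f has_integral b) {0<..}"
    by (subst has_integral_spike_set_eq[where T = "{0..}"])
       (use f(1) in \<open>auto intro: negligible_subset[of "{0}"]\<close>)
  then have "f absolutely_integrable_on {0<..}" "integral {0<..} f = b"
    using f(2) by (auto intro!: nonnegative_absolutely_integrable_1 simp: has_integral_integrable integral_unique)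
  moreover have "range exp = {0 :: real<..}"
    by (auto simp: image_iff) (metis exp_ln)
  ultimately have "(\<lambda>s. \<bar>exp s\<bar> * f (exp s)) absolutely_integrable_on UNIV \<and> integral UNIV (\<lambda>s. \<bar>exp s\<bar> * f (exp s)) = b"
    using has_absolute_integral_change_of_variables_1'[of UNIV exp exp f b]
    by (auto intro!: derivative_eq_intros injI)
  then have "((\<lambda>s. exp s * f (exp s)) has_integral b) UNIV"
    by (auto simp: has_integral_integral[symmetric] set_lebesgue_integral_eq_integral)
  then have "(\<integral>\<^sup>+s. ennreal (exp s * f (exp s)) \<partial>lborel) = ennreal b" and "0 \<le> b"
    using f(2) meas by (auto intro!: nn_integral_has_integral_lborel intro: has_integral_nonneg)
  then show ?thesis
    using f(2) meas by (intro has_bochner_integral_nn_integral) auto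
qed

text \<open>\<open>exp (- exp s)\<close> is the probability that the logarithm of a standard
  exponential variable exceeds \<open>s\<close>; in the variable \<open>exp s\<close> its
  exponential moment is Euler's integral for \<open>Gamma\<close>.\<close>

lemma gumbel_moment:
  fixes h :: real
  assumes h: "0 < h"
  shows "has_bochner_integral lborel (\<lambda>s. exp (h * s) * exp (- exp s)) (Gamma h)"
proof -
  have "exp s * (exp s powr (h - 1) / exp (exp s)) = exp (h * s) * exp (- exp s)" for s :: real
    by (simp add: powr_def exp_minus field_simps exp_add[symmetric])
  then show ?thesis
    using has_bochner_integral_exp_substitution[OF Gamma_integral_real[OF h]] by simp
qed

lemma exp_moment_nonpos:
  fixes h :: real
  assumes h: "0 < h"
  shows "has_bochner_integral lborel (\<lambda>s. exp (h * s) * of_bool (s \<le> 0)) (1 / h)"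
proof -
  let ?f = "\<lambda>t :: real. if t \<in> {0..1} then t powr (h - 1) else 0"
  have "((\<lambda>t. t powr (h - 1)) has_integral (1 powr (h - 1 + 1) / (h - 1 + 1))) {0..1}"
    using h by (intro has_integral_powr_from_0) auto
  then have "(?f has_integral 1 / h) {0..}"
    by (subst has_integral_restrict) auto
  moreover have "exp s * ?f (exp s) = exp (h * s) * of_bool (s \<le> 0)" for s
    by (simp add: powr_def exp_add[symmetric] algebra_simps)
  ultimately show ?thesis
    using has_bochner_integral_exp_substitution[of ?f "1 / h"] by simp
qed

text \<open>Neither term is integrable alone, as both tend to 1 at minus infinity. The factor
  \<open>exp (h * s)\<close> separates them, and the difference of the moments,
  \<open>Gamma h - 1 / h\<close>, is the difference quotient of \<open>Gamma\<close> at 1 with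
  increment \<open>h\<close>. Letting \<open>h\<close> tend to 0 gives the derivative.\<close>

lemma gumbel_integral:
  "has_bochner_integral lborel (\<lambda>s :: real. exp (- exp s) - of_bool (s \<le> 0) :: real) (- euler_mascheroni)"
proof -
  define D where "D s = exp (- exp s) - of_bool (s \<le> 0)" for s :: real
  \<comment> \<open>A majorant for all \<open>h\<close> in \<open>{0..1}\<close> at once: for
    \<open>s \<le> 0\<close> because \<open>1 - exp (- x) \<le> x\<close>, for \<open>s > 0\<close>
    because \<open>h * s \<le> s\<close>.\<close>
  define w where "w s = exp (1 * s) * exp (- exp s) + exp (1 * s) * of_bool (s \<le> 0)" for s :: real
  have [measurable]: "D \<in> borel_measurable borel" unfolding D_def by measurable
  have w: "integrable lborel w"
    unfolding w_def using gumbel_moment[of 1] exp_moment_nonpos[of 1]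
    by (intro Bochner_Integration.integrable_add) (auto simp: has_bochner_integral_iff)
  have bound: "norm (exp (h * s) * D s) \<le> w s" if h: "0 \<le> h" "h \<le> 1" for h s
  proof (cases "s \<le> 0")
    case True
    have "exp (- exp s) \<ge> 1 + (- exp s)" by (rule exp_ge_add_one_self)
    then have D: "\<bar>D s\<bar> \<le> exp s" using True by (simp add: D_def abs_if)
    have "h * s \<le> 0" using True h by (simp add: mult_nonneg_nonpos)
    then have "exp (h * s) * \<bar>D s\<bar> \<le> 1 * \<bar>D s\<bar>" by (intro mult_right_mono) auto
    also have "\<dots> \<le> exp s" using D by simp
    also have "\<dots> \<le> w s" using True by (simp add: w_def)
    finally show ?thesis by (simp add: abs_mult)
  next
    case False
    have "h * s \<le> 1 * s" using False h by (intro mult_right_mono) auto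
    then show ?thesis using False by (simp add: D_def w_def)
  qed
  have int: "integrable lborel D"
    by (rule Bochner_Integration.integrable_bound[OF w]) (use bound[of 0] in \<open>auto intro!: AE_I2 order_trans[OF _ abs_ge_self]\<close>)
  have moment: "(\<integral>s. exp (h * s) * D s \<partial>lborel) = (Gamma (1 + h) - Gamma 1) / h" if h: "0 < h" for h
  proof -
    have "has_bochner_integral lborel (\<lambda>s. exp (h * s) * exp (- exp s) - exp (h * s) * of_bool (s \<le> 0)) (Gamma h - 1 / h)"
      by (intro has_bochner_integral_diff gumbel_moment exp_moment_nonpos h)
    then have "(\<integral>s. exp (h * s) * D s \<partial>lborel) = Gamma h - 1 / h"
      by (simp add: has_bochner_integral_iff D_def right_diff_distrib)
    also have "\<dots> = (Gamma (1 + h) - Gamma 1) / h"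
    proof -
      have "h \<notin> \<int>\<^sub>\<le>\<^sub>0" using h by (auto elim!: nonpos_Ints_cases)
      from Gamma_plus1[OF this] show ?thesis using h by (simp add: field_simps)
    qed
    finally show ?thesis .
  qed
  let ?h = "\<lambda>n. inverse (real (Suc n))"
  have "(\<lambda>n. \<integral>s. exp (?h n * s) * D s \<partial>lborel) \<longlonglongrightarrow> (\<integral>s. D s \<partial>lborel)"
  proof (rule integral_dominated_convergence[OF _ _ w])
    show "AE s in lborel. (\<lambda>n. exp (?h n * s) * D s) \<longlonglongrightarrow> D s"
    proof (rule AE_I2)
      fix s
      have "(\<lambda>n. exp (?h n * s) * D s) \<longlonglongrightarrow> exp (0 * s) * D s"
        by (intro tendsto_intros LIMSEQ_inverse_real_of_nat)
      then show "(\<lambda>n. exp (?h n * s) * D s) \<longlonglongrightarrow> D s" by simp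
    qed
    show "AE s in lborel. norm (exp (?h n * s) * D s) \<le> w s" for n
      by (intro AE_I2 bound) (auto simp: field_simps)
  qed simp_all
  moreover have "(\<lambda>n. \<integral>s. exp (?h n * s) * D s \<partial>lborel) \<longlonglongrightarrow> - euler_mascheroni"
  proof -
    have "(Gamma has_field_derivative Gamma 1 * Digamma 1) (at (1 :: real))"
      by (rule has_field_derivative_Gamma) auto
    then have "((\<lambda>h. (Gamma (1 + h) - Gamma 1) / h) \<longlongrightarrow> (- euler_mascheroni :: real)) (at 0)"
      unfolding DERIV_def by simp
    moreover have "filterlim ?h (at 0) sequentially"
      using LIMSEQ_inverse_real_of_nat by (simp add: filterlim_at)
    ultimately have "(\<lambda>n. (Gamma (1 + ?h n) - Gamma 1) / ?h n) \<longlonglongrightarrow> - euler_mascheroni"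
      by (rule filterlim_compose)
    then show ?thesis by (subst moment) auto
  qed
  ultimately have "(\<integral>s. D s \<partial>lborel) = - euler_mascheroni"
    by (rule LIMSEQ_unique)
  with int have "has_bochner_integral lborel D (- euler_mascheroni)"
    by (simp add: has_bochner_integral_iff)
  then show ?thesis unfolding D_def .
qed

lemma borel_measurable_poisson_less [measurable]: "poisson_less k \<in> borel_measurable borel"
  unfolding poisson_less_def by measurable

text \<open>Raising \<open>k\<close> by 1 adds one Poisson weight, whose integral over
  \<open>s\<close> is \<open>Gamma k / fact k = 1 / k\<close>. These are the harmonic terms of
  \<open>knn_psi\<close>, and the Gumbel integral is the base case.\<close>

lemma poisson_less_integral:
  "0 < k \<Longrightarrow> has_bochner_integral lborel (\<lambda>s. poisson_less k (exp s) - of_bool (s \<le> 0)) (knn_psi k)"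
proof (induction k rule: nat_induct_non_zero)
  case 1
  show ?case using gumbel_integral by (simp add: poisson_less_def knn_psi_def)
next
  case (Suc k)
  have "has_bochner_integral lborel (\<lambda>s. exp s ^ k * exp (- exp s) / fact k) (Gamma (real k) / fact k)"
    unfolding exp_of_nat_mult[symmetric] using Suc(1) by (intro has_bochner_integral_divide_zero gumbel_moment) auto
  then have "has_bochner_integral lborel (\<lambda>s. (poisson_less k (exp s) - of_bool (s \<le> 0)) + exp s ^ k * exp (- exp s) / fact k)
      (knn_psi k + Gamma (real k) / fact k)"
    by (intro has_bochner_integral_add Suc.IH)
  moreover have "Gamma (real k) / fact k = 1 / real k"
    using Suc(1) Gamma_fact[of "k - 1", where 'a = real] by (simp add: fact_reduce[of k] of_nat_diff)
  moreover have "knn_psi k + 1 / real k = knn_psi (Suc k)"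
    using Suc(1) by (simp add: knn_psi_def)
  ultimately show ?case
    by (simp add: poisson_less_def algebra_simps)
qed

lemma step_integral:
  fixes a :: real
  shows "has_bochner_integral lborel (\<lambda>s. of_bool (s < a) - of_bool (s \<le> 0)) a"
    and "(\<integral>s. \<bar>of_bool (s < a) - of_bool (s \<le> 0)\<bar> \<partial>lborel) = \<bar>a\<bar>"
proof -
  have ind: "has_bochner_integral lborel (indicator A :: real \<Rightarrow> real) (measure lborel A)"
    if "A \<in> sets borel" "emeasure lborel A < \<infinity>" for A
    using that by (intro has_bochner_integral_real_indicator) auto
  have "has_bochner_integral lborel (\<lambda>s. of_bool (s < a) - of_bool (s \<le> 0)) a \<and> (\<integral>s. \<bar>of_bool (s < a) - of_bool (s \<le> 0)\<bar> \<partial>lborel) = \<bar>a\<bar>"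
  proof (cases "0 < a")
    case True
    have eq: "of_bool (s < a) - of_bool (s \<le> 0) = (indicator {0<..<a} s :: real)" for s
      using True by (auto simp: indicator_def)
    show ?thesis using ind[of "{0<..<a}"] True unfolding eq by (simp add: has_bochner_integral_iff)
  next
    case False
    have eq: "of_bool (s < a) - of_bool (s \<le> 0) = - (indicator {a..0} s :: real)" for s
      using False by (auto simp: indicator_def)
    show ?thesis using ind[of "{a..0}"] False unfolding eq
      by (auto simp: has_bochner_integral_iff)
  qed
  then show "has_bochner_integral lborel (\<lambda>s. of_bool (s < a) - of_bool (s \<le> 0)) a"
    "(\<integral>s. \<bar>of_bool (s < a) - of_bool (s \<le> 0)\<bar> \<partial>lborel) = \<bar>a\<bar>" by auto
qed

text \<open>Scaling by \<open>l\<close> translates \<open>s\<close> by \<open>ln l\<close>, and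
  moving the step back to 0 accounts for the term in \<open>ln l\<close>. The second part is the
  bound that admits Fubini's theorem when \<open>l\<close> is the density at a random point.\<close>

lemma poisson_less_scaled_integral:
  assumes k: "0 < k" and l: "0 < l"
  shows "has_bochner_integral lborel (\<lambda>s. poisson_less k (exp s * l) - of_bool (s \<le> 0)) (knn_psi k - ln l)"
    and "(\<integral>s. \<bar>poisson_less k (exp s * l) - of_bool (s \<le> 0)\<bar> \<partial>lborel) \<le>
      (\<integral>s. \<bar>poisson_less k (exp s) - of_bool (s \<le> 0)\<bar> \<partial>lborel) + \<bar>ln l\<bar>"
proof -
  let ?p = "\<lambda>s. poisson_less k (exp s) - of_bool (s \<le> 0)"
  let ?st = "\<lambda>s. of_bool (s < - ln l) - of_bool (s \<le> 0)"
  have p: "has_bochner_integral lborel ?p (knn_psi k)" by (rule poisson_less_integral[OF k])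
  have shift: "has_bochner_integral lborel (\<lambda>s. ?p (ln l + 1 * s)) (knn_psi k /\<^sub>R \<bar>1\<bar>)"
    by (rule iffD1[OF lborel_has_bochner_integral_real_affine_iff[OF one_neq_zero] p])
  \<comment> \<open>The translated step uses \<open>\<le>\<close> and \<open>?st\<close> uses
    \<open><\<close>, so the identity fails at this one point.\<close>
  have ab: "AE s in lborel. s \<noteq> - ln l" by (rule AE_lborel_singleton)
  have eq: "AE s in lborel. poisson_less k (exp s * l) - of_bool (s \<le> 0) = ?p (ln l + 1 * s) + ?st s"
    using ab by eventually_elim (use l in \<open>auto simp: exp_add mult.commute\<close>)
  have sum: "has_bochner_integral lborel (\<lambda>s. ?p (ln l + 1 * s) + ?st s) (knn_psi k /\<^sub>R \<bar>1\<bar> + - ln l)"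
    by (rule has_bochner_integral_add[OF shift step_integral(1)])
  then show res: "has_bochner_integral lborel (\<lambda>s. poisson_less k (exp s * l) - of_bool (s \<le> 0)) (knn_psi k - ln l)"
    using eq by (subst has_bochner_integral_cong_AE[OF _ _ eq]) auto
  have "(\<integral>s. \<bar>poisson_less k (exp s * l) - of_bool (s \<le> 0)\<bar> \<partial>lborel) \<le> (\<integral>s. \<bar>?p (ln l + 1 * s)\<bar> + \<bar>?st s\<bar> \<partial>lborel)"
  proof (rule integral_mono_AE)
    show "AE s in lborel. \<bar>poisson_less k (exp s * l) - of_bool (s \<le> 0)\<bar> \<le> \<bar>?p (ln l + 1 * s)\<bar> + \<bar>?st s\<bar>"
      using eq by eventually_elim linarith
  qed (use res shift step_integral(1)[of "- ln l"] in \<open>auto simp: has_bochner_integral_iff intro!: Bochner_Integration.integrable_add integrable_abs\<close>)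
  also have "\<dots> = (\<integral>s. \<bar>?p (ln l + 1 * s)\<bar> \<partial>lborel) + (\<integral>s. \<bar>?st s\<bar> \<partial>lborel)"
    using shift step_integral(1)[of "- ln l"] by (intro Bochner_Integration.integral_add integrable_abs) (auto simp: has_bochner_integral_iff)
  also have "(\<integral>s. \<bar>?p (ln l + 1 * s)\<bar> \<partial>lborel) = (\<integral>s. \<bar>?p s\<bar> \<partial>lborel)"
    using lborel_integral_real_affine[of 1 "\<lambda>s. \<bar>?p s\<bar>" "ln l"] by simp
  finally show "(\<integral>s. \<bar>poisson_less k (exp s * l) - of_bool (s \<le> 0)\<bar> \<partial>lborel) \<le>
      (\<integral>s. \<bar>?p s\<bar> \<partial>lborel) + \<bar>ln l\<bar>"
    unfolding step_integral(2) by simp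
qed

section \<open>Independent samples\<close>

locale iid_sample = prob_space P for P :: "'w measure" +
  fixes X :: "nat \<Rightarrow> 'w \<Rightarrow> 'a::euclidean_space" and \<mu> :: "'a measure" and k :: nat
  assumes X_measurable [measurable]: "X n \<in> borel_measurable P"
    and X_distr: "distr P borel (X n) = \<mu>"
    and X_indep: "indep_vars (\<lambda>_. borel) X UNIV"
begin

lemma sets_mu [measurable_cong]: "sets \<mu> = sets borel"
  using X_distr[of 0] by auto

lemma space_mu [simp]: "space \<mu> = UNIV"
  using X_distr[of 0] by auto

sublocale mu: prob_space \<mu>
  using prob_space_distr[OF X_measurable[of 0]] X_distr[of 0] by simp

lemma nn_integral_sample:
  assumes J: "finite J" "J \<noteq> {}" and F: "F \<in> borel_measurable (Pi\<^sub>M J (\<lambda>_. borel))"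
  shows "(\<integral>\<^sup>+\<omega>. F (\<lambda>i\<in>J. X i \<omega>) \<partial>P) = (\<integral>\<^sup>+x. F x \<partial>Pi\<^sub>M J (\<lambda>_. \<mu>))"
proof -
  have "indep_vars (\<lambda>_. borel) X J"
    using X_indep by (rule indep_vars_subset) simp
  then have "distr P (Pi\<^sub>M J (\<lambda>_. borel)) (\<lambda>\<omega>. \<lambda>i\<in>J. X i \<omega>) = Pi\<^sub>M J (\<lambda>_. \<mu>)"
    using J by (subst (asm) indep_vars_iff_distr_eq_PiM) (auto simp: X_distr)
  then have "(\<integral>\<^sup>+x. F x \<partial>Pi\<^sub>M J (\<lambda>_. \<mu>)) = (\<integral>\<^sup>+x. F x \<partial>distr P (Pi\<^sub>M J (\<lambda>_. borel)) (\<lambda>\<omega>. \<lambda>i\<in>J. X i \<omega>))"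
    by simp
  also have "\<dots> = (\<integral>\<^sup>+\<omega>. F (\<lambda>i\<in>J. X i \<omega>) \<partial>P)"
    by (rule nn_integral_distr) (measurable, use F in simp)
  finally show ?thesis by simp
qed

text \<open>If the sample points are distinct and at least \<open>k\<close> others exist, this says
  that the \<open>k\<close>th nearest neighbour is farther than \<open>r\<close>. Counting indices
  and not values keeps it a count of independent hits even when points coincide.\<close>

definition few :: "nat \<Rightarrow> real \<Rightarrow> nat \<Rightarrow> 'w \<Rightarrow> bool" where
  "few N r i \<omega> \<longleftrightarrow> card {j \<in> {1..N} - {i}. dist (X i \<omega>) (X j \<omega>) \<le> r} < k"

definition ball_mass :: "real \<Rightarrow> 'a \<Rightarrow> real" where
  "ball_mass r y = measure \<mu> (cball y r)"

lemma ball_mass_bounds: "0 \<le> ball_mass r y" "ball_mass r y \<le> 1"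
  by (simp_all add: ball_mass_def)

lemma measurable_card_within:
  fixes I J :: "nat set"
  assumes "i \<in> J" "I \<subseteq> J"
  shows "(\<lambda>x. card {j \<in> I. dist (x i) (x j) \<le> r}) \<in> measurable (Pi\<^sub>M J (\<lambda>_. borel :: 'a measure)) (count_space UNIV)"
proof (rule measurable_card)
  fix j
  have "{x \<in> space (Pi\<^sub>M J (\<lambda>_. borel :: 'a measure)). j \<in> I \<and> dist (x i) (x j) \<le> r} \<in> sets (Pi\<^sub>M J (\<lambda>_. borel))"
  proof (cases "j \<in> I")
    case True
    then have "j \<in> J" using assms by auto
    then have [measurable]: "(\<lambda>x. x i) \<in> measurable (Pi\<^sub>M J (\<lambda>_. borel :: 'a measure)) borel" "(\<lambda>x. x j) \<in> measurable (Pi\<^sub>M J (\<lambda>_. borel :: 'a measure)) borel"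
      using assms by (auto intro: measurable_component_singleton)
    show ?thesis using True by measurable
  qed simp
  then show "{x \<in> space (Pi\<^sub>M J (\<lambda>_. borel :: 'a measure)). j \<in> {j \<in> I. dist (x i) (x j) \<le> r}} \<in> sets (Pi\<^sub>M J (\<lambda>_. borel))" by simp
qed

lemma few_measurable [measurable]: "Measurable.pred P (few N r i)"
proof -
  let ?J = "insert i {1..N}"
  have "(\<lambda>\<omega>. \<lambda>l\<in>?J. X l \<omega>) \<in> measurable P (Pi\<^sub>M ?J (\<lambda>_. borel))" by measurable
  from measurable_compose[OF this measurable_card_within[of i ?J "{1..N} - {i}" r]]
  have [measurable]: "(\<lambda>\<omega>. card {j \<in> {1..N} - {i}. dist ((\<lambda>l\<in>?J. X l \<omega>) i) ((\<lambda>l\<in>?J. X l \<omega>) j) \<le> r}) \<in> measurable P (count_space UNIV)"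
    by auto
  have "few N r i = (\<lambda>\<omega>. card {j \<in> {1..N} - {i}. dist ((\<lambda>l\<in>?J. X l \<omega>) i) ((\<lambda>l\<in>?J. X l \<omega>) j) \<le> r} < k)"
    unfolding few_def by (intro ext arg_cong2[where f = "(<)"] arg_cong[where f = card]) auto
  then show ?thesis by simp
qed

lemma ball_mass_measurable [measurable]: "ball_mass r \<in> borel_measurable borel"
proof -
  have "(\<lambda>y. \<integral>\<^sup>+x. of_bool (dist y x \<le> r) \<partial>\<mu>) \<in> borel_measurable borel"
    by measurable
  moreover have "ball_mass r = (\<lambda>y. enn2real (\<integral>\<^sup>+x. of_bool (dist y x \<le> r) \<partial>\<mu>))"
  proof
    fix y
    have "(\<integral>\<^sup>+x. of_bool (dist y x \<le> r) \<partial>\<mu>) = (\<integral>\<^sup>+x. indicator (cball y r) x \<partial>\<mu>)"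
      by (intro nn_integral_cong) (auto simp: indicator_def)
    then show "ball_mass r y = enn2real (\<integral>\<^sup>+x. of_bool (dist y x \<le> r) \<partial>\<mu>)"
      by (simp add: ball_mass_def measure_def sets_mu)
  qed
  ultimately show ?thesis by simp
qed

lemma binomial_less_measurable [measurable]: "binomial_less n k \<in> borel_measurable borel"
  unfolding binomial_less_eq_sum[abs_def] by measurable

definition few_prob :: "nat \<Rightarrow> real \<Rightarrow> real" where
  "few_prob n r = (\<integral>y. binomial_less n k (ball_mass r y) \<partial>\<mu>)"

lemma binomial_ball_mass_bounds: "0 \<le> binomial_less n k (ball_mass r y)" "binomial_less n k (ball_mass r y) \<le> 1"
  using binomial_less_bounds[OF ball_mass_bounds] by auto

lemma integrable_binomial_ball_mass: "integrable \<mu> (\<lambda>y. binomial_less n k (ball_mass r y))"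
  using binomial_ball_mass_bounds by (intro mu.integrable_const_bound[of _ 1]) (auto simp: measurable_cong_sets[OF sets_mu refl])

lemma integrable_ball_mass: "integrable \<mu> (ball_mass r)"
  using ball_mass_bounds by (intro mu.integrable_const_bound[of _ 1]) (auto simp: measurable_cong_sets[OF sets_mu refl])

text \<open>Given \<open>X i = y\<close>, the other \<open>n\<close> points hit the ball about
  \<open>y\<close> independently.\<close>

lemma prob_few:
  assumes i: "i \<in> {1..Suc n}"
  shows "prob {\<omega> \<in> space P. few (Suc n) r i \<omega>} = few_prob n r"
proof -
  interpret product_sigma_finite "\<lambda>_ :: nat. \<mu>" ..
  let ?J = "{1..Suc n} - {i}"
  have J: "insert i ?J = {1..Suc n}" "finite ?J" "i \<notin> ?J" "card ?J = n" using i by auto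
  let ?F = "\<lambda>x :: nat \<Rightarrow> 'a. of_bool (card {j \<in> ?J. dist (x i) (x j) \<le> r} < k) :: ennreal"
  have [measurable]: "(\<lambda>x. card {j \<in> ?J. dist (x i) (x j) \<le> r}) \<in> measurable (Pi\<^sub>M (insert i ?J) (\<lambda>_. borel :: 'a measure)) (count_space UNIV)"
    by (rule measurable_card_within) auto
  have F: "?F \<in> borel_measurable (Pi\<^sub>M (insert i ?J) (\<lambda>_. borel))" by measurable
  have F': "?F \<in> borel_measurable (Pi\<^sub>M (insert i ?J) (\<lambda>_. \<mu>))"
    using F by (simp add: measurable_cong_sets[OF sets_PiM_cong[OF refl sets_mu] refl])
  have "ennreal (prob {\<omega> \<in> space P. few (Suc n) r i \<omega>}) = (\<integral>\<^sup>+\<omega>. indicator {\<omega> \<in> space P. few (Suc n) r i \<omega>} \<omega> \<partial>P)"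
    by (simp add: emeasure_eq_measure)
  also have "\<dots> = (\<integral>\<^sup>+\<omega>. ?F (\<lambda>l\<in>insert i ?J. X l \<omega>) \<partial>P)"
  proof (rule nn_integral_cong)
    fix \<omega> assume "\<omega> \<in> space P"
    moreover have "{j \<in> ?J. dist ((\<lambda>l\<in>insert i ?J. X l \<omega>) i) ((\<lambda>l\<in>insert i ?J. X l \<omega>) j) \<le> r} = {j \<in> ?J. dist (X i \<omega>) (X j \<omega>) \<le> r}"
      by auto
    ultimately show "indicator {\<omega> \<in> space P. few (Suc n) r i \<omega>} \<omega> = ?F (\<lambda>l\<in>insert i ?J. X l \<omega>)"
      by (simp add: few_def indicator_def)
  qed
  also have "\<dots> = (\<integral>\<^sup>+x. ?F x \<partial>Pi\<^sub>M (insert i ?J) (\<lambda>_. \<mu>))"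
    by (rule nn_integral_sample) (use F in auto)
  also have "\<dots> = (\<integral>\<^sup>+y. (\<integral>\<^sup>+x. ?F (x(i := y)) \<partial>Pi\<^sub>M ?J (\<lambda>_. \<mu>)) \<partial>\<mu>)"
    by (rule product_nn_integral_insert_rev[OF J(2,3) F'])
  also have "\<dots> = (\<integral>\<^sup>+y. ennreal (binomial_less n k (ball_mass r y)) \<partial>\<mu>)"
  proof (rule nn_integral_cong)
    fix y
    have "?F (x(i := y)) = of_bool (mu.hits ?J (cball y r) x < k)" for x
    proof -
      have "{j \<in> ?J. dist ((x(i := y)) i) ((x(i := y)) j) \<le> r} = {j \<in> ?J. x j \<in> cball y r}" by auto
      then show ?thesis by simp
    qed
    then have "(\<integral>\<^sup>+x. ?F (x(i := y)) \<partial>Pi\<^sub>M ?J (\<lambda>_. \<mu>)) = (\<integral>\<^sup>+x. of_bool (mu.hits ?J (cball y r) x < k) \<partial>Pi\<^sub>M ?J (\<lambda>_. \<mu>))"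
      by simp
    also have "\<dots> = ennreal (binomial_less (card ?J) k (mu.prob (cball y r)))"
      by (rule mu.nn_integral_hits) (auto simp: sets_mu)
    finally show "(\<integral>\<^sup>+x. ?F (x(i := y)) \<partial>Pi\<^sub>M ?J (\<lambda>_. \<mu>)) = ennreal (binomial_less n k (ball_mass r y))"
      unfolding J(4) ball_mass_def .
  qed
  also have "\<dots> = ennreal (few_prob n r)"
    unfolding few_prob_def using binomial_ball_mass_bounds
    by (intro nn_integral_eq_integral integrable_binomial_ball_mass) auto
  finally show ?thesis
    using binomial_ball_mass_bounds by (simp add: few_prob_def ennreal_inj integral_nonneg_AE)
qed

lemma few_prob_bounds: "0 \<le> few_prob n r" "few_prob n r \<le> 1"
proof -
  show "0 \<le> few_prob n r"
    unfolding few_prob_def using binomial_ball_mass_bounds by (intro integral_nonneg_AE) auto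
  have "few_prob n r \<le> (\<integral>y. 1 \<partial>\<mu>)"
    unfolding few_prob_def using binomial_ball_mass_bounds integrable_binomial_ball_mass by (intro integral_mono) auto
  then show "few_prob n r \<le> 1" by (simp add: mu.prob_space[simplified])
qed

text \<open>Given \<open>X i = y\<close> and \<open>X j = z\<close>, the balls are disjoint unless
  \<open>dist y z \<le> 2 * r\<close>. Counts in disjoint balls are negatively dependent; close
  pairs get the trivial bound 1, which costs the mass of the ball of radius
  \<open>2 * r\<close>.\<close>

lemma prob_few_two:
  assumes ij: "i \<in> {1..Suc (Suc n)}" "j \<in> {1..Suc (Suc n)}" "i \<noteq> j"
  shows "prob {\<omega> \<in> space P. few (Suc (Suc n)) r i \<omega> \<and> few (Suc (Suc n)) r j \<omega>} \<le>
     (few_prob n r)\<^sup>2 + (\<integral>y. ball_mass (2 * r) y \<partial>\<mu>)"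
proof -
  interpret product_sigma_finite "\<lambda>_ :: nat. \<mu>" ..
  let ?N = "Suc (Suc n)"
  let ?J = "{1..?N} - {i, j}"
  have J: "insert i (insert j ?J) = {1..?N}" "finite ?J" "j \<notin> ?J" "i \<notin> insert j ?J" "card ?J = n"
    using ij by auto
  let ?c = "\<lambda>l x. card {a \<in> ?J. dist (x l) (x a :: 'a) \<le> r}"
  let ?F = "\<lambda>x :: nat \<Rightarrow> 'a. of_bool (?c i x < k \<and> ?c j x < k) :: ennreal"
  have [measurable]: "?c i \<in> measurable (Pi\<^sub>M (insert i (insert j ?J)) (\<lambda>_. borel :: 'a measure)) (count_space UNIV)"
     "?c j \<in> measurable (Pi\<^sub>M (insert i (insert j ?J)) (\<lambda>_. borel :: 'a measure)) (count_space UNIV)"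
    by (rule measurable_card_within; auto)+
  have F: "?F \<in> borel_measurable (Pi\<^sub>M (insert i (insert j ?J)) (\<lambda>_. borel))" by measurable
  have F': "?F \<in> borel_measurable (Pi\<^sub>M (insert i (insert j ?J)) (\<lambda>_. \<mu>))"
    using F by (simp add: measurable_cong_sets[OF sets_PiM_cong[OF refl sets_mu] refl])
  have "ennreal (prob {\<omega> \<in> space P. few ?N r i \<omega> \<and> few ?N r j \<omega>}) = (\<integral>\<^sup>+\<omega>. indicator {\<omega> \<in> space P. few ?N r i \<omega> \<and> few ?N r j \<omega>} \<omega> \<partial>P)"
    by (simp add: emeasure_eq_measure)
  \<comment> \<open>Each of the two points is dropped from the count of the other. This can only
    lower the counts, so the event grows, and both counts now run over the same \<open>n\<close>
    further points.\<close>
  also have "\<dots> \<le> (\<integral>\<^sup>+\<omega>. ?F (\<lambda>l\<in>insert i (insert j ?J). X l \<omega>) \<partial>P)"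
  proof (rule nn_integral_mono)
    fix \<omega> assume "\<omega> \<in> space P"
    have sub: "?c l (\<lambda>l\<in>insert i (insert j ?J). X l \<omega>) \<le> card {a \<in> {1..?N} - {l}. dist (X l \<omega>) (X a \<omega>) \<le> r}"
      if "l = i \<or> l = j" for l
      using that by (intro card_mono) auto
    show "indicator {\<omega> \<in> space P. few ?N r i \<omega> \<and> few ?N r j \<omega>} \<omega> \<le> ?F (\<lambda>l\<in>insert i (insert j ?J). X l \<omega>)"
      using sub[of i] sub[of j] by (auto simp: few_def indicator_def simp del: restrict_apply)
  qed
  also have "\<dots> = (\<integral>\<^sup>+x. ?F x \<partial>Pi\<^sub>M (insert i (insert j ?J)) (\<lambda>_. \<mu>))"
    by (rule nn_integral_sample) (use F in auto)
  also have "\<dots> = (\<integral>\<^sup>+y. (\<integral>\<^sup>+x. ?F (x(i := y)) \<partial>Pi\<^sub>M (insert j ?J) (\<lambda>_. \<mu>)) \<partial>\<mu>)"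
    by (rule product_nn_integral_insert_rev[OF _ J(4) F']) simp
  also have "\<dots> = (\<integral>\<^sup>+y. (\<integral>\<^sup>+z. (\<integral>\<^sup>+x. ?F (x(j := z, i := y)) \<partial>Pi\<^sub>M ?J (\<lambda>_. \<mu>)) \<partial>\<mu>) \<partial>\<mu>)"
  proof (rule nn_integral_cong)
    fix y
    have "(\<lambda>x. x(i := y)) \<in> measurable (Pi\<^sub>M (insert j ?J) (\<lambda>_. \<mu>)) (Pi\<^sub>M (insert i (insert j ?J)) (\<lambda>_. \<mu>))"
      by (rule measurable_fun_upd) auto
    from measurable_compose[OF this F']
    have "(\<lambda>x. ?F (x(i := y))) \<in> borel_measurable (Pi\<^sub>M (insert j ?J) (\<lambda>_. \<mu>))" .
    from product_nn_integral_insert_rev[OF J(2,3) this]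
    show "(\<integral>\<^sup>+x. ?F (x(i := y)) \<partial>Pi\<^sub>M (insert j ?J) (\<lambda>_. \<mu>)) = (\<integral>\<^sup>+z. (\<integral>\<^sup>+x. ?F (x(j := z, i := y)) \<partial>Pi\<^sub>M ?J (\<lambda>_. \<mu>)) \<partial>\<mu>)" .
  qed
  also have "\<dots> \<le> (\<integral>\<^sup>+y. (\<integral>\<^sup>+z. ennreal (binomial_less n k (ball_mass r y)) * ennreal (binomial_less n k (ball_mass r z)) + indicator (cball y (2 * r)) z \<partial>\<mu>) \<partial>\<mu>)"
  proof (intro nn_integral_mono)
    fix y z
    have eq: "?F (x(j := z, i := y)) = of_bool (mu.hits ?J (cball y r) x < k \<and> mu.hits ?J (cball z r) x < k)" for x
    proof -
      have "{a \<in> ?J. dist ((x(j := z, i := y)) i) ((x(j := z, i := y)) a) \<le> r} = {a \<in> ?J. x a \<in> cball y r}"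
        "{a \<in> ?J. dist ((x(j := z, i := y)) j) ((x(j := z, i := y)) a) \<le> r} = {a \<in> ?J. x a \<in> cball z r}"
        using ij(3) by auto
      then show ?thesis by simp
    qed
    show "(\<integral>\<^sup>+x. ?F (x(j := z, i := y)) \<partial>Pi\<^sub>M ?J (\<lambda>_. \<mu>)) \<le>
        ennreal (binomial_less n k (ball_mass r y)) * ennreal (binomial_less n k (ball_mass r z)) + indicator (cball y (2 * r)) z"
    proof (cases "dist y z \<le> 2 * r")
      case True
      interpret Pi: prob_space "Pi\<^sub>M ?J (\<lambda>_. \<mu>)" by (rule prob_space_PiM) (rule mu.prob_space_axioms)
      have "(\<integral>\<^sup>+x. ?F (x(j := z, i := y)) \<partial>Pi\<^sub>M ?J (\<lambda>_. \<mu>)) \<le> (\<integral>\<^sup>+x. 1 \<partial>Pi\<^sub>M ?J (\<lambda>_. \<mu>))"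
        by (intro nn_integral_mono) simp
      also have "\<dots> = 1" using Pi.emeasure_space_1 by simp
      finally show ?thesis using True by (simp add: indicator_def add_increasing)
    next
      case False
      have disj: "cball y r \<inter> cball z r = {}"
      proof -
        have "w \<notin> cball z r" if "w \<in> cball y r" for w
          using that False dist_triangle2[of y z w] by (auto simp: dist_commute)
        then show ?thesis by auto
      qed
      have "(\<integral>\<^sup>+x. ?F (x(j := z, i := y)) \<partial>Pi\<^sub>M ?J (\<lambda>_. \<mu>)) \<le>
          ennreal (binomial_less (card ?J) k (mu.prob (cball y r)) * binomial_less (card ?J) k (mu.prob (cball z r)))"
        unfolding eq by (rule mu.nn_integral_hits_disjoint_le[OF _ _ disj J(2)]) (auto simp: sets_mu)
      also have "\<dots> = ennreal (binomial_less n k (ball_mass r y)) * ennreal (binomial_less n k (ball_mass r z))"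
        unfolding J(5) ball_mass_def[symmetric] using binomial_ball_mass_bounds by (intro ennreal_mult) auto
      finally show ?thesis by (simp add: add_increasing2)
    qed
  qed
  also have "\<dots> = (\<integral>\<^sup>+y. ennreal (binomial_less n k (ball_mass r y)) * ennreal (few_prob n r) + ennreal (ball_mass (2 * r) y) \<partial>\<mu>)"
  proof (rule nn_integral_cong)
    fix y
    have "(\<integral>\<^sup>+z. ennreal (binomial_less n k (ball_mass r z)) \<partial>\<mu>) = ennreal (few_prob n r)"
      unfolding few_prob_def using binomial_ball_mass_bounds
      by (intro nn_integral_eq_integral integrable_binomial_ball_mass) auto
    note i1 = this
    have i2: "(\<integral>\<^sup>+z. indicator (cball y (2 * r)) z \<partial>\<mu>) = ennreal (ball_mass (2 * r) y)"
      by (subst nn_integral_indicator) (auto simp: sets_mu ball_mass_def mu.emeasure_eq_measure)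
    have m: "(\<lambda>z. ennreal (binomial_less n k (ball_mass r z))) \<in> borel_measurable \<mu>" by measurable
    have m1: "(\<lambda>z. ennreal (binomial_less n k (ball_mass r y)) * ennreal (binomial_less n k (ball_mass r z))) \<in> borel_measurable \<mu>"
      using m by measurable
    have m2: "indicator (cball y (2 * r)) \<in> borel_measurable \<mu>"
      by (rule borel_measurable_indicator) (simp add: sets_mu)
    show "(\<integral>\<^sup>+z. ennreal (binomial_less n k (ball_mass r y)) * ennreal (binomial_less n k (ball_mass r z)) + indicator (cball y (2 * r)) z \<partial>\<mu>) =
        ennreal (binomial_less n k (ball_mass r y)) * ennreal (few_prob n r) + ennreal (ball_mass (2 * r) y)"
      unfolding nn_integral_add[OF m1 m2] nn_integral_cmult[OF m] i1 i2 ..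
  qed
  also have "\<dots> = ennreal (few_prob n r) * ennreal (few_prob n r) + ennreal (\<integral>y. ball_mass (2 * r) y \<partial>\<mu>)"
  proof -
    have "(\<integral>\<^sup>+z. ennreal (binomial_less n k (ball_mass r z)) \<partial>\<mu>) = ennreal (few_prob n r)"
      unfolding few_prob_def using binomial_ball_mass_bounds
      by (intro nn_integral_eq_integral integrable_binomial_ball_mass) auto
    moreover have "(\<integral>\<^sup>+y. ennreal (ball_mass (2 * r) y) \<partial>\<mu>) = ennreal (\<integral>y. ball_mass (2 * r) y \<partial>\<mu>)"
      using ball_mass_bounds by (intro nn_integral_eq_integral integrable_ball_mass) auto
    ultimately show ?thesis
      by (subst nn_integral_add) (simp_all add: nn_integral_multc)
  qed
  also have "\<dots> = ennreal ((few_prob n r)\<^sup>2 + (\<integral>y. ball_mass (2 * r) y \<partial>\<mu>))"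
    using few_prob_bounds ball_mass_bounds
    by (simp add: ennreal_mult[symmetric] power2_eq_square integral_nonneg_AE)
  finally show ?thesis
    using ball_mass_bounds by (subst (asm) ennreal_le_iff) (auto intro!: add_nonneg_nonneg integral_nonneg_AE)
qed

text \<open>A single point sees \<open>n + 1\<close> others, while a pair leaves only
  \<open>n\<close>. At equal radius the second probability exceeds the first by at most the mean
  mass of a ball.\<close>

lemma few_prob_le_Suc: "few_prob n r \<le> few_prob (Suc n) r + (\<integral>y. ball_mass r y \<partial>\<mu>)"
proof -
  have "few_prob n r \<le> (\<integral>y. binomial_less (Suc n) k (ball_mass r y) + ball_mass r y \<partial>\<mu>)"
    unfolding few_prob_def using binomial_less_Suc_le[OF ball_mass_bounds]
    by (intro integral_mono Bochner_Integration.integrable_add integrable_binomial_ball_mass integrable_ball_mass) auto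
  also have "\<dots> = few_prob (Suc n) r + (\<integral>y. ball_mass r y \<partial>\<mu>)"
    unfolding few_prob_def by (intro Bochner_Integration.integral_add integrable_binomial_ball_mass integrable_ball_mass)
  finally show ?thesis .
qed

definition few_fraction :: "nat \<Rightarrow> real \<Rightarrow> 'w \<Rightarrow> real" where
  "few_fraction N r \<omega> = (\<Sum>i=1..N. of_bool (few N r i \<omega>)) / real N"

lemma few_fraction_measurable [measurable]: "few_fraction N r \<in> borel_measurable P"
  unfolding few_fraction_def by measurable

lemma few_fraction_bounds: "0 \<le> few_fraction N r \<omega>" "few_fraction N r \<omega> \<le> 1"
proof -
  have "(\<Sum>i=1..N. of_bool (few N r i \<omega>)) \<le> (\<Sum>i=1..N. 1 :: real)" by (intro sum_mono) auto
  then show "0 \<le> few_fraction N r \<omega>" "few_fraction N r \<omega> \<le> 1"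
    by (auto simp: few_fraction_def divide_le_eq_1 intro!: divide_nonneg_nonneg sum_nonneg)
qed

lemma integrable_few: "integrable P (\<lambda>\<omega>. of_bool (few N r i \<omega>) :: real)"
  by (rule integrable_const_bound[of _ 1]) auto

lemma integrable_few_fraction: "integrable P (few_fraction N r)"
  using few_fraction_bounds by (intro integrable_const_bound[of _ 1]) auto

lemma expectation_few_fraction: "expectation (few_fraction (Suc n) r) = few_prob n r"
proof -
  have "expectation (\<lambda>\<omega>. of_bool (few (Suc n) r i \<omega>)) = few_prob n r" if "i \<in> {1..Suc n}" for i
  proof -
    have "expectation (\<lambda>\<omega>. of_bool (few (Suc n) r i \<omega>)) = expectation (indicator {\<omega> \<in> space P. few (Suc n) r i \<omega>})"
      by (intro Bochner_Integration.integral_cong) (auto simp: indicator_def)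
    also have "\<dots> = prob {\<omega> \<in> space P. few (Suc n) r i \<omega>}" by simp
    also have "\<dots> = few_prob n r" by (rule prob_few[OF that])
    finally show ?thesis .
  qed
  then have "expectation (\<lambda>\<omega>. \<Sum>i=1..Suc n. of_bool (few (Suc n) r i \<omega>) :: real) = (\<Sum>i=1..Suc n. few_prob n r)"
    by (subst Bochner_Integration.integral_sum) (auto intro: integrable_few)
  then show ?thesis
    unfolding few_fraction_def by simp
qed

text \<open>The diagonal pairs contribute the term divided by the sample size; all others are
  covered by \<open>prob_few_two\<close>.\<close>

lemma expectation_few_fraction_square:
  "expectation (\<lambda>\<omega>. (few_fraction (Suc (Suc n)) r \<omega>)\<^sup>2) \<le>
     few_prob (Suc n) r / real (Suc (Suc n)) + (few_prob n r)\<^sup>2 + (\<integral>y. ball_mass (2 * r) y \<partial>\<mu>)"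
proof -
  let ?N = "Suc (Suc n)" and ?b = "(few_prob n r)\<^sup>2 + (\<integral>y. ball_mass (2 * r) y \<partial>\<mu>)" and ?a = "few_prob (Suc n) r"
  have b: "0 \<le> ?b" using ball_mass_bounds by (auto intro!: add_nonneg_nonneg integral_nonneg_AE)
  let ?E = "\<lambda>i j. {\<omega> \<in> space P. few ?N r i \<omega> \<and> few ?N r j \<omega>}"
  have int: "integrable P (indicator (?E i j) :: 'w \<Rightarrow> real)" for i j
    by (intro integrable_real_indicator) (auto simp: emeasure_eq_measure)
  have "expectation (\<lambda>\<omega>. (few_fraction ?N r \<omega>)\<^sup>2) = expectation (\<lambda>\<omega>. (\<Sum>i=1..?N. \<Sum>j=1..?N. indicator (?E i j) \<omega>) / (real ?N)\<^sup>2)"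
  proof (rule Bochner_Integration.integral_cong[OF refl])
    fix \<omega> assume "\<omega> \<in> space P"
    then have "indicator (?E i j) \<omega> = (of_bool (few ?N r i \<omega>) * of_bool (few ?N r j \<omega>) :: real)" for i j
      by (simp add: indicator_def)
    then show "(few_fraction ?N r \<omega>)\<^sup>2 = (\<Sum>i=1..?N. \<Sum>j=1..?N. indicator (?E i j) \<omega>) / (real ?N)\<^sup>2"
      by (simp only: few_fraction_def power2_eq_square times_divide_times_eq sum_product)
  qed
  also have "\<dots> = (\<Sum>i=1..?N. \<Sum>j=1..?N. prob (?E i j)) / (real ?N)\<^sup>2"
  proof -
    have "expectation (\<lambda>\<omega>. \<Sum>i\<in>A. \<Sum>j\<in>A. indicator (?E i j) \<omega>) = (\<Sum>i\<in>A. \<Sum>j\<in>A. prob (?E i j))" for A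
      using int by (simp add: Bochner_Integration.integral_sum Bochner_Integration.integrable_sum)
    then show ?thesis by (simp only: integral_divide_zero)
  qed
  also have "\<dots> \<le> (\<Sum>i=1..?N. \<Sum>j=1..?N. (if j = i then ?a else 0) + ?b) / (real ?N)\<^sup>2"
  proof (intro divide_right_mono sum_mono)
    fix i j assume ij: "i \<in> {1..?N}" "j \<in> {1..?N}"
    show "prob (?E i j) \<le> (if j = i then ?a else 0) + ?b"
      using prob_few[OF ij(1), of r] prob_few_two[OF ij, of r] b by (cases "j = i") auto
  qed simp
  also have "\<dots> = (real ?N * ?a + (real ?N)\<^sup>2 * ?b) / (real ?N)\<^sup>2"
    by (simp add: sum.distrib power2_eq_square algebra_simps del: sum.cl_ivl_Suc)
  also have "\<dots> = ?a / real ?N + ?b"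
  proof -
    have "(x * a + x\<^sup>2 * b) / x\<^sup>2 = a / x + b" if "x \<noteq> 0" for x a b :: real
      using that by (simp add: field_simps power2_eq_square)
    then show ?thesis by simp
  qed
  finally show ?thesis by simp
qed

end

text \<open>What the probabilistic part uses of the manifold: an upper bound for ball masses, covers
  of a bounded set that carries the law, and differentiation of the law in mean. The last assumption
  is what ties \<open>f\<close> to \<open>\<mu>\<close>.\<close>

locale knn_sample = iid_sample P X \<mu> k
  for P :: "'w measure" and X :: "nat \<Rightarrow> 'w \<Rightarrow> 'a::euclidean_space" and \<mu> k +
  fixes m :: nat and v c N0 B :: real and K :: "'a set" and f :: "'a \<Rightarrow> real"
  assumes m: "0 < m" and k: "0 < k" and v: "0 < v" and c: "0 < c"
    and ball_le: "\<And>x r. 0 < r \<Longrightarrow> measure \<mu> (cball x r) \<le> c * r ^ m"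
    and K_bounded: "bounded K" and K_AE: "AE x in \<mu>. x \<in> K" and K_covers: "fine_covers m N0 K"
    and f_measurable [measurable]: "f \<in> borel_measurable borel"
    and f_nonneg: "\<And>x. 0 \<le> f x" and f_le: "\<And>x. f x \<le> B" and f_pos: "AE x in \<mu>. 0 < f x"
    and ln_f: "integrable \<mu> (\<lambda>x. ln (f x))"
    and differentiation: "\<And>r :: nat \<Rightarrow> real. (\<And>n. 0 < r n) \<Longrightarrow> r \<longlonglongrightarrow> 0 \<Longrightarrow>
      (\<lambda>n. \<integral>\<^sup>+x. ennreal \<bar>measure \<mu> (cball x (r n)) / (v * r n ^ m) - f x\<bar> \<partial>\<mu>) \<longlonglongrightarrow> 0"
begin

text \<open>The solution of \<open>v * n * r ^ m = exp s\<close>, where \<open>n\<close> is the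
  sample size minus 1: a distance exceeds it exactly when its normalised volume exceeds
  \<open>exp s\<close>.\<close>

definition radius :: "nat \<Rightarrow> real \<Rightarrow> real" where
  "radius n s = root m (exp s / (v * real n))"

definition limit_fraction :: "real \<Rightarrow> real" where
  "limit_fraction s = (\<integral>x. poisson_less k (exp s * f x) \<partial>\<mu>)"

lemma radius_pos: "0 < n \<Longrightarrow> 0 < radius n s"
  using m v by (simp add: radius_def)

lemma radius_power: "0 < n \<Longrightarrow> radius n s ^ m = exp s / (v * real n)"
  using m v by (simp add: radius_def)

lemma radius_measurable [measurable]: "radius n \<in> borel_measurable borel"
  unfolding radius_def[abs_def] divide_inverse by (intro borel_measurable_continuous_onI continuous_intros)

lemma radius_tendsto: "(\<lambda>n. radius (Suc n) s) \<longlonglongrightarrow> 0"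
proof -
  have "(\<lambda>n. exp s / v / real (Suc n)) \<longlonglongrightarrow> 0"
    by (rule LIMSEQ_Suc[OF lim_const_over_n])
  from tendsto_real_root[OF this, of m] show ?thesis
    by (simp add: radius_def)
qed

lemma integral_mu_const: "(\<integral>x. a \<partial>\<mu>) = (a :: real)"
  using mu.prob_space by simp

lemma poisson_f_bounds: "0 \<le> l \<Longrightarrow> 0 \<le> poisson_less k (l * f x)" "0 \<le> l \<Longrightarrow> poisson_less k (l * f x) \<le> 1"
  using poisson_less_bounds[of "l * f x" k] f_nonneg by auto

lemma borel_measurable_mu [simp]: "borel_measurable \<mu> = borel_measurable borel"
  by (rule measurable_cong_sets[OF sets_mu refl])

lemma ball_mass_integral_le: "0 < r \<Longrightarrow> (\<integral>y. ball_mass r y \<partial>\<mu>) \<le> c * r ^ m"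
proof -
  assume r: "0 < r"
  have "(\<integral>y. ball_mass r y \<partial>\<mu>) \<le> (\<integral>y. c * r ^ m \<partial>\<mu>)"
    using ball_le[OF r] by (intro integral_mono integrable_ball_mass) (auto simp: ball_mass_def)
  then show ?thesis by (simp add: integral_mu_const del: Bochner_Integration.lebesgue_integral_const)
qed

text \<open>First the ball mass is replaced by \<open>exp s * f x\<close> over the number of trials.
  That number times \<open>v * r ^ m\<close> is \<open>exp s\<close>, so by the Lipschitz bound the
  replacement costs \<open>exp s\<close> times the error in mean, which vanishes. Afterwards the
  Poisson limit holds for each \<open>x\<close>.\<close>

lemma few_prob_tendsto: "(\<lambda>n. few_prob (Suc n) (radius (Suc n) s)) \<longlonglongrightarrow> limit_fraction s"
proof -
  let ?r = "\<lambda>n. radius (Suc n) s"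
  \<comment> \<open>This may exceed 1 for small \<open>n\<close>. It is capped by
    \<open>min 1\<close> below, and the cap is inactive once
    \<open>exp s * B \<le> real (Suc n)\<close>.\<close>
  let ?q = "\<lambda>n x. exp s * f x / real (Suc n)"
  let ?d = "\<lambda>n x. \<bar>ball_mass (?r n) x / (v * ?r n ^ m) - f x\<bar>"
  have bin: "integrable \<mu> (\<lambda>x. binomial_less n k (h x))" if "\<And>x. 0 \<le> h x" "\<And>x. h x \<le> 1" "h \<in> borel_measurable borel"
    for h n
    using that binomial_less_bounds[OF that(1,2)] by (intro mu.integrable_const_bound[of _ 1]) auto
  have large: "\<forall>\<^sub>F n in sequentially. exp s * B \<le> real (Suc n)"
  proof -
    obtain n0 :: nat where "exp s * B \<le> real n0" using real_arch_simple by blast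
    then show ?thesis
      by (intro eventually_sequentiallyI[of n0]) linarith
  qed
  have dint: "integrable \<mu> (?d n)" for n
  proof (rule mu.integrable_const_bound[of _ "1 / (v * ?r n ^ m) + B"])
    have w: "0 < v * ?r n ^ m" using v radius_pos[of "Suc n" s] by simp
    show "AE x in \<mu>. norm (?d n x) \<le> 1 / (v * ?r n ^ m) + B"
    proof (rule AE_I2)
      fix x
      have "ball_mass (?r n) x / (v * ?r n ^ m) \<le> 1 / (v * ?r n ^ m)"
        using w ball_mass_bounds by (intro divide_right_mono) auto
      moreover have "0 \<le> ball_mass (?r n) x / (v * ?r n ^ m)"
        using w ball_mass_bounds by simp
      ultimately show "norm (?d n x) \<le> 1 / (v * ?r n ^ m) + B"
        using f_nonneg[of x] f_le[of x] by (simp del: power_Suc)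
    qed
  qed simp
  have "(\<lambda>n. \<integral>\<^sup>+x. ennreal (?d n x) \<partial>\<mu>) \<longlonglongrightarrow> 0"
    unfolding ball_mass_def using radius_pos radius_tendsto by (intro differentiation) auto
  then have "(\<lambda>n. enn2real (\<integral>\<^sup>+x. ennreal (?d n x) \<partial>\<mu>)) \<longlonglongrightarrow> 0"
    by (intro tendsto_enn2real) simp_all
  moreover have "enn2real (\<integral>\<^sup>+x. ennreal (?d n x) \<partial>\<mu>) = (\<integral>x. ?d n x \<partial>\<mu>)" for n
    using dint[of n] by (subst nn_integral_eq_integral) auto
  ultimately have d0: "(\<lambda>n. \<integral>x. ?d n x \<partial>\<mu>) \<longlonglongrightarrow> 0" by simp
  have 1: "(\<lambda>n. few_prob (Suc n) (?r n) - (\<integral>x. binomial_less (Suc n) k (min 1 (?q n x)) \<partial>\<mu>)) \<longlonglongrightarrow> 0"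
  proof (rule Lim_null_comparison[of _ "\<lambda>n. exp s * (\<integral>x. ?d n x \<partial>\<mu>)"])
    show "(\<lambda>n. exp s * (\<integral>x. ?d n x \<partial>\<mu>)) \<longlonglongrightarrow> 0"
      using tendsto_mult_left[OF d0, of "exp s"] by simp
    show "\<forall>\<^sub>F n in sequentially. norm (few_prob (Suc n) (?r n) - (\<integral>x. binomial_less (Suc n) k (min 1 (?q n x)) \<partial>\<mu>)) \<le> exp s * (\<integral>x. ?d n x \<partial>\<mu>)"
      using large
    proof eventually_elim
      case (elim n)
      have q1: "0 \<le> ?q n x" "?q n x \<le> 1" for x
      proof -
        have "exp s * f x \<le> exp s * B" using f_le[of x] by (intro mult_left_mono) auto
        from order_trans[OF this elim] show "?q n x \<le> 1" by simp
      qed (use f_nonneg in simp)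
      have q: "min 1 (?q n x) = ?q n x" for x using q1[of x] by simp
      have b1: "integrable \<mu> (\<lambda>x. binomial_less (Suc n) k (ball_mass (?r n) x))"
        by (rule integrable_binomial_ball_mass)
      have b2: "integrable \<mu> (\<lambda>x. binomial_less (Suc n) k (?q n x))"
        by (rule bin) (use q1 in auto)
      have "\<bar>\<integral>x. binomial_less (Suc n) k (ball_mass (?r n) x) - binomial_less (Suc n) k (?q n x) \<partial>\<mu>\<bar> \<le>
          (\<integral>x. exp s * ?d n x \<partial>\<mu>)"
      proof (rule order_trans[OF integral_abs_bound integral_mono])
        show "integrable \<mu> (\<lambda>x. \<bar>binomial_less (Suc n) k (ball_mass (?r n) x) - binomial_less (Suc n) k (?q n x)\<bar>)"
          using b1 b2 by (intro integrable_abs Bochner_Integration.integrable_diff)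
        show "integrable \<mu> (\<lambda>x. exp s * ?d n x)" using dint[of n] by (rule integrable_mult_right)
        fix x
        have w: "real (Suc n) * (v * ?r n ^ m) = exp s"
          using v radius_power[of "Suc n" s] by simp
        have w0: "v * ?r n ^ m \<noteq> 0" using v radius_pos[of "Suc n" s] by simp
        have "\<bar>binomial_less (Suc n) k (ball_mass (?r n) x) - binomial_less (Suc n) k (?q n x)\<bar> \<le>
            real (Suc n) * \<bar>ball_mass (?r n) x - ?q n x\<bar>"
          by (rule binomial_less_lipschitz[OF ball_mass_bounds q1])
        also have "\<dots> = \<bar>real (Suc n) * ball_mass (?r n) x - exp s * f x\<bar>"
        proof -
          have "N * \<bar>a - b / N\<bar> = \<bar>N * a - b\<bar>" if "0 < N" for N a b :: real
          proof -
            have "N * \<bar>a - b / N\<bar> = \<bar>N * (a - b / N)\<bar>" using that by (simp add: abs_mult)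
            also have "N * (a - b / N) = N * a - b" using that by (simp add: right_diff_distrib)
            finally show ?thesis .
          qed
          then show ?thesis by simp
        qed
        also have "real (Suc n) * ball_mass (?r n) x = exp s * (ball_mass (?r n) x / (v * ?r n ^ m))"
        proof -
          have "N * b = N * w * (b / w)" if "w \<noteq> 0" for N b w :: real
            using that by simp
          then show ?thesis unfolding w[symmetric] using w0 .
        qed
        also have "\<bar>exp s * (ball_mass (?r n) x / (v * ?r n ^ m)) - exp s * f x\<bar> = exp s * ?d n x"
          by (simp only: right_diff_distrib[symmetric] abs_mult abs_exp_cancel)
        finally show "\<bar>binomial_less (Suc n) k (ball_mass (?r n) x) - binomial_less (Suc n) k (?q n x)\<bar> \<le> exp s * ?d n x" .
      qed
      also have "(\<integral>x. binomial_less (Suc n) k (ball_mass (?r n) x) - binomial_less (Suc n) k (?q n x) \<partial>\<mu>) =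
          few_prob (Suc n) (?r n) - (\<integral>x. binomial_less (Suc n) k (?q n x) \<partial>\<mu>)"
        unfolding few_prob_def by (rule Bochner_Integration.integral_diff[OF b1 b2])
      finally show ?case
        unfolding q real_norm_def by (simp only: integral_mult_right_zero)
    qed
  qed
  have 2: "(\<lambda>n. \<integral>x. binomial_less (Suc n) k (min 1 (?q n x)) \<partial>\<mu>) \<longlonglongrightarrow> limit_fraction s"
    unfolding limit_fraction_def
  proof (rule integral_dominated_convergence[where w = "\<lambda>_. 1"])
    show "AE x in \<mu>. (\<lambda>n. binomial_less (Suc n) k (min 1 (?q n x))) \<longlonglongrightarrow> poisson_less k (exp s * f x)"
    proof (rule AE_I2)
      fix x
      have "(\<lambda>n. binomial_less (Suc n) k (?q n x)) \<longlonglongrightarrow> poisson_less k (exp s * f x)"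
        by (rule LIMSEQ_Suc[OF binomial_less_tendsto])
      moreover have "\<forall>\<^sub>F n in sequentially. binomial_less (Suc n) k (?q n x) = binomial_less (Suc n) k (min 1 (?q n x))"
        using large
      proof eventually_elim
        case (elim n)
        have "exp s * f x \<le> exp s * B" using f_le[of x] by (intro mult_left_mono) auto
        from order_trans[OF this elim] have "?q n x \<le> 1" by simp
        then show ?case by (simp only: min.absorb2)
      qed
      ultimately show "(\<lambda>n. binomial_less (Suc n) k (min 1 (?q n x))) \<longlonglongrightarrow> poisson_less k (exp s * f x)"
        by (rule Lim_transform_eventually)
    qed
    show "AE x in \<mu>. norm (binomial_less (Suc n) k (min 1 (?q n x))) \<le> 1" for n
      using f_nonneg binomial_less_bounds[of "min 1 (?q n _)" "Suc n" k]
      by (intro AE_I2) (simp del: binomial_less.simps)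
  qed (auto simp del: binomial_less.simps)
  from tendsto_add[OF 1 2] show ?thesis by simp
qed

lemma mean_square_tendsto:
  "(\<lambda>n. expectation (\<lambda>\<omega>. (few_fraction (Suc (Suc n)) (radius (Suc n) s) \<omega> - limit_fraction s)\<^sup>2)) \<longlonglongrightarrow> 0"
proof -
  let ?r = "\<lambda>n. radius (Suc n) s" and ?F = "limit_fraction s"
  let ?a = "\<lambda>n. few_prob (Suc n) (?r n)"
  let ?D = "\<lambda>n \<omega>. few_fraction (Suc (Suc n)) (?r n) \<omega>"
  \<comment> \<open>The square is expanded with the exact mean and an upper bound for the second
    moment; in the limit the terms are
    \<open>?F\<^sup>2 - 2 * ?F\<^sup>2 + ?F\<^sup>2\<close>.\<close>
  let ?u = "\<lambda>n. ?a n / real (Suc (Suc n)) + (?a n + c * ?r n ^ m)\<^sup>2 + c * (2 * ?r n) ^ m - 2 * ?F * ?a n + ?F\<^sup>2"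
  have "?u \<longlonglongrightarrow> 0 + (?F + c * 0 ^ m)\<^sup>2 + c * (2 * 0) ^ m - 2 * ?F * ?F + ?F\<^sup>2"
  proof (intro tendsto_intros few_prob_tendsto radius_tendsto)
    have "(\<lambda>n. ?a n * inverse (real (Suc (Suc n)))) \<longlonglongrightarrow> ?F * 0"
      by (intro tendsto_mult few_prob_tendsto LIMSEQ_Suc LIMSEQ_inverse_real_of_nat)
    then show "(\<lambda>n. ?a n / real (Suc (Suc n))) \<longlonglongrightarrow> 0"
      by (simp add: divide_inverse)
  qed
  moreover have "0 + (?F + c * 0 ^ m)\<^sup>2 + c * (2 * 0) ^ m - 2 * ?F * ?F + ?F\<^sup>2 = 0"
    using m by (simp add: power2_eq_square zero_power)
  ultimately have u: "?u \<longlonglongrightarrow> 0" by (simp only:)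
  have le: "expectation (\<lambda>\<omega>. (?D n \<omega> - ?F)\<^sup>2) \<le> ?u n" for n
  proof -
    have iD: "integrable P (?D n)" by (rule integrable_few_fraction)
    have iD2: "integrable P (\<lambda>\<omega>. (?D n \<omega>)\<^sup>2)"
      using few_fraction_bounds by (intro integrable_const_bound[of _ 1]) (auto simp: power_le_one)
    have "expectation (\<lambda>\<omega>. (?D n \<omega> - ?F)\<^sup>2) = expectation (\<lambda>\<omega>. (?D n \<omega>)\<^sup>2 - 2 * ?F * ?D n \<omega> + ?F\<^sup>2)"
      by (intro Bochner_Integration.integral_cong) (auto simp: power2_eq_square algebra_simps)
    also have "\<dots> = expectation (\<lambda>\<omega>. (?D n \<omega>)\<^sup>2) - 2 * ?F * expectation (?D n) + ?F\<^sup>2"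
      using iD iD2 by (simp add: prob_space)
    also have "expectation (?D n) = ?a n" by (rule expectation_few_fraction)
    also have "expectation (\<lambda>\<omega>. (?D n \<omega>)\<^sup>2) \<le> ?a n / real (Suc (Suc n)) + (few_prob n (?r n))\<^sup>2 + (\<integral>y. ball_mass (2 * ?r n) y \<partial>\<mu>)"
      by (rule expectation_few_fraction_square)
    also have "(\<integral>y. ball_mass (2 * ?r n) y \<partial>\<mu>) \<le> c * (2 * ?r n) ^ m"
      using radius_pos[of "Suc n" s] by (intro ball_mass_integral_le) simp
    also have "(few_prob n (?r n))\<^sup>2 \<le> (?a n + c * ?r n ^ m)\<^sup>2"
      using few_prob_le_Suc[of n "?r n"] ball_mass_integral_le[OF radius_pos[of "Suc n" s]] few_prob_bounds
      by (intro power_mono) auto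
    finally show ?thesis by simp
  qed
  show ?thesis
    by (rule tendsto_sandwich[OF _ _ tendsto_const u]) (use le in auto)
qed

lemma few_fraction_upper:
  obtains C where "0 \<le> C" "\<And>n s \<omega>. k \<le> n \<Longrightarrow> (\<And>i. i \<in> {1..Suc n} \<Longrightarrow> X i \<omega> \<in> K) \<Longrightarrow>
    few_fraction (Suc n) (radius n s) \<omega> \<le> C * exp (- s)"
proof -
  obtain R0 where R0: "\<And>x y. x \<in> K \<Longrightarrow> y \<in> K \<Longrightarrow> dist x y \<le> R0"
    using K_bounded unfolding bounded_two_points by (elim exE) (rule that, blast)
  \<comment> \<open>Covers exist for scales up to 1 only. Dividing by a bound \<open>R\<close> for
    the diameter brings every \<open>r < R\<close> into this range; for \<open>r \<ge> R\<close> all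
    \<open>n \<ge> k\<close> other points are near, so no index is counted.\<close>
  define R where "R = max 1 R0"
  have R: "1 \<le> R" "\<And>x y. x \<in> K \<Longrightarrow> y \<in> K \<Longrightarrow> dist x y \<le> R"
    using R0 by (simp_all add: R_def le_max_iff_disj)
  have N0: "0 \<le> N0"
    by (rule fine_coversE[OF K_covers, of 1]) (auto intro: order_trans[OF of_nat_0_le_iff])
  have count: "(\<Sum>i=1..Suc n. of_bool (few (Suc n) r i \<omega>)) \<le> real k * N0 * R ^ m / r ^ m"
    if r: "0 < r" and n: "k \<le> n" and XK: "\<And>i. i \<in> {1..Suc n} \<Longrightarrow> X i \<omega> \<in> K" for n r \<omega>
  proof (cases "R \<le> r")
    case True
    have "\<not> few (Suc n) r i \<omega>" if i: "i \<in> {1..Suc n}" for i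
    proof -
      have "dist (X i \<omega>) (X j \<omega>) \<le> r" if "j \<in> {1..Suc n}" for j
        using R(2)[OF XK[OF i] XK[OF that]] True by simp
      then have "{j \<in> {1..Suc n} - {i}. dist (X i \<omega>) (X j \<omega>) \<le> r} = {1..Suc n} - {i}" by auto
      then show ?thesis using i n by (simp add: few_def)
    qed
    then have "(\<Sum>i=1..Suc n. of_bool (few (Suc n) r i \<omega>)) = (\<Sum>i=1..Suc n. 0 :: real)"
      by (intro sum.cong) auto
    then show ?thesis using N0 r R(1) by simp
  next
    case False
    have "0 < r / R" "r / R \<le> 1" using r R(1) False by auto
    then obtain Q where Q: "finite Q" "real (card Q) \<le> N0 / (r / R) ^ m" "K \<subseteq> \<Union>Q" "\<forall>A\<in>Q. \<forall>x\<in>A. \<forall>y\<in>A. dist x y \<le> r / R"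
      by (rule fine_coversE[OF K_covers])
    have rR: "r / R \<le> r" using r R(1) by (simp add: field_simps)
    let ?S = "\<lambda>A. {i \<in> {1..Suc n}. few (Suc n) r i \<omega> \<and> X i \<omega> \<in> A}"
    \<comment> \<open>If \<open>i\<close> is counted, the other counted indices in the same cell are
      within \<open>r\<close> of it, so there are fewer than \<open>k\<close> of them.\<close>
    have cardS: "card (?S A) \<le> k" if A: "A \<in> Q" for A
    proof (cases "?S A = {}")
      case False
      then obtain i where i: "i \<in> ?S A" by blast
      have "?S A - {i} \<subseteq> {j \<in> {1..Suc n} - {i}. dist (X i \<omega>) (X j \<omega>) \<le> r}"
        using Q(4) A i rR by fastforce
      then have "card (?S A - {i}) \<le> card {j \<in> {1..Suc n} - {i}. dist (X i \<omega>) (X j \<omega>) \<le> r}"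
        by (intro card_mono) auto
      also have "\<dots> < k" using i by (simp add: few_def)
      finally show ?thesis using i by (simp add: card_Diff_singleton)
    next
      case True
      then show ?thesis by (simp only: card.empty)
    qed
    have "(\<Sum>i=1..Suc n. of_bool (few (Suc n) r i \<omega>)) = real (card {i \<in> {1..Suc n}. few (Suc n) r i \<omega>})"
      by (simp only: sum_of_bool_eq finite_atLeastAtMost Int_def mem_Collect_eq)
    also have "card {i \<in> {1..Suc n}. few (Suc n) r i \<omega>} \<le> card (\<Union>A\<in>Q. ?S A)"
    proof (rule card_mono)
      show "finite (\<Union>A\<in>Q. ?S A)" using Q(1) by simp
      show "{i \<in> {1..Suc n}. few (Suc n) r i \<omega>} \<subseteq> (\<Union>A\<in>Q. ?S A)"
      proof
        fix i assume i: "i \<in> {i \<in> {1..Suc n}. few (Suc n) r i \<omega>}"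
        then have "X i \<omega> \<in> \<Union>Q" using XK[of i] Q(3) by blast
        then show "i \<in> (\<Union>A\<in>Q. ?S A)" using i by blast
      qed
    qed
    also have "card (\<Union>A\<in>Q. ?S A) \<le> (\<Sum>A\<in>Q. card (?S A))" by (rule card_UN_le[OF Q(1)])
    also have "\<dots> \<le> (\<Sum>A\<in>Q. k)" using cardS by (rule sum_mono)
    also have "real (\<Sum>A\<in>Q. k) = real (card Q) * real k" by simp
    also have "\<dots> \<le> N0 / (r / R) ^ m * real k" using Q(2) by (rule mult_right_mono) simp
    also have "\<dots> = real k * N0 * R ^ m / r ^ m" by (simp add: power_divide)
    finally show ?thesis by simp
  qed
  show thesis
  proof
    show "0 \<le> real k * N0 * R ^ m * v" using N0 R(1) v by simp
    fix n s \<omega> assume n: "k \<le> n" and XK: "\<And>i. i \<in> {1..Suc n} \<Longrightarrow> X i \<omega> \<in> K"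
    have n0: "0 < n" using n k by simp
    have "few_fraction (Suc n) (radius n s) \<omega> \<le> real k * N0 * R ^ m / radius n s ^ m / real (Suc n)"
      unfolding few_fraction_def by (intro divide_right_mono count radius_pos n0 n XK) auto
    also have "\<dots> = real k * N0 * R ^ m * v * exp (- s) * (real n / real (Suc n))"
      unfolding radius_power[OF n0] using v n0 by (simp add: exp_minus field_simps)
    also have "\<dots> \<le> real k * N0 * R ^ m * v * exp (- s) * 1"
      using N0 R(1) v by (intro mult_left_mono) auto
    finally show "few_fraction (Suc n) (radius n s) \<omega> \<le> real k * N0 * R ^ m * v * exp (- s)" by simp
  qed
qed

lemma AE_X_in_K: "AE \<omega> in P. \<forall>i. X i \<omega> \<in> K"
proof -
  have "AE \<omega> in P. X i \<omega> \<in> K" for i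
    using K_AE unfolding X_distr[of i, symmetric] by (rule AE_distrD[rotated]) simp
  then show ?thesis by (simp add: AE_all_countable)
qed

text \<open>The probability of at least one hit is at most the mean number of hits, \<open>n\<close>
  times the ball mass.\<close>

lemma few_prob_lower:
  assumes n: "0 < n"
  shows "1 - few_prob n (radius n s) \<le> c / v * exp s"
proof -
  let ?r = "radius n s"
  have "(\<integral>y. 1 - real n * ball_mass ?r y \<partial>\<mu>) \<le> few_prob n ?r"
    unfolding few_prob_def using binomial_less_ge[OF ball_mass_bounds k]
    by (intro integral_mono integrable_binomial_ball_mass Bochner_Integration.integrable_diff integrable_mult_right integrable_ball_mass) auto
  moreover have "(\<integral>y. 1 - real n * ball_mass ?r y \<partial>\<mu>) = 1 - real n * (\<integral>y. ball_mass ?r y \<partial>\<mu>)"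
    using integrable_ball_mass[of ?r] mu.prob_space by simp
  moreover have "real n * (\<integral>y. ball_mass ?r y \<partial>\<mu>) \<le> real n * (c * ?r ^ m)"
    by (intro mult_left_mono ball_mass_integral_le radius_pos n) simp
  moreover have "real n * (c * ?r ^ m) = c / v * exp s"
    unfolding radius_power[OF n] using n v by simp
  ultimately show ?thesis by linarith
qed

lemma limit_fraction_bounds: "0 \<le> limit_fraction s" "limit_fraction s \<le> 1"
proof -
  show "0 \<le> limit_fraction s"
    by (rule tendsto_lowerbound[OF few_prob_tendsto _ sequentially_bot])
      (intro always_eventually allI few_prob_bounds)
  show "limit_fraction s \<le> 1"
    by (rule tendsto_upperbound[OF few_prob_tendsto _ sequentially_bot])
      (intro always_eventually allI few_prob_bounds)
qed

lemma fraction_tails: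
  obtains C where "0 \<le> C"
    "\<And>n s. k \<le> n \<Longrightarrow> expectation (\<lambda>\<omega>. (few_fraction (Suc n) (radius n s) \<omega> - limit_fraction s)\<^sup>2) \<le> C * exp (- \<bar>s\<bar>)"
    "\<And>s. \<bar>limit_fraction s - of_bool (s \<le> 0)\<bar> \<le> C * exp (- \<bar>s\<bar>)"
proof -
  obtain C where C: "0 \<le> C" "\<And>n s \<omega>. k \<le> n \<Longrightarrow> (\<And>i. i \<in> {1..Suc n} \<Longrightarrow> X i \<omega> \<in> K) \<Longrightarrow>
    few_fraction (Suc n) (radius n s) \<omega> \<le> C * exp (- s)"
    by (rule few_fraction_upper) blast
  \<comment> \<open>\<open>C\<close> serves for \<open>s > 0\<close>. For \<open>s \<le> 0\<close>
    both the mean proportion and its limit may fall short of 1 by \<open>c / v * exp s\<close>,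
    hence the factor 2.\<close>
  let ?C = "C + 2 * (c / v)"
  have cv: "0 < c / v" using c v by simp
  have upAE: "AE \<omega> in P. few_fraction (Suc n) (radius n s) \<omega> \<le> C * exp (- s)" if "k \<le> n" for n s
    using AE_X_in_K by eventually_elim (rule C(2)[OF that], auto)
  have up: "few_prob n (radius n s) \<le> C * exp (- s)" if n: "k \<le> n" for n s
  proof -
    have "expectation (few_fraction (Suc n) (radius n s)) \<le> expectation (\<lambda>_. C * exp (- s))"
      using upAE[OF n, of s] by (intro integral_mono_AE integrable_few_fraction) auto
    then show ?thesis unfolding expectation_few_fraction by (simp add: prob_space)
  qed
  have ev: "\<forall>\<^sub>F n in sequentially. k \<le> Suc n" by (intro eventually_sequentiallyI[of k]) simp
  have Fup: "limit_fraction s \<le> C * exp (- s)" for s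
  proof (rule tendsto_upperbound[OF few_prob_tendsto _ sequentially_bot])
    show "\<forall>\<^sub>F n in sequentially. few_prob (Suc n) (radius (Suc n) s) \<le> C * exp (- s)"
      using ev by eventually_elim (rule up)
  qed
  have Flo: "1 - limit_fraction s \<le> c / v * exp s" for s
    by (rule tendsto_upperbound[OF tendsto_diff[OF tendsto_const few_prob_tendsto] _ sequentially_bot])
      (intro always_eventually allI few_prob_lower zero_less_Suc)
  note F01 = limit_fraction_bounds
  show thesis
  proof
    show "0 \<le> ?C" using C(1) cv by simp
    show "\<bar>limit_fraction s - of_bool (s \<le> 0)\<bar> \<le> ?C * exp (- \<bar>s\<bar>)" for s
    proof (cases "s \<le> 0")
      case True
      have "c / v * exp s \<le> ?C * exp s" using cv C(1) by (intro mult_right_mono) auto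
      from order_trans[OF Flo this] show ?thesis using True F01[of s] by simp
    next
      case False
      have "C * exp (- s) \<le> ?C * exp (- s)" using cv by (intro mult_right_mono) auto
      from order_trans[OF Fup this] show ?thesis using False F01[of s] by simp
    qed
    fix n s assume n: "k \<le> n"
    let ?D = "few_fraction (Suc n) (radius n s)"
    \<comment> \<open>Both numbers lie in \<open>{0..1}\<close>, so the square of their difference
      is at most its absolute value, and bounds on first moments suffice.\<close>
    have sq: "(?D \<omega> - limit_fraction s)\<^sup>2 \<le> \<bar>?D \<omega> - limit_fraction s\<bar>" for \<omega>
    proof -
      have "\<bar>?D \<omega> - limit_fraction s\<bar> \<le> 1" using few_fraction_bounds[of "Suc n" "radius n s" \<omega>] F01[of s] by linarith
      then have "\<bar>?D \<omega> - limit_fraction s\<bar> * \<bar>?D \<omega> - limit_fraction s\<bar> \<le> \<bar>?D \<omega> - limit_fraction s\<bar> * 1"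
        by (intro mult_left_mono) auto
      then show ?thesis by (simp add: power2_eq_square)
    qed
    have iD: "integrable P ?D" by (rule integrable_few_fraction)
    have iD2: "integrable P (\<lambda>\<omega>. (?D \<omega> - limit_fraction s)\<^sup>2)"
    proof (rule Bochner_Integration.integrable_bound[of _ "\<lambda>\<omega>. \<bar>?D \<omega> - limit_fraction s\<bar>"])
      show "integrable P (\<lambda>\<omega>. \<bar>?D \<omega> - limit_fraction s\<bar>)" using iD by simp
    qed (use sq in auto)
    show "expectation (\<lambda>\<omega>. (?D \<omega> - limit_fraction s)\<^sup>2) \<le> ?C * exp (- \<bar>s\<bar>)"
    proof (cases "s \<le> 0")
      case True
      have "expectation (\<lambda>\<omega>. (?D \<omega> - limit_fraction s)\<^sup>2) \<le> expectation (\<lambda>\<omega>. (1 - ?D \<omega>) + (1 - limit_fraction s))"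
      proof (rule integral_mono[OF iD2])
        fix \<omega>
        have "\<bar>?D \<omega> - limit_fraction s\<bar> \<le> (1 - ?D \<omega>) + (1 - limit_fraction s)"
          using few_fraction_bounds[of "Suc n" "radius n s" \<omega>] F01[of s] by linarith
        then show "(?D \<omega> - limit_fraction s)\<^sup>2 \<le> (1 - ?D \<omega>) + (1 - limit_fraction s)"
          using sq[of \<omega>] by linarith
      qed (use iD in auto)
      also have "\<dots> = (1 - few_prob n (radius n s)) + (1 - limit_fraction s)"
        using iD by (simp add: prob_space expectation_few_fraction)
      also have "\<dots> \<le> c / v * exp s + c / v * exp s"
        using few_prob_lower[of n s] Flo[of s] n k by (intro add_mono) auto
      also have "\<dots> = 2 * (c / v) * exp s" by simp
      also have "\<dots> \<le> ?C * exp s" using C(1) by (intro mult_right_mono) auto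
      finally show ?thesis using True by simp
    next
      case False
      have "expectation (\<lambda>\<omega>. (?D \<omega> - limit_fraction s)\<^sup>2) \<le> expectation (\<lambda>\<omega>. C * exp (- s))"
      proof (rule integral_mono_AE[OF iD2])
        show "AE \<omega> in P. (?D \<omega> - limit_fraction s)\<^sup>2 \<le> C * exp (- s)"
          using upAE[OF n, of s]
        proof eventually_elim
          case (elim \<omega>)
          have "\<bar>?D \<omega> - limit_fraction s\<bar> \<le> C * exp (- s)"
            using elim Fup[of s] few_fraction_bounds[of "Suc n" "radius n s" \<omega>] F01[of s] by linarith
          then show ?case using sq[of \<omega>] by linarith
        qed
      qed simp
      also have "\<dots> = C * exp (- s)" by (simp add: prob_space)
      also have "\<dots> \<le> ?C * exp (- s)" using cv by (intro mult_right_mono) auto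
      finally show ?thesis using False by simp
    qed
  qed
qed

text \<open>Fubini's theorem in \<open>s\<close> and \<open>x\<close>. At fixed \<open>x\<close> the
  absolute integral over \<open>s\<close> is at most a constant plus
  \<open>\<bar>ln (f x)\<bar>\<close>, which is integrable by \<open>ln_f\<close>; the entropy
  enters through the scaling by \<open>f x\<close>.\<close>

lemma limit_fraction_integral:
  "has_bochner_integral lborel (\<lambda>s. limit_fraction s - of_bool (s \<le> 0)) (knn_psi k - (\<integral>x. ln (f x) \<partial>\<mu>))"
proof -
  interpret Q: pair_sigma_finite \<mu> lborel ..
  let ?g = "\<lambda>x s. poisson_less k (exp s * f x) - of_bool (s \<le> 0)"
  let ?C = "\<integral>s. \<bar>poisson_less k (exp s) - of_bool (s \<le> 0)\<bar> \<partial>lborel"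
  have meas: "case_prod ?g \<in> borel_measurable (\<mu> \<Otimes>\<^sub>M lborel)" by measurable
  have ints: "AE x in \<mu>. integrable lborel (?g x)"
    using f_pos by eventually_elim (use poisson_less_scaled_integral(1)[OF k] in \<open>auto simp: has_bochner_integral_iff\<close>)
  have "integrable \<mu> (\<lambda>x. \<integral>s. norm (?g x s) \<partial>lborel)"
  proof (rule Bochner_Integration.integrable_bound)
    show "integrable \<mu> (\<lambda>x. ?C + \<bar>ln (f x)\<bar>)" using ln_f by simp
    have "(\<lambda>x. \<integral>s. norm (?g x s) \<partial>lborel) \<in> borel_measurable \<mu>"
      by (rule lborel.borel_measurable_lebesgue_integral) measurable
    then show "(\<lambda>x. \<integral>s. norm (?g x s) \<partial>lborel) \<in> borel_measurable \<mu>" .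
    show "AE x in \<mu>. norm (\<integral>s. norm (?g x s) \<partial>lborel) \<le> norm (?C + \<bar>ln (f x)\<bar>)"
      using f_pos
    proof eventually_elim
      case (elim x)
      have "0 \<le> (\<integral>s. norm (?g x s) \<partial>lborel)" by simp
      then show ?case using poisson_less_scaled_integral(2)[OF k elim] by simp
    qed
  qed
  then have int: "integrable (\<mu> \<Otimes>\<^sub>M lborel) (case_prod ?g)"
    using meas ints by (intro Q.Fubini_integrable) auto
  have inner: "(\<integral>x. ?g x s \<partial>\<mu>) = limit_fraction s - of_bool (s \<le> 0)" for s
  proof -
    have "integrable \<mu> (\<lambda>x. poisson_less k (exp s * f x))"
      using poisson_f_bounds[of "exp s"] by (intro mu.integrable_const_bound[of _ 1]) auto
    then show ?thesis using mu.prob_space by (simp add: limit_fraction_def)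
  qed
  have "integrable lborel (\<lambda>s. limit_fraction s - of_bool (s \<le> 0))"
    using Q.integrable_snd[OF int] by (simp add: inner)
  moreover have "(\<integral>s. limit_fraction s - of_bool (s \<le> 0) \<partial>lborel) = (\<integral>x. (\<integral>s. ?g x s \<partial>lborel) \<partial>\<mu>)"
    using Q.Fubini_integral[OF int] by (simp add: inner)
  moreover have "(\<integral>x. (\<integral>s. ?g x s \<partial>lborel) \<partial>\<mu>) = (\<integral>x. knn_psi k - ln (f x) \<partial>\<mu>)"
  proof (rule integral_cong_AE)
    show "(\<lambda>x. \<integral>s. ?g x s \<partial>lborel) \<in> borel_measurable \<mu>"
      by (rule lborel.borel_measurable_lebesgue_integral) (rule meas)
    show "AE x in \<mu>. (\<integral>s. ?g x s \<partial>lborel) = knn_psi k - ln (f x)"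
      using f_pos by eventually_elim (use poisson_less_scaled_integral(1)[OF k] in \<open>auto simp: has_bochner_integral_iff\<close>)
  qed simp
  moreover have "(\<integral>x. knn_psi k - ln (f x) \<partial>\<mu>) = knn_psi k - (\<integral>x. ln (f x) \<partial>\<mu>)"
    using ln_f mu.prob_space by simp
  ultimately show ?thesis by (simp add: has_bochner_integral_iff)
qed

end

section \<open>The nearest neighbour estimator\<close>

lemma sorted_nth_le_iff:
  fixes xs :: "real list"
  shows "sorted xs \<Longrightarrow> j < length xs \<Longrightarrow> xs ! j \<le> r \<longleftrightarrow> j < length (filter (\<lambda>x. x \<le> r) xs)"
proof (induction xs arbitrary: j)
  case (Cons x xs)
  show ?case
  proof (cases "x \<le> r")
    case True
    then show ?thesis using Cons by (cases j) auto
  next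
    case False
    then have "\<forall>y\<in>set (x # xs). \<not> y \<le> r" using Cons.prems(1) by auto
    then have "filter (\<lambda>x. x \<le> r) (x # xs) = []" "\<not> (x # xs) ! j \<le> r"
      using Cons.prems(2) nth_mem[of j "x # xs"] by (simp only: filter_empty_conv, blast)+
    then show ?thesis by simp
  qed
qed simp

text \<open>An order statistic turned into a count, the form that can be measured and compared with
  \<open>few\<close>. The last case is the default value 0.\<close>

lemma nn_dist_le_iff:
  assumes F: "finite F" and k: "0 < k"
  shows "nn_dist k x F \<le> r \<longleftrightarrow> (if k \<le> card (F - {x}) then k \<le> card {y \<in> F - {x}. dist x y \<le> r} else 0 \<le> r)"
proof (cases "k \<le> card (F - {x})")
  case True
  let ?M = "image_mset (dist x) (mset_set (F - {x}))"
  let ?L = "sorted_list_of_multiset ?M"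
  have fin: "finite (F - {x})" using F by simp
  have mset: "mset ?L = ?M" by simp
  have len: "length ?L = card (F - {x})"
    unfolding size_mset[symmetric] mset using fin by simp
  have "length (filter (\<lambda>z. z \<le> r) ?L) = size (filter_mset (\<lambda>z. z \<le> r) ?M)"
    unfolding size_mset[symmetric] mset_filter mset ..
  also have "\<dots> = card {y \<in> F - {x}. dist x y \<le> r}"
    using fin by (simp add: filter_mset_image_mset)
  finally have "nn_dist k x F \<le> r \<longleftrightarrow> k - 1 < card {y \<in> F - {x}. dist x y \<le> r}"
    using True k len sorted_nth_le_iff[of ?L "k - 1" r] by (simp add: nn_dist_def)
  then show ?thesis using True k by auto
qed (simp add: nn_dist_def)

lemma exp_neg_abs_integrable: "integrable lborel (\<lambda>s :: real. exp (- \<bar>s\<bar> / 2))"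
proof -
  let ?g = "\<lambda>s :: real. exp (1 / 2 * s) * of_bool (s \<le> 0)"
  have g: "integrable lborel ?g"
    using exp_moment_nonpos[of "1 / 2"] by (simp add: has_bochner_integral_iff)
  then have "integrable lborel (\<lambda>s. ?g s + ?g (0 + (- 1) * s))"
    by (intro Bochner_Integration.integrable_add lborel_integrable_real_affine) auto
  then show ?thesis
    by (rule Bochner_Integration.integrable_bound) (auto intro!: AE_I2)
qed

section \<open>From distances to the mean square error\<close>

context knn_sample
begin

lemma singleton_null: "emeasure \<mu> {y} = 0"
proof -
  have "measure \<mu> {y} \<le> c * r ^ m" if r: "0 < r" for r
    using ball_le[OF r, of y] mu.finite_measure_mono[of "{y}" "cball y r"] r by (simp add: sets_mu)
  then have "\<forall>n. measure \<mu> {y} \<le> c * inverse (real (Suc n)) ^ m" by simp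
  moreover have "(\<lambda>n. c * inverse (real (Suc n)) ^ m) \<longlonglongrightarrow> c * 0 ^ m"
    by (intro tendsto_intros LIMSEQ_inverse_real_of_nat)
  ultimately have "measure \<mu> {y} \<le> c * 0 ^ m"
    by (intro tendsto_lowerbound[OF _ _ sequentially_bot]) auto
  then show ?thesis
    using m measure_nonneg[of \<mu> "{y}"] by (simp add: mu.emeasure_eq_measure zero_power)
qed

text \<open>The estimator sees the set of values, \<open>few\<close> the indices. The two views
  agree when there are no ties, and ties are null because the law has no atoms.\<close>

lemma AE_distinct: "AE \<omega> in P. \<forall>i j. i \<noteq> j \<longrightarrow> X i \<omega> \<noteq> X j \<omega>"
proof -
  have "AE \<omega> in P. i \<noteq> j \<longrightarrow> X i \<omega> \<noteq> X j \<omega>" for i j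
  proof (cases "i = j")
    case False
    interpret product_sigma_finite "\<lambda>_ :: nat. \<mu>" ..
    let ?F = "\<lambda>x :: nat \<Rightarrow> 'a. of_bool (dist (x i) (x j) \<le> 0) :: ennreal"
    have [measurable]: "(\<lambda>x. x i) \<in> measurable (Pi\<^sub>M (insert i {j}) (\<lambda>_. borel :: 'a measure)) borel"
        "(\<lambda>x. x j) \<in> measurable (Pi\<^sub>M (insert i {j}) (\<lambda>_. borel :: 'a measure)) borel"
      by (auto intro: measurable_component_singleton)
    have F: "?F \<in> borel_measurable (Pi\<^sub>M (insert i {j}) (\<lambda>_. borel))" by measurable
    have F': "?F \<in> borel_measurable (Pi\<^sub>M (insert i {j}) (\<lambda>_. \<mu>))"
      using F by (simp add: measurable_cong_sets[OF sets_PiM_cong[OF refl sets_mu] refl])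
    have "(\<integral>\<^sup>+\<omega>. of_bool (X i \<omega> = X j \<omega>) \<partial>P) = (\<integral>\<^sup>+\<omega>. ?F (\<lambda>l\<in>insert i {j}. X l \<omega>) \<partial>P)"
      by (intro nn_integral_cong) auto
    also have "\<dots> = (\<integral>\<^sup>+x. ?F x \<partial>Pi\<^sub>M (insert i {j}) (\<lambda>_. \<mu>))"
      by (rule nn_integral_sample) (use F in auto)
    also have "\<dots> = (\<integral>\<^sup>+y. (\<integral>\<^sup>+x. ?F (x(i := y)) \<partial>Pi\<^sub>M {j} (\<lambda>_. \<mu>)) \<partial>\<mu>)"
      by (rule product_nn_integral_insert_rev[OF _ _ F']) (use False in auto)
    also have "\<dots> = (\<integral>\<^sup>+y. (\<integral>\<^sup>+x. indicator {y} (x j) \<partial>Pi\<^sub>M {j} (\<lambda>_. \<mu>)) \<partial>\<mu>)"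
      using False by (intro nn_integral_cong) (auto simp: indicator_def)
    also have "\<dots> = (\<integral>\<^sup>+y. (\<integral>\<^sup>+z. indicator {y} z \<partial>\<mu>) \<partial>\<mu>)"
      by (intro nn_integral_cong product_nn_integral_singleton) simp
    also have "\<dots> = 0" by (simp add: singleton_null sets_mu)
    finally have "AE \<omega> in P. of_bool (X i \<omega> = X j \<omega>) = (0 :: ennreal)"
      by (subst (asm) nn_integral_0_iff_AE) auto
    then show ?thesis by eventually_elim (simp split: if_splits)
  qed simp
  then show ?thesis by (simp add: AE_all_countable)
qed

definition knn :: "nat \<Rightarrow> nat \<Rightarrow> 'w \<Rightarrow> real" where
  "knn N i \<omega> = nn_dist k (X i \<omega>) ((\<lambda>j. X j \<omega>) ` {1..N})"

lemma knn_measurable [measurable]: "knn N i \<in> borel_measurable P"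
proof (rule borel_measurableI_le)
  fix r
  txt \<open>The indices of the first occurrences are in bijection with the values, and they keep the
    cardinalities measurable when sample points coincide.\<close>
  let ?J = "\<lambda>\<omega>. {j \<in> {1..N}. X j \<omega> \<noteq> X i \<omega> \<and> (\<forall>l\<in>{1..<j}. X l \<omega> \<noteq> X j \<omega>)}"
  have bij: "bij_betw (\<lambda>j. X j \<omega>) (?J \<omega>) ((\<lambda>j. X j \<omega>) ` {1..N} - {X i \<omega>})" for \<omega>
  proof (rule bij_betw_imageI)
    show "inj_on (\<lambda>j. X j \<omega>) (?J \<omega>)"
    proof (rule inj_onI)
      fix a b assume ab: "a \<in> ?J \<omega>" "b \<in> ?J \<omega>" "X a \<omega> = X b \<omega>"
      then have "\<not> a < b" "\<not> b < a" by force+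
      then show "a = b" by simp
    qed
    show "(\<lambda>j. X j \<omega>) ` ?J \<omega> = (\<lambda>j. X j \<omega>) ` {1..N} - {X i \<omega>}"
    proof (intro equalityI subsetI)
      fix y assume y: "y \<in> (\<lambda>j. X j \<omega>) ` {1..N} - {X i \<omega>}"
      then have ex: "\<exists>j. j \<in> {1..N} \<and> X j \<omega> = y" by auto
      define j where "j = (LEAST j. j \<in> {1..N} \<and> X j \<omega> = y)"
      have j: "j \<in> {1..N}" "X j \<omega> = y" using LeastI_ex[OF ex] by (auto simp: j_def)
      have "X l \<omega> \<noteq> X j \<omega>" if "l \<in> {1..<j}" for l
      proof -
        have "l < j" using that by simp
        then have "\<not> (l \<in> {1..N} \<and> X l \<omega> = y)" unfolding j_def by (rule not_less_Least)
        then show ?thesis using that j by auto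
      qed
      then have "j \<in> ?J \<omega>" using j y by auto
      then show "y \<in> (\<lambda>j. X j \<omega>) ` ?J \<omega>" using j(2) by blast
    qed auto
  qed
  have card1: "card ((\<lambda>j. X j \<omega>) ` {1..N} - {X i \<omega>}) = card (?J \<omega>)" for \<omega>
    using bij_betw_same_card[OF bij] by simp
  have card2: "card {y \<in> (\<lambda>j. X j \<omega>) ` {1..N} - {X i \<omega>}. dist (X i \<omega>) y \<le> r} =
      card {j \<in> ?J \<omega>. dist (X i \<omega>) (X j \<omega>) \<le> r}" for \<omega>
  proof -
    have "{y \<in> (\<lambda>j. X j \<omega>) ` {1..N} - {X i \<omega>}. dist (X i \<omega>) y \<le> r} =
        (\<lambda>j. X j \<omega>) ` {j \<in> ?J \<omega>. dist (X i \<omega>) (X j \<omega>) \<le> r}"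
      unfolding bij_betw_imp_surj_on[OF bij, symmetric] by auto
    moreover have "inj_on (\<lambda>j. X j \<omega>) {j \<in> ?J \<omega>. dist (X i \<omega>) (X j \<omega>) \<le> r}"
      by (rule inj_on_subset[OF bij_betw_imp_inj_on[OF bij]]) blast
    ultimately show ?thesis by (simp only: card_image)
  qed
  have [measurable]: "(\<lambda>\<omega>. card (?J \<omega>)) \<in> measurable P (count_space UNIV)"
  proof (rule measurable_card)
    fix j
    have "{\<omega> \<in> space P. j \<in> {1..N} \<and> X j \<omega> \<noteq> X i \<omega> \<and> (\<forall>l\<in>{1..<j}. X l \<omega> \<noteq> X j \<omega>)} \<in> sets P" by measurable
    then show "{\<omega> \<in> space P. j \<in> ?J \<omega>} \<in> sets P" by simp
  qed
  have [measurable]: "(\<lambda>\<omega>. card {j \<in> ?J \<omega>. dist (X i \<omega>) (X j \<omega>) \<le> r}) \<in> measurable P (count_space UNIV)"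
  proof (rule measurable_card)
    fix j
    have "{\<omega> \<in> space P. j \<in> {1..N} \<and> X j \<omega> \<noteq> X i \<omega> \<and> (\<forall>l\<in>{1..<j}. X l \<omega> \<noteq> X j \<omega>) \<and> dist (X i \<omega>) (X j \<omega>) \<le> r} \<in> sets P" by measurable
    then show "{\<omega> \<in> space P. j \<in> {j \<in> ?J \<omega>. dist (X i \<omega>) (X j \<omega>) \<le> r}} \<in> sets P" by simp
  qed
  have "{\<omega> \<in> space P. knn N i \<omega> \<le> r} =
      {\<omega> \<in> space P. if k \<le> card (?J \<omega>) then k \<le> card {j \<in> ?J \<omega>. dist (X i \<omega>) (X j \<omega>) \<le> r} else 0 \<le> r}"
    unfolding knn_def nn_dist_le_iff[OF finite_imageI[OF finite_atLeastAtMost] k] card1 card2 ..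
  also have "\<dots> \<in> sets P" by measurable
  finally show "{\<omega> \<in> space P. knn N i \<omega> \<le> r} \<in> sets P" .
qed

lemma knn_le_iff:
  assumes distinct: "\<And>i j. i \<noteq> j \<Longrightarrow> X i \<omega> \<noteq> X j \<omega>" and n: "k \<le> n" and i: "i \<in> {1..Suc n}"
  shows "knn (Suc n) i \<omega> \<le> r \<longleftrightarrow> \<not> few (Suc n) r i \<omega>"
proof -
  have inj: "inj_on (\<lambda>j. X j \<omega>) A" for A using distinct by (auto simp: inj_on_def)
  have F: "(\<lambda>j. X j \<omega>) ` {1..Suc n} - {X i \<omega>} = (\<lambda>j. X j \<omega>) ` ({1..Suc n} - {i})"
    using i distinct by auto
  have "{y \<in> (\<lambda>j. X j \<omega>) ` ({1..Suc n} - {i}). dist (X i \<omega>) y \<le> r} =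
      (\<lambda>j. X j \<omega>) ` {j \<in> {1..Suc n} - {i}. dist (X i \<omega>) (X j \<omega>) \<le> r}" by auto
  then have "card {y \<in> (\<lambda>j. X j \<omega>) ` ({1..Suc n} - {i}). dist (X i \<omega>) y \<le> r} =
      card {j \<in> {1..Suc n} - {i}. dist (X i \<omega>) (X j \<omega>) \<le> r}"
    by (simp add: card_image[OF inj])
  moreover have "card ((\<lambda>j. X j \<omega>) ` ({1..Suc n} - {i})) = n"
    using i by (simp add: card_image[OF inj])
  ultimately show ?thesis
    using n unfolding knn_def few_def nn_dist_le_iff[OF finite_imageI[OF finite_atLeastAtMost] k] F by auto
qed

text \<open>The estimator and its limit are both compared with the same step at 0, which cancels in
  the difference.\<close>

lemma knn_entropy_error:
  assumes distinct: "\<And>i j. i \<noteq> j \<Longrightarrow> X i \<omega> \<noteq> X j \<omega>" and n: "k \<le> n" and vol: "v = unit_ball_vol (real m)"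
  shows "has_bochner_integral lborel (\<lambda>s. few_fraction (Suc n) (radius n s) \<omega> - limit_fraction s)
     (knn_entropy m k (Suc n) (\<lambda>i. X i \<omega>) - - (\<integral>x. ln (f x) \<partial>\<mu>))"
proof -
  let ?W = "\<lambda>i. v * real n * knn (Suc n) i \<omega> ^ m"
  have n0: "0 < n" using n k by simp
  \<comment> \<open>At a distance 0 the default value \<open>ln 0 = 0\<close> would break both the
    level equivalence \<open>few\<close> and the splitting of the logarithm.\<close>
  have pos: "0 < knn (Suc n) i \<omega>" if "i \<in> {1..Suc n}" for i
  proof -
    have "{j \<in> {1..Suc n} - {i}. dist (X i \<omega>) (X j \<omega>) \<le> 0} = {}" using distinct by auto
    then have "few (Suc n) 0 i \<omega>" using k by (simp only: few_def card.empty)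
    then show ?thesis using knn_le_iff[OF distinct n that, of 0] by simp
  qed
  have few: "few (Suc n) (radius n s) i \<omega> \<longleftrightarrow> s < ln (?W i)" if i: "i \<in> {1..Suc n}" for i s
  proof -
    have "s < ln (?W i) \<longleftrightarrow> exp s < ?W i"
      using pos[OF i] v n0 by (metis exp_less_cancel_iff exp_ln mult_pos_pos of_nat_0_less_iff zero_less_power)
    also have "\<dots> \<longleftrightarrow> radius n s ^ m < knn (Suc n) i \<omega> ^ m"
      unfolding radius_power[OF n0] using v n0 by (simp add: pos_divide_less_eq mult.commute)
    also have "\<dots> \<longleftrightarrow> radius n s < knn (Suc n) i \<omega>"
      using power_mono_iff[of "knn (Suc n) i \<omega>" "radius n s" m] m radius_pos[OF n0, of s] pos[OF i]
      by (meson less_imp_le not_le)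
    also have "\<dots> \<longleftrightarrow> few (Suc n) (radius n s) i \<omega>"
      using knn_le_iff[OF distinct n i, of "radius n s"] by auto
    finally show ?thesis by simp
  qed
  have "has_bochner_integral lborel (\<lambda>s. \<Sum>i\<in>{1..Suc n}. of_bool (s < ln (?W i)) - of_bool (s \<le> 0)) (\<Sum>i\<in>{1..Suc n}. ln (?W i))"
    by (intro has_bochner_integral_sum step_integral(1))
  then have "has_bochner_integral lborel (\<lambda>s. (\<Sum>i\<in>{1..Suc n}. of_bool (s < ln (?W i)) - of_bool (s \<le> 0)) / real (Suc n))
      ((\<Sum>i\<in>{1..Suc n}. ln (?W i)) / real (Suc n))"
    by (rule has_bochner_integral_divide_zero)
  moreover have "(\<Sum>i\<in>{1..Suc n}. of_bool (s < ln (?W i)) - of_bool (s \<le> 0)) / real (Suc n) =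
      few_fraction (Suc n) (radius n s) \<omega> - of_bool (s \<le> 0)" for s
  proof -
    have "(\<Sum>i\<in>{1..Suc n}. of_bool (s < ln (?W i))) = (\<Sum>i\<in>{1..Suc n}. of_bool (few (Suc n) (radius n s) i \<omega>) :: real)"
      using few by (intro sum.cong) auto
    then show ?thesis
      unfolding few_fraction_def by (simp add: sum_subtractf diff_divide_distrib del: sum.cl_ivl_Suc sum_of_bool_eq)
  qed
  ultimately have "has_bochner_integral lborel (\<lambda>s. few_fraction (Suc n) (radius n s) \<omega> - of_bool (s \<le> 0))
      ((\<Sum>i\<in>{1..Suc n}. ln (?W i)) / real (Suc n))"
    by simp
  from has_bochner_integral_diff[OF this limit_fraction_integral]
  have "has_bochner_integral lborel (\<lambda>s. few_fraction (Suc n) (radius n s) \<omega> - limit_fraction s)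
     ((\<Sum>i\<in>{1..Suc n}. ln (?W i)) / real (Suc n) - (knn_psi k - (\<integral>x. ln (f x) \<partial>\<mu>)))"
    by simp
  then have "has_bochner_integral lborel (\<lambda>s. few_fraction (Suc n) (radius n s) \<omega> - limit_fraction s)
     ((\<Sum>i\<in>{1..Suc n}. ln (?W i)) / real (Suc n) - knn_psi k - - (\<integral>x. ln (f x) \<partial>\<mu>))"
    by (simp only: diff_diff_eq2 diff_minus_eq_add diff_add_eq)
  moreover have "knn_entropy m k (Suc n) (\<lambda>i. X i \<omega>) = (\<Sum>i\<in>{1..Suc n}. ln (?W i)) / real (Suc n) - knn_psi k"
  proof -
    have "ln (knn (Suc n) i \<omega> ^ m * v * real n * exp (- knn_psi k)) = ln (?W i) - knn_psi k" if "i \<in> {1..Suc n}" for i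
    proof -
      have "knn (Suc n) i \<omega> ^ m * v * real n * exp (- knn_psi k) = ?W i * exp (- knn_psi k)" by simp
      also have "ln \<dots> = ln (?W i) + ln (exp (- knn_psi k))"
        using pos[OF that] v n0 by (intro ln_mult_pos) simp_all
      also have "\<dots> = ln (?W i) - knn_psi k" unfolding ln_exp by (rule add_uminus_conv_diff)
      finally show ?thesis .
    qed
    then have "(\<Sum>i=1..Suc n. ln (knn (Suc n) i \<omega> ^ m * v * real n * exp (- knn_psi k))) = (\<Sum>i\<in>{1..Suc n}. ln (?W i) - knn_psi k)"
      by (rule sum.cong[OF refl])
    also have "\<dots> = (\<Sum>i\<in>{1..Suc n}. ln (?W i)) - real (Suc n) * knn_psi k"
      by (simp add: sum_subtractf del: sum.cl_ivl_Suc)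
    finally have sum: "(\<Sum>i=1..Suc n. ln (knn (Suc n) i \<omega> ^ m * v * real n * exp (- knn_psi k))) = \<dots>" .
    have "knn_entropy m k (Suc n) (\<lambda>i. X i \<omega>) = 1 / real (Suc n) * (\<Sum>i=1..Suc n. ln (knn (Suc n) i \<omega> ^ m * v * real n * exp (- knn_psi k)))"
      unfolding knn_entropy_def knn_def vol by simp
    also have "\<dots> = (\<Sum>i\<in>{1..Suc n}. ln (?W i)) / real (Suc n) - knn_psi k"
      unfolding sum by (simp add: right_diff_distrib del: sum.cl_ivl_Suc of_nat_Suc)
    finally show ?thesis .
  qed
  ultimately show ?thesis by (simp only:)
qed

lemma few_fraction_jointly_measurable [measurable]:
  "(\<lambda>(s, \<omega>). few_fraction N (radius n s) \<omega>) \<in> borel_measurable (borel \<Otimes>\<^sub>M P)"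
proof -
  have [measurable]: "Measurable.pred (borel \<Otimes>\<^sub>M P) (\<lambda>x. few N (radius n (fst x)) i (snd x))" for i
  proof -
    have [measurable]: "(\<lambda>x. card {j \<in> {1..N} - {i}. dist (X i (snd x)) (X j (snd x)) \<le> radius n (fst x)}) \<in> measurable (borel \<Otimes>\<^sub>M P) (count_space UNIV)"
    proof (rule measurable_card)
      fix j
      have "{x \<in> space (borel \<Otimes>\<^sub>M P). j \<in> {1..N} - {i} \<and> dist (X i (snd x)) (X j (snd x)) \<le> radius n (fst x)} \<in> sets (borel \<Otimes>\<^sub>M P)"
        by measurable
      then show "{x \<in> space (borel \<Otimes>\<^sub>M P). j \<in> {j \<in> {1..N} - {i}. dist (X i (snd x)) (X j (snd x)) \<le> radius n (fst x)}} \<in> sets (borel \<Otimes>\<^sub>M P)"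
        by simp
    qed
    show ?thesis unfolding few_def by measurable
  qed
  show ?thesis
    unfolding few_fraction_def split_beta by measurable
qed

lemma limit_fraction_measurable [measurable]: "limit_fraction \<in> borel_measurable borel"
proof -
  have "(\<lambda>s. \<integral>x. poisson_less k (exp s * f x) \<partial>\<mu>) \<in> borel_measurable borel"
    by (rule mu.borel_measurable_lebesgue_integral) measurable
  then show ?thesis by (simp add: limit_fraction_def[abs_def])
qed

text \<open>The bound is proved for the nonnegative integral, so it also shows that the squared
  error is integrable for large \<open>N\<close>; the real expectation alone would not, being 0 by
  default otherwise.\<close>

theorem knn_entropy_mean_square:
  assumes vol: "v = unit_ball_vol (real m)"
  defines "H \<equiv> - (\<integral>x. ln (f x) \<partial>\<mu>)"
  shows "(\<forall>\<^sub>F N in sequentially. integrable P (\<lambda>\<omega>. (knn_entropy m k N (\<lambda>i. X i \<omega>) - H)\<^sup>2)) \<and>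
    (\<lambda>N. expectation (\<lambda>\<omega>. (knn_entropy m k N (\<lambda>i. X i \<omega>) - H)\<^sup>2)) \<longlonglongrightarrow> 0"
proof -
  let ?E = "\<lambda>N \<omega>. (knn_entropy m k N (\<lambda>i. X i \<omega>) - H)\<^sup>2"
  let ?D = "\<lambda>n s \<omega>. few_fraction (Suc (Suc n)) (radius (Suc n) s) \<omega> - limit_fraction s"
  define e where "e s = exp (\<bar>s\<bar> / 2)" for s :: real
  have [measurable]: "e \<in> borel_measurable borel" unfolding e_def by measurable
  define Z where "Z = (\<integral>\<^sup>+s. ennreal (exp (- \<bar>s\<bar> / 2)) \<partial>lborel)"
  have Z: "Z < \<infinity>"
    using exp_neg_abs_integrable by (simp add: Z_def nn_integral_eq_integral)
  interpret Q: pair_sigma_finite lborel P ..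
  have meas: "?E N \<in> borel_measurable P" for N
    unfolding knn_entropy_def knn_def[symmetric] by measurable
  obtain C where C: "0 \<le> C"
    "\<And>n s. k \<le> n \<Longrightarrow> expectation (\<lambda>\<omega>. (few_fraction (Suc n) (radius n s) \<omega> - limit_fraction s)\<^sup>2) \<le> C * exp (- \<bar>s\<bar>)"
    by (rule fraction_tails) blast
  let ?I = "\<lambda>n. \<integral>\<^sup>+s. ennreal (e s * expectation (\<lambda>\<omega>. (?D n s \<omega>)\<^sup>2)) \<partial>lborel"
  have D_meas [measurable]: "(\<lambda>(s, \<omega>). ?D n s \<omega>) \<in> borel_measurable (borel \<Otimes>\<^sub>M P)" for n
    by measurable
  have expD_meas: "(\<lambda>s. expectation (\<lambda>\<omega>. (?D n s \<omega>)\<^sup>2)) \<in> borel_measurable borel" for n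
    by (rule borel_measurable_lebesgue_integral) measurable
  have F_bound: "\<bar>limit_fraction s\<bar> \<le> 1" for s
    using limit_fraction_bounds[of s] by simp
  have bound: "(\<integral>\<^sup>+\<omega>. ennreal (?E (Suc (Suc n)) \<omega>) \<partial>P) \<le> Z * ?I n" if n: "k \<le> Suc n" for n
  proof -
    have "(\<integral>\<^sup>+\<omega>. ennreal (?E (Suc (Suc n)) \<omega>) \<partial>P) \<le> (\<integral>\<^sup>+\<omega>. Z * (\<integral>\<^sup>+s. ennreal (e s * (?D n s \<omega>)\<^sup>2) \<partial>lborel) \<partial>P)"
    proof (rule nn_integral_mono_AE)
      show "AE \<omega> in P. ennreal (?E (Suc (Suc n)) \<omega>) \<le> Z * (\<integral>\<^sup>+s. ennreal (e s * (?D n s \<omega>)\<^sup>2) \<partial>lborel)"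
        using AE_distinct AE_space
      proof eventually_elim
        case (elim \<omega>)
        have [measurable]: "(\<lambda>s. ?D n s \<omega>) \<in> borel_measurable borel"
          using measurable_Pair_compose_split[OF D_meas[of n] measurable_ident measurable_const[OF elim(2)]] by simp
        have hb: "has_bochner_integral lborel (\<lambda>s. ?D n s \<omega>) (knn_entropy m k (Suc (Suc n)) (\<lambda>i. X i \<omega>) - H)"
          unfolding H_def by (rule knn_entropy_error[OF _ n vol]) (use elim in auto)
        have "ennreal \<bar>knn_entropy m k (Suc (Suc n)) (\<lambda>i. X i \<omega>) - H\<bar> \<le> (\<integral>\<^sup>+s. ennreal \<bar>?D n s \<omega>\<bar> \<partial>lborel)"
          using integral_norm_bound_ennreal[of lborel "\<lambda>s. ?D n s \<omega>"] hb by (simp add: has_bochner_integral_iff)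
        \<comment> \<open>Cauchy-Schwarz squares both factors and so doubles the exponents: the
          first square integrates to \<open>Z\<close>, the second carries the weight
          \<open>e\<close>.\<close>
        also have "\<dots> = (\<integral>\<^sup>+s. ennreal (exp (- \<bar>s\<bar> / 4)) * ennreal (exp (\<bar>s\<bar> / 4) * \<bar>?D n s \<omega>\<bar>) \<partial>lborel)"
          by (intro nn_integral_cong) (simp add: ennreal_mult[symmetric] mult.assoc[symmetric] exp_add[symmetric])
        finally have "(ennreal \<bar>knn_entropy m k (Suc (Suc n)) (\<lambda>i. X i \<omega>) - H\<bar>)\<^sup>2 \<le>
            (\<integral>\<^sup>+s. ennreal (exp (- \<bar>s\<bar> / 4)) * ennreal (exp (\<bar>s\<bar> / 4) * \<bar>?D n s \<omega>\<bar>) \<partial>lborel)\<^sup>2"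
          by (rule power_mono) simp
        also have "\<dots> \<le> (\<integral>\<^sup>+s. (ennreal (exp (- \<bar>s\<bar> / 4)))\<^sup>2 \<partial>lborel) * (\<integral>\<^sup>+s. (ennreal (exp (\<bar>s\<bar> / 4) * \<bar>?D n s \<omega>\<bar>))\<^sup>2 \<partial>lborel)"
          by (rule Cauchy_Schwarz_nn_integral) measurable
        also have "(\<integral>\<^sup>+s. (ennreal (exp (- \<bar>s\<bar> / 4)))\<^sup>2 \<partial>lborel) = Z"
          unfolding Z_def by (intro nn_integral_cong) (simp add: ennreal_power exp_double[symmetric])
        also have "(\<integral>\<^sup>+s. (ennreal (exp (\<bar>s\<bar> / 4) * \<bar>?D n s \<omega>\<bar>))\<^sup>2 \<partial>lborel) = (\<integral>\<^sup>+s. ennreal (e s * (?D n s \<omega>)\<^sup>2) \<partial>lborel)"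
          unfolding e_def by (intro nn_integral_cong) (simp add: ennreal_power power_mult_distrib exp_double[symmetric])
        finally show ?case by (simp add: ennreal_power)
      qed
    qed
    also have "\<dots> = Z * (\<integral>\<^sup>+\<omega>. (\<integral>\<^sup>+s. ennreal (e s * (?D n s \<omega>)\<^sup>2) \<partial>lborel) \<partial>P)"
      by (rule nn_integral_cmult) measurable
    also have "(\<integral>\<^sup>+\<omega>. (\<integral>\<^sup>+s. ennreal (e s * (?D n s \<omega>)\<^sup>2) \<partial>lborel) \<partial>P) = (\<integral>\<^sup>+s. (\<integral>\<^sup>+\<omega>. ennreal (e s * (?D n s \<omega>)\<^sup>2) \<partial>P) \<partial>lborel)"
      by (rule Q.Fubini') measurable
    also have "\<dots> = ?I n"
    proof (rule nn_integral_cong)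
      fix s
      have "integrable P (\<lambda>\<omega>. (?D n s \<omega>)\<^sup>2)"
      proof (rule integrable_const_bound[of _ 4])
        show "AE \<omega> in P. norm ((?D n s \<omega>)\<^sup>2) \<le> 4"
        proof (rule AE_I2)
          fix \<omega>
          have "\<bar>?D n s \<omega>\<bar> \<le> 2"
            using few_fraction_bounds[of "Suc (Suc n)" "radius (Suc n) s" \<omega>] F_bound[of s] by linarith
          then have "\<bar>?D n s \<omega>\<bar>\<^sup>2 \<le> 2\<^sup>2" by (intro power_mono) auto
          then show "norm ((?D n s \<omega>)\<^sup>2) \<le> 4" by simp
        qed
      qed measurable
      then have "integrable P (\<lambda>\<omega>. e s * (?D n s \<omega>)\<^sup>2)" by simp
      then have "(\<integral>\<^sup>+\<omega>. ennreal (e s * (?D n s \<omega>)\<^sup>2) \<partial>P) = ennreal (expectation (\<lambda>\<omega>. e s * (?D n s \<omega>)\<^sup>2))"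
        by (intro nn_integral_eq_integral) (auto simp: e_def)
      then show "(\<integral>\<^sup>+\<omega>. ennreal (e s * (?D n s \<omega>)\<^sup>2) \<partial>P) = ennreal (e s * expectation (\<lambda>\<omega>. (?D n s \<omega>)\<^sup>2))"
        by simp
    qed
    finally show ?thesis .
  qed
  \<comment> \<open>The tail bound requires at least \<open>k\<close> other points; the shift by
    \<open>k\<close> makes it available for every \<open>n\<close>.\<close>
  have "(\<lambda>n. ?I (n + k)) \<longlonglongrightarrow> (\<integral>\<^sup>+s. 0 \<partial>(lborel :: real measure))"
  proof (rule nn_integral_dominated_convergence[where w = "\<lambda>s. ennreal (C * exp (- \<bar>s\<bar> / 2))"])
    show "AE s in lborel. ennreal (e s * expectation (\<lambda>\<omega>. (?D (n + k) s \<omega>)\<^sup>2)) \<le> ennreal (C * exp (- \<bar>s\<bar> / 2))" for n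
    proof (rule AE_I2, rule ennreal_leI)
      fix s
      have "e s * expectation (\<lambda>\<omega>. (?D (n + k) s \<omega>)\<^sup>2) \<le> e s * (C * exp (- \<bar>s\<bar>))"
        by (intro mult_left_mono C(2)) (auto simp: e_def)
      also have "\<dots> = C * exp (- \<bar>s\<bar> / 2)"
        by (simp add: e_def mult.left_commute exp_add[symmetric])
      finally show "e s * expectation (\<lambda>\<omega>. (?D (n + k) s \<omega>)\<^sup>2) \<le> C * exp (- \<bar>s\<bar> / 2)" .
    qed
    have "(\<integral>\<^sup>+s. ennreal (C * exp (- \<bar>s\<bar> / 2)) \<partial>lborel) = ennreal C * Z"
      unfolding Z_def using C(1) by (subst nn_integral_cmult[symmetric]) (auto simp: ennreal_mult)
    then show "(\<integral>\<^sup>+s. ennreal (C * exp (- \<bar>s\<bar> / 2)) \<partial>lborel) < \<infinity>"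
      using Z by (simp add: ennreal_mult_less_top)
    show "AE s in lborel. (\<lambda>n. ennreal (e s * expectation (\<lambda>\<omega>. (?D (n + k) s \<omega>)\<^sup>2))) \<longlonglongrightarrow> 0"
    proof (rule AE_I2)
      fix s
      have "(\<lambda>n. expectation (\<lambda>\<omega>. (?D (n + k) s \<omega>)\<^sup>2)) \<longlonglongrightarrow> 0"
        by (rule LIMSEQ_ignore_initial_segment[OF mean_square_tendsto])
      from tendsto_ennrealI[OF tendsto_mult_left[OF this, of "e s"]]
      show "(\<lambda>n. ennreal (e s * expectation (\<lambda>\<omega>. (?D (n + k) s \<omega>)\<^sup>2))) \<longlonglongrightarrow> 0" by simp
    qed
  qed (use expD_meas in measurable)
  then have "(\<lambda>n. ?I (n + k)) \<longlonglongrightarrow> 0" by simp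
  then have "?I \<longlonglongrightarrow> 0" by (rule LIMSEQ_offset)
  then have "(\<lambda>n. Z * ?I n) \<longlonglongrightarrow> Z * 0"
    using Z by (intro tendsto_mult_ennreal tendsto_const) auto
  then have ZI: "(\<lambda>n. Z * ?I n) \<longlonglongrightarrow> 0" by simp
  have lim: "(\<lambda>n. \<integral>\<^sup>+\<omega>. ennreal (?E (Suc (Suc n)) \<omega>) \<partial>P) \<longlonglongrightarrow> 0"
  proof (rule tendsto_sandwich[OF _ _ tendsto_const ZI])
    show "\<forall>\<^sub>F n in sequentially. (\<integral>\<^sup>+\<omega>. ennreal (?E (Suc (Suc n)) \<omega>) \<partial>P) \<le> Z * ?I n"
      by (rule eventually_sequentiallyI[of k]) (rule bound, simp)
  qed simp
  have "\<forall>\<^sub>F n in sequentially. (\<integral>\<^sup>+\<omega>. ennreal (?E (Suc (Suc n)) \<omega>) \<partial>P) < 1"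
    by (rule order_tendstoD(2)[OF lim]) simp
  then have "\<forall>\<^sub>F n in sequentially. integrable P (?E (Suc (Suc n)))"
  proof eventually_elim
    case (elim n)
    show ?case
      by (rule integrableI_nonneg[OF meas]) (use elim in \<open>auto intro: less_trans[OF _ ennreal_one_less_top]\<close>)
  qed
  then have int: "\<forall>\<^sub>F N in sequentially. integrable P (?E N)"
    by (simp only: eventually_sequentially_Suc[of "\<lambda>n. integrable P (?E (Suc n))"] eventually_sequentially_Suc[of "\<lambda>n. integrable P (?E n)"])
  have "(\<lambda>n. enn2real (\<integral>\<^sup>+\<omega>. ennreal (?E (Suc (Suc n)) \<omega>) \<partial>P)) \<longlonglongrightarrow> 0"
    using lim by (intro tendsto_enn2real) simp_all
  moreover have "enn2real (\<integral>\<^sup>+\<omega>. ennreal (?E N \<omega>) \<partial>P) = expectation (?E N)" for N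
    using meas[of N] by (simp add: integral_eq_nn_integral)
  ultimately have "(\<lambda>n. expectation (?E (Suc (Suc n)))) \<longlonglongrightarrow> 0" by simp
  then have "(\<lambda>N. expectation (?E N)) \<longlonglongrightarrow> 0"
    by (simp only: filterlim_sequentially_Suc[of "\<lambda>n. expectation (?E (Suc n))"] filterlim_sequentially_Suc[of "\<lambda>n. expectation (?E n)"])
  with int show ?thesis by blast
qed

end

section \<open>Manifolds\<close>

text \<open>For \<open>0 < t < 1\<close> this comes from \<open>ln (1 / t) \<le> 1 / t - 1\<close>,
  for \<open>t \<ge> 1\<close> from \<open>ln t \<le> t\<close>. It makes \<open>f * ln f\<close>
  integrable for a bounded density and a finite measure.\<close>

lemma abs_mult_ln_le:
  fixes t :: real
  assumes "0 \<le> t" "t \<le> B"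
  shows "\<bar>t * ln t\<bar> \<le> 1 + B * B"
proof (cases "t < 1")
  case True
  show ?thesis
  proof (cases "t = 0")
    case False
    then have t: "0 < t" using assms by simp
    have "- ln t \<le> 1 / t - 1"
      using ln_le_minus_one[of "1 / t"] t by (simp add: ln_div)
    then have "t * - ln t \<le> t * (1 / t - 1)" using t by (intro mult_left_mono) auto
    also have "\<dots> = 1 - t" using t by (simp add: right_diff_distrib)
    finally have "\<bar>t * ln t\<bar> \<le> 1" using t True by (simp add: abs_mult)
    then show ?thesis by (rule order_trans) simp
  qed simp
next
  case False
  then have "0 \<le> ln t" "ln t \<le> t" using ln_le_minus_one[of t] by auto
  then have "\<bar>t * ln t\<bar> \<le> B * B"
    using assms False by (auto simp: abs_mult intro!: mult_mono)
  then show ?thesis by simp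
qed

theorem theorem4p6:
  fixes M :: "(real ^ 'd) set"
    and I :: "'i set"
    and U :: "'i \<Rightarrow> (real ^ 'm) set"
    and g :: "'i \<Rightarrow> real ^ 'm \<Rightarrow> real ^ 'd"
    and p :: "'i \<Rightarrow> real ^ 'd \<Rightarrow> real"
    and \<nu> :: "(real ^ 'd) measure"
    and P :: "'w measure"
    and X :: "nat \<Rightarrow> 'w \<Rightarrow> real ^ 'd"
    and f :: "real ^ 'd \<Rightarrow> real"
    and k :: nat
  assumes "CARD('m) \<le> CARD('d)"
    and "C1_manifold TYPE('m) M"
    and "C1_atlas M I U g"
    and "partition_of_unity M I U g p"
    and "volume_measure M I U g p \<nu>"
    and "prob_space P"
    and "prob_space.indep_vars P (\<lambda>_. \<nu>) X UNIV"
    and "\<forall>x\<in>M. 0 \<le> f x"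
    and "\<forall>n. distributed P \<nu> (X n) (\<lambda>x. ennreal (f x))"
    and "bounded (f ` M)"
    and "compact ((top_of_set M) closure_of {x\<in>M. f x \<noteq> 0})"
    and "1 \<le> k"
  shows "(\<forall>\<^sub>F N in sequentially.
            integrable P (\<lambda>\<omega>. (knn_entropy CARD('m) k N (\<lambda>i. X i \<omega>) - shannon_entropy \<nu> f)\<^sup>2)) \<and>
         (\<lambda>N. prob_space.expectation P
            (\<lambda>\<omega>. (knn_entropy CARD('m) k N (\<lambda>i. X i \<omega>) - shannon_entropy \<nu> f)\<^sup>2))
          \<longlonglongrightarrow> 0"
proof -
  interpret prob_space P by fact
  interpret manifold_volume M I U g p \<nu> by unfold_locales fact+
  let ?m = "CARD('m)" and ?v = "unit_ball_vol (real CARD('m))"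
  let ?K = "(top_of_set M) closure_of {x\<in>M. f x \<noteq> 0}"
  have K: "compact ?K" "?K \<subseteq> M"
    using \<open>compact ?K\<close> closure_of_subset_topspace[of "top_of_set M"] by auto
  have f_off: "f x = 0" if "x \<in> M - ?K" for x
    using closure_of_subset[of "{x\<in>M. f x \<noteq> 0}" "top_of_set M"] that by auto
  obtain \<Lambda> c N0 where \<Lambda>: "finite_measure \<Lambda>" "sets \<Lambda> = sets borel" "0 < c"
    "\<And>x r. 0 < r \<Longrightarrow> measure \<Lambda> (cball x r) \<le> c * r ^ ?m"
    "\<And>x. x \<in> ?K \<Longrightarrow> ((\<lambda>r. measure \<Lambda> (cball x r) / (?v * r ^ ?m)) \<longlongrightarrow> 1) (at_right 0)"
    "fine_covers ?m N0 ?K"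
    "\<And>h. h \<in> borel_measurable borel \<Longrightarrow> (\<And>y. y \<in> M - ?K \<Longrightarrow> h y = 0) \<Longrightarrow> (\<integral>\<^sup>+y. h y \<partial>\<nu>) = (\<integral>\<^sup>+y. h y \<partial>\<Lambda>)"
    by (rule local_measure[OF K]) blast
  have Kb: "?K \<in> sets borel" using K(1) by (rule borel_compact)
  interpret \<Lambda>: ball_regular \<Lambda> ?m ?v c ?K
    by (rule ball_regular.intro[OF \<Lambda>(1)]) (unfold_locales, use \<Lambda>(2-5) Kb in auto)
  obtain B where B: "0 < B" "\<And>x. x \<in> M \<Longrightarrow> \<bar>f x\<bar> \<le> B"
    using \<open>bounded (f ` M)\<close> unfolding bounded_pos by auto
  have distrib: "distributed P \<nu> (X n) (\<lambda>x. ennreal (f x))" for n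
    using assms(9) by blast
  have f_pos: "0 \<le> f x" if "x \<in> M" for x using assms(8) that by blast
  have f_nu: "f \<in> borel_measurable \<nu>"
  proof -
    have "(\<lambda>x. enn2real (ennreal (f x))) \<in> borel_measurable \<nu>"
      using distributed_borel_measurable[OF distrib[of 0]] by measurable
    then show ?thesis
      by (rule measurable_cong[THEN iffD1, rotated]) (simp add: space_nu f_pos)
  qed
  \<comment> \<open>\<open>f\<close> is measurable on \<open>M\<close> and arbitrary outside. As it
    vanishes on \<open>M - ?K\<close>, this Borel function on the whole space equals it on
    \<open>M\<close>.\<close>
  define f0 where "f0 x = (if x \<in> ?K then f x else 0)" for x
  have f0_meas [measurable]: "f0 \<in> borel_measurable borel"
  proof -
    have "f \<in> borel_measurable (restrict_space borel M)"
      using f_nu by (simp add: measurable_cong_sets[OF sets_nu refl])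
    then have "f \<in> borel_measurable (restrict_space borel ?K)"
      using K(2) by (rule measurable_restrict_mono)
    then show ?thesis
      unfolding f0_def using Kb by (subst (asm) measurable_restrict_space_iff) auto
  qed
  have f0_eq: "f0 x = f x" if "x \<in> M" for x using f_off that by (auto simp: f0_def)
  have f0_nonneg: "0 \<le> f0 x" and f0_le: "f0 x \<le> B" for x
    using K(2) f_pos[of x] B(2)[of x] B(1) by (auto simp: f0_def)
  have X_nu [measurable]: "X n \<in> measurable P \<nu>" for n
    using distributed_measurable[OF distrib] .
  have id_nu: "(\<lambda>x. x) \<in> measurable \<nu> borel"
    by (rule borel_measurable_nu) simp
  have X_borel [measurable]: "X n \<in> borel_measurable P" for n
    using measurable_compose[OF X_nu id_nu] by simp
  define \<mu> where "\<mu> = density \<Lambda> (\<lambda>x. ennreal (f0 x))"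
  have f0_\<Lambda> [measurable]: "f0 \<in> borel_measurable \<Lambda>" by simp
  have f0_enn: "(\<lambda>x. ennreal (f0 x)) \<in> borel_measurable \<Lambda>"
    using f0_\<Lambda> by (rule measurable_compose) simp
  have sets_\<mu>: "sets \<mu> = sets borel" by (simp add: \<mu>_def \<Lambda>(2))
  have distr: "distr P borel (X n) = \<mu>" for n
  proof (rule measure_eqI)
    fix A assume "A \<in> sets (distr P borel (X n))"
    then have A[measurable]: "A \<in> sets borel" by simp
    have "emeasure (distr P borel (X n)) A = (\<integral>\<^sup>+x. indicator A x \<partial>distr P borel (X n))"
      by simp
    also have "\<dots> = (\<integral>\<^sup>+\<omega>. indicator A (X n \<omega>) \<partial>P)"
      by (rule nn_integral_distr) simp_all
    also have "\<dots> = (\<integral>\<^sup>+x. ennreal (f x) * indicator A x \<partial>\<nu>)"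
      by (rule distributed_nn_integral[OF distrib, symmetric]) (rule borel_measurable_nu, simp)
    also have "\<dots> = (\<integral>\<^sup>+x. ennreal (f0 x) * indicator A x \<partial>\<nu>)"
      by (intro nn_integral_cong) (simp add: space_nu f0_eq)
    also have "\<dots> = (\<integral>\<^sup>+x. ennreal (f0 x) * indicator A x \<partial>\<Lambda>)"
    proof (rule \<Lambda>(7))
      show "(\<lambda>x. ennreal (f0 x) * indicator A x) \<in> borel_measurable borel" by measurable
    qed (auto simp: f0_def)
    also have "\<dots> = emeasure \<mu> A"
      unfolding \<mu>_def by (subst emeasure_density[OF f0_enn]) (auto simp: \<Lambda>(2))
    finally show "emeasure (distr P borel (X n)) A = emeasure \<mu> A" .
  qed (simp add: sets_\<mu>)
  have \<mu>_ball: "measure \<mu> (cball x r) = (\<integral>y. (if dist x y \<le> r then f0 y else 0) \<partial>\<Lambda>)" for x r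
  proof -
    have "emeasure \<mu> (cball x r) = (\<integral>\<^sup>+y. ennreal (f0 y) * indicator (cball x r) y \<partial>\<Lambda>)"
      unfolding \<mu>_def by (subst emeasure_density[OF f0_enn]) (auto simp: \<Lambda>(2))
    also have "\<dots> = (\<integral>\<^sup>+y. ennreal (if dist x y \<le> r then f0 y else 0) \<partial>\<Lambda>)"
      by (intro nn_integral_cong) (auto simp: indicator_def)
    finally show ?thesis
      unfolding measure_def by (subst integral_eq_nn_integral) (auto simp: f0_nonneg)
  qed
  have f0_int: "integrable \<Lambda> f0"
    using f0_nonneg f0_le by (intro \<Lambda>.integrable_const_bound[of _ B]) auto
  interpret S: knn_sample P X \<mu> k ?m ?v "B * c" N0 B ?K f0
  proof unfold_locales
    show "random_variable borel (X n)" for n by (rule X_borel)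
    show "distr P borel (X n) = \<mu>" for n by (rule distr)
    have "indep_vars (\<lambda>_. borel) (\<lambda>i \<omega>. (\<lambda>x. x) (X i \<omega>)) UNIV"
      using assms(7) by (rule indep_vars_compose2) (rule id_nu)
    then show "indep_vars (\<lambda>_. borel) X UNIV" by simp
    show "0 < ?m" "0 < k" "0 < ?v" "0 < B * c"
      using assms(12) B(1) \<Lambda>(3) by auto
    show "measure \<mu> (cball x r) \<le> B * c * r ^ ?m" if r: "0 < r" for x r
    proof -
      have v0: "?v \<noteq> 0" using unit_ball_vol_pos[of "real ?m"] by (simp add: less_imp_neq[symmetric])
      have "measure \<mu> (cball x r) = \<Lambda>.average r f0 x * (?v * r ^ ?m)"
        unfolding \<mu>_ball \<Lambda>.average_def using r v0 by simp
      also have "\<dots> \<le> B * (measure \<Lambda> (cball x r) / (?v * r ^ ?m)) * (?v * r ^ ?m)"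
        using \<Lambda>.average_le[of f0 B r x] f0_nonneg f0_le r by (intro mult_right_mono) (auto simp: abs_le_iff)
      also have "\<dots> = B * measure \<Lambda> (cball x r)" using r v0 by simp
      also have "\<dots> \<le> B * (c * r ^ ?m)" using B(1) \<Lambda>(4)[OF r] by (intro mult_left_mono) auto
      finally show ?thesis by simp
    qed
    show "bounded ?K" using K(1) by (rule compact_imp_bounded)
    show "AE x in \<mu>. x \<in> ?K"
      unfolding \<mu>_def by (subst AE_density[OF f0_enn]) (auto simp: f0_def)
    show "fine_covers ?m N0 ?K" by (rule \<Lambda>(6))
    show "f0 \<in> borel_measurable borel" by (rule f0_meas)
    show "0 \<le> f0 x" "f0 x \<le> B" for x by (rule f0_nonneg f0_le)+
    show "AE x in \<mu>. 0 < f0 x"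
      unfolding \<mu>_def by (subst AE_density[OF f0_enn]) auto
    show "integrable \<mu> (\<lambda>x. ln (f0 x))"
    proof -
      have "integrable \<Lambda> (\<lambda>x. f0 x * ln (f0 x))"
        using abs_mult_ln_le[OF f0_nonneg f0_le] by (intro \<Lambda>.integrable_const_bound[of _ "1 + B * B"]) auto
      then show ?thesis
        unfolding \<mu>_def using f0_nonneg by (subst integrable_density) auto
    qed
    fix r :: "nat \<Rightarrow> real" assume r: "\<And>n. 0 < r n" "r \<longlonglongrightarrow> 0"
    let ?A = "\<lambda>n x. ennreal \<bar>measure \<mu> (cball x (r n)) / (?v * r n ^ ?m) - f0 x\<bar>"
    have A: "?A n x = ennreal \<bar>\<Lambda>.average (r n) f0 x - f0 x\<bar>" for n x
      by (simp add: \<mu>_ball \<Lambda>.average_def)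
    note [measurable] = \<Lambda>.borel_measurable_average[OF f0_meas]
    \<comment> \<open>Since \<open>f0\<close> is at most \<open>B\<close> and vanishes off
      \<open>?K\<close>, the error in mean for \<open>\<Lambda>\<close> on \<open>?K\<close>
      controls the error in mean for the law \<open>\<mu>\<close>.\<close>
    have "(\<lambda>n. ennreal B * (\<integral>\<^sup>+x\<in>?K. ennreal \<bar>\<Lambda>.average (r n) f0 x - f0 x\<bar> \<partial>\<Lambda>)) \<longlonglongrightarrow> ennreal B * 0"
      by (intro tendsto_mult_ennreal tendsto_const \<Lambda>.average_tendsto_L1 f0_int r) auto
    then have lim: "(\<lambda>n. ennreal B * (\<integral>\<^sup>+x\<in>?K. ennreal \<bar>\<Lambda>.average (r n) f0 x - f0 x\<bar> \<partial>\<Lambda>)) \<longlonglongrightarrow> 0" by simp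
    show "(\<lambda>n. \<integral>\<^sup>+x. ?A n x \<partial>\<mu>) \<longlonglongrightarrow> 0"
    proof (rule tendsto_sandwich[OF _ _ tendsto_const lim])
      have "(\<integral>\<^sup>+x. ?A n x \<partial>\<mu>) \<le> ennreal B * (\<integral>\<^sup>+x\<in>?K. ennreal \<bar>\<Lambda>.average (r n) f0 x - f0 x\<bar> \<partial>\<Lambda>)" for n
      proof -
        have "(\<integral>\<^sup>+x. ?A n x \<partial>\<mu>) = (\<integral>\<^sup>+x. ennreal (f0 x) * ennreal \<bar>\<Lambda>.average (r n) f0 x - f0 x\<bar> \<partial>\<Lambda>)"
          unfolding \<mu>_def[symmetric] A unfolding \<mu>_def by (rule nn_integral_density) simp_all
        also have "\<dots> \<le> (\<integral>\<^sup>+x. ennreal B * (ennreal \<bar>\<Lambda>.average (r n) f0 x - f0 x\<bar> * indicator ?K x) \<partial>\<Lambda>)"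
        proof (rule nn_integral_mono)
          fix x
          show "ennreal (f0 x) * ennreal \<bar>\<Lambda>.average (r n) f0 x - f0 x\<bar> \<le>
              ennreal B * (ennreal \<bar>\<Lambda>.average (r n) f0 x - f0 x\<bar> * indicator ?K x)"
          proof (cases "x \<in> ?K")
            case True
            then show ?thesis using mult_right_mono[OF ennreal_leI[OF f0_le[of x]]] by simp
          next
            case False
            then have "f0 x = 0" by (simp only: f0_def if_False)
            then show ?thesis by simp
          qed
        qed
        also have "\<dots> = ennreal B * (\<integral>\<^sup>+x\<in>?K. ennreal \<bar>\<Lambda>.average (r n) f0 x - f0 x\<bar> \<partial>\<Lambda>)"
          using Kb by (intro nn_integral_cmult) simp
        finally show ?thesis .
      qed
      then show "\<forall>\<^sub>F n in sequentially. (\<integral>\<^sup>+x. ?A n x \<partial>\<mu>) \<le> ennreal B * (\<integral>\<^sup>+x\<in>?K. ennreal \<bar>\<Lambda>.average (r n) f0 x - f0 x\<bar> \<partial>\<Lambda>)"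
        by simp
    qed simp
  qed
  \<comment> \<open>The index 0 lies outside the sample but has the same law. Points with
    \<open>f x = 0\<close> contribute nothing to either side, in line with the convention for
    \<open>0 log 0\<close>.\<close>
  have "shannon_entropy \<nu> f = - expectation (\<lambda>\<omega>. ln (f (X 0 \<omega>)))"
    unfolding shannon_entropy_def
    using f_nu f_pos by (subst distributed_integral[OF distrib[of 0]]) (auto simp: space_nu)
  also have "expectation (\<lambda>\<omega>. ln (f (X 0 \<omega>))) = expectation (\<lambda>\<omega>. ln (f0 (X 0 \<omega>)))"
    using measurable_space[OF X_nu[of 0]] by (intro Bochner_Integration.integral_cong) (auto simp: space_nu f0_eq)
  also have "\<dots> = (\<integral>x. ln (f0 x) \<partial>\<mu>)"
    unfolding distr[of 0, symmetric] by (rule integral_distr[symmetric]) simp_all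
  finally show ?thesis
    using S.knn_entropy_mean_square[OF refl] by simp
qed

end
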